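(* Let $a,c\in\mathbb{Z}$, $k,m,n\in\mathbb{N}$ with $km>n\ge1$, and suppose $f(x)=(x^k+c)^m-ax^n$ is irreducible over $\mathbb{Q}$. Let $\theta$ be a root of $f$, $K=\mathbb{Q}(\theta)$, $t=\gcd(n,k)$, $n=n_1t$, $k=k_1t$. Let $p$ be a prime dividing $\mathfrak{D}_f$. Then $p\nmid[\mathbb{Z}_K:\mathbb{Z}[\theta]]$ if and only if the condition below corresponding to the case into which $p$ falls holds: (i) If $p\mid c$ and $p\mid a$: $m=1$ and $p^2\nmid c$. (ii) If $p\mid c$, $p\nmid a$ and $n=1$: letting $j=v_p(km-1)$ (which is $\ge1$), $c_2=c/p$ and $a_1=(a^{p^j}-a)/p$, either ($p\mid c_2$ and $p\nmid a_1$) or $p\nmid c_2\,[a^k a_1^{km-1}-(-mac_2)^{km-1}]$. (iii) If $p\mid c$, $p\nmid a$ and $n\ge2$: $m=1$, and, with $\ell=v_p(k-n)\ge0$, $c_2=c/p$ and $a_1=(a^{p^\ell}-a)/p$, either ($p\mid a_1$ and $p\nmid c_2$) or $p\nmid a_1c_2^{\,n-1}[a^{n_1}a_1^{k_1-n_1}-(-c_2)^{k_1-n_1}]$. (iv) If $p\nmid c$ and $p\mid a$: (a) if $m\ge2$, then $p^2\nmid a$; (b) if $m=1$, then, with $\ell=v_p(k)$ (which is $\ge1$), $a_2=-a/p$ and $c_1=((-c)^{p^\ell}+c)/p$, either ($p\mid a_2$ and $p\nmid c_1$) or $p\nmid a_2[a_2^{k_1}(-c)^{n_1}-(-c_1)^{k_1}]$.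 (v) If $p\nmid ca$ and $p\mid k$: write $k=p^js'$, $n=p^js$ with $j\ge1$ and $p\nmid\gcd(s,s')$; let $a_1=(a^{p^j}-a)/p$ and $t(x)=\frac1p\left(\sum_{i=0}^{p^j-1}\binom{p^j}{i}x^{s'i}c^{p^j-i}-c\right)\in\mathbb{Z}[x]$. Then the reductions modulo $p$ of the polynomials $\frac1p\left[pa_1x^n-pm\,t(x)(x^k+c)^{m-1}\right]=a_1x^n-m\,t(x)(x^k+c)^{m-1}$ and $(x^{s'}+c)^m-ax^s$ are coprime in $\mathbb{F}_p[x]$. (vi) If $p\nmid cak$ and $p\mid m$: $p\mid n$ and $p^2\nmid(a^p-a)$. (vii) If $p\nmid cakm$: $p^2\nmid(\mathcal{C}-\mathcal{E})$. Consequently, $\mathbb{Z}_K=\mathbb{Z}[\theta]$ if and only if every prime dividing $\mathfrak{D}_f$ satisfies its corresponding condition.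
   Context: $\mathfrak{D}_f$ is the discriminant of $f$; $\mathbb{Z}_K$ is the ring of integers of $K$; $v_p$ is the $p$-adic valuation. $\mathcal{C}=(km)^{k_1m}c^{k_1m-n_1}$ and $\mathcal{E}=a^{k_1}n^{n_1}(km-n)^{k_1m-n_1}$. *)

theory Defs
  imports "HOL-Computational_Algebra.Computational_Algebra"
          "Subresultants.Resultant_Prelim"
          "Berlekamp_Zassenhaus.Poly_Mod"
begin

definition fpoly :: "int \<Rightarrow> int \<Rightarrow> nat \<Rightarrow> nat \<Rightarrow> nat \<Rightarrow> int poly" where
  "fpoly a c k m n = (monom 1 k + [:c:]) ^ m - monom a n"

definition disc :: "int poly \<Rightarrow> int" where
  "disc f = ((-1) ^ (degree f * (degree f - 1) div 2) * resultant f (pderiv f)) div lead_coeff f"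

definition QQ_adj :: "complex \<Rightarrow> complex set" where
  "QQ_adj \<theta> = {poly (map_poly of_rat q) \<theta> | q :: rat poly. True}"

definition ZZ_adj :: "complex \<Rightarrow> complex set" where
  "ZZ_adj \<theta> = {poly (map_poly of_int q) \<theta> | q :: int poly. True}"

definition ring_of_integers :: "complex set \<Rightarrow> complex set" where
  "ring_of_integers K = {x \<in> K. algebraic_int x}"

definition order_index :: "complex \<Rightarrow> nat" where
  "order_index \<theta> = card ((\<lambda>x. (+) x ` ZZ_adj \<theta>) ` ring_of_integers (QQ_adj \<theta>))"

definition tpoly :: "nat \<Rightarrow> nat \<Rightarrow> nat \<Rightarrow> int \<Rightarrow> int poly" where
  "tpoly p j s' c = map_poly (\<lambda>z. z div int p)
     ((\<Sum>i<p ^ j. monom (of_nat (p ^ j choose i) * c ^ (p ^ j - i)) (s' * i)) - [:c:])"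

definition cond :: "int \<Rightarrow> int \<Rightarrow> nat \<Rightarrow> nat \<Rightarrow> nat \<Rightarrow> nat \<Rightarrow> bool" where
  "cond a c k m n p = (
    let P = int p; t = gcd n k; n1 = n div t; k1 = k div t in
    if P dvd c \<and> P dvd a then
      m = 1 \<and> \<not> P ^ 2 dvd c
    else if P dvd c \<and> \<not> P dvd a \<and> n = 1 then
      (let j = multiplicity p (k * m - 1); c2 = c div P; a1 = (a ^ (p ^ j) - a) div P in
        (P dvd c2 \<and> \<not> P dvd a1) \<or>
        \<not> P dvd (c2 * (a ^ k * a1 ^ (k * m - 1) - (- int m * a * c2) ^ (k * m - 1))))
    else if P dvd c \<and> \<not> P dvd a \<and> n \<ge> 2 then
      m = 1 \<and>
      (let l = multiplicity p (k - n); c2 = c div P; a1 = (a ^ (p ^ l) - a) div P in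
        (P dvd a1 \<and> \<not> P dvd c2) \<or>
        \<not> P dvd (a1 * c2 ^ (n - 1) * (a ^ n1 * a1 ^ (k1 - n1) - (- c2) ^ (k1 - n1))))
    else if \<not> P dvd c \<and> P dvd a then
      (m \<ge> 2 \<longrightarrow> \<not> P ^ 2 dvd a) \<and>
      (m = 1 \<longrightarrow>
        (let l = multiplicity p k; a2 = (- a) div P; c1 = ((- c) ^ (p ^ l) + c) div P in
          (P dvd a2 \<and> \<not> P dvd c1) \<or>
          \<not> P dvd (a2 * (a2 ^ k1 * (- c) ^ n1 - (- c1) ^ k1))))
    else if \<not> P dvd c * a \<and> P dvd int k then
      (let j = multiplicity p (gcd k n); s' = k div p ^ j; s = n div p ^ j;
           a1 = (a ^ (p ^ j) - a) div P;
           g1 = monom a1 n - Polynomial.smult (int m) (tpoly p j s' c * (monom 1 k + [:c:]) ^ (m - 1));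
           g2 = (monom 1 s' + [:c:]) ^ m - monom a s in
        poly_mod.coprime_m P g1 g2)
    else if \<not> P dvd c * a * int k \<and> P dvd int m then
      P dvd int n \<and> \<not> P ^ 2 dvd (a ^ p - a)
    else
      (let C = int (k * m) ^ (k1 * m) * c ^ (k1 * m - n1);
           E = a ^ k1 * int n ^ n1 * int (k * m - n) ^ (k1 * m - n1) in
        \<not> P ^ 2 dvd (C - E)))"

end

(*
  Dedekind's criterion in Uchida's form: p divides the index of Z[theta] iff f lies in the square of
  some maximal ideal M = (p, g) of Z[x]. Likewise p divides the discriminant iff some M contains
  both f and f'. Modulo M^2 the main tool is that u = v mod M implies u^N = v^N mod M^2
  whenever p divides N. In cases (i), (iv)(a), (vi), and for M = (p, x) in (iii), membership of f in
  M^2 becomes a divisibility between integers. In the remaining cases with p | ca one finds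
  f = p w mod M^2, where w in M together with f in M is a system x^N = A, b x^n = -d over F_p, whose
  solvability is decided by taking powers and by Bezout; in (v) it is the coprimality condition. In
  (vii) the double root satisfies (km - n) x^k = n c mod M, and eliminating x leaves C - E.
*)

theory Submission
  imports Defs "HOL-Number_Theory.Cong" "HOL-Algebra.Sylow" "HOL-Algebra.Multiplicative_Group"
    "Jordan_Normal_Form.Char_Poly"
begin

hide_const (open) up_ring.coeff up_ring.monom Coset.order

section \<open>Torsion in finite quotients\<close>

text \<open>The argument stays in Z[x]: residue fields and factorizations over F_p are replaced by
  the pair M, M^2, with X itself as the root, so that f may be exchanged for anything congruent to
  it modulo M^2. Two facts make M^2 computable: p q lies in M^2 only for q in M, and units modulo M
  can be cancelled modulo M^2. The assumption that p divides the discriminant supplies the exponents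
  divisible by p. A common zero of f and f' forces p | km - 1 in (ii), p | k in (iv)(b) and p | n in
  (v) and (vi), so that taking p^j-th powers with j > 0 sharpens congruences from M to M^2.
  Replacing a by a^(p^j), its equal modulo p, is the origin of the quotients (a^(p^j) - a)/p. The
  index is a cardinality, and an infinite quotient would get the value 0, divisible by every prime.
  Its finiteness is therefore proved, by a common denominator for all integers of K.\<close>

lemma prime_dvd_card_cosets_iff:
  fixes R Z :: "'a::comm_ring_1 set" and p :: nat
  assumes R: "0 \<in> R" "\<And>x y. x \<in> R \<Longrightarrow> y \<in> R \<Longrightarrow> x + y \<in> R" "\<And>x. x \<in> R \<Longrightarrow> - x \<in> R"
    and Z: "0 \<in> Z" "\<And>x y. x \<in> Z \<Longrightarrow> y \<in> Z \<Longrightarrow> x + y \<in> Z" "\<And>x. x \<in> Z \<Longrightarrow> - x \<in> Z"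
    and sub: "Z \<subseteq> R" and fin: "finite ((\<lambda>x. (+) x ` Z) ` R)" and p: "prime p"
  shows "p dvd card ((\<lambda>x. (+) x ` Z) ` R) \<longleftrightarrow> (\<exists>x\<in>R. x \<notin> Z \<and> of_nat p * x \<in> Z)"
proof -
  define G where "G = \<lparr>carrier = R, monoid.mult = (+), one = (0::'a)\<rparr>"
  have G: "comm_group G"
  proof (rule comm_groupI)
    fix x assume "x \<in> carrier G"
    then show "\<exists>y\<in>carrier G. y \<otimes>\<^bsub>G\<^esub> x = \<one>\<^bsub>G\<^esub>"
      using R(3)[of x] by (intro bexI[of _ "- x"]) (auto simp: G_def)
  qed (auto simp: G_def R add_ac)
  interpret comm_group G by fact
  have inv: "inv\<^bsub>G\<^esub> x = - x" if "x \<in> R" for x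
    using that R by (intro inv_equality) (auto simp: G_def)
  have "subgroup Z G"
    by (rule subgroupI) (use Z sub inv in \<open>auto simp: G_def\<close>)
  then have norm: "Z \<lhd> G" by (rule subgroup_imp_normal)
  interpret N: normal Z G by fact
  have coset: "r_coset G Z x = (+) x ` Z" for x
    by (auto simp: r_coset_def G_def add.commute image_def)
  have pow: "x [^]\<^bsub>G\<^esub> n = of_nat n * x" for x and n :: nat
    by (induction n) (auto simp: G_def algebra_simps)
  let ?Q = "G Mod Z"
  interpret Q: group ?Q by (rule N.factorgroup_is_group)
  have car: "carrier ?Q = (\<lambda>x. (+) x ` Z) ` R"
    unfolding carrier_FactGroup coset by (simp add: G_def)
  have ord: "Coset.order ?Q = card ((\<lambda>x. (+) x ` Z) ` R)" by (simp add: order_def car)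
  have finQ: "finite (carrier ?Q)" using fin car by simp
  have trivial: "(+) x ` Z = Z \<longleftrightarrow> x \<in> Z" if "x \<in> R" for x
  proof
    assume "(+) x ` Z = Z" then show "x \<in> Z" using Z(1) by force
  next
    assume x: "x \<in> Z"
    have "z \<in> (+) x ` Z" if "z \<in> Z" for z
      using Z(2)[OF that Z(3)[OF x]] by (intro image_eqI[of _ _ "z - x"]) auto
    then show "(+) x ` Z = Z" using Z(2)[OF x] by auto
  qed
  have powQ: "(+) x ` Z [^]\<^bsub>?Q\<^esub> n = (+) (of_nat n * x) ` Z" if "x \<in> R" for x and n :: nat
    using N.FactGroup_pow[of x n] that unfolding coset pow by (simp add: G_def)
  have mulR: "of_nat n * x \<in> R" if "x \<in> R" for x n
    using that by (induction n) (auto simp: algebra_simps R)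
  show ?thesis
  proof
    assume "p dvd card ((\<lambda>x. (+) x ` Z) ` R)"
    \<comment> \<open>Sylow's theorem with exponent 1 is Cauchy's: it gives a subgroup of order p,
      whose nontrivial elements are cosets killed by p.\<close>
    then obtain q where "Coset.order ?Q = p ^ 1 * q" using ord by auto
    from sylow_thm[OF p Q.group_axioms this finQ] obtain H where H: "subgroup H ?Q" "card H = p" by auto
    interpret H: group "?Q\<lparr>carrier := H\<rparr>" using H(1) by (rule Q.subgroup_imp_group)
    have "\<exists>h\<in>H. h \<noteq> \<one>\<^bsub>?Q\<^esub>"
    proof (rule ccontr)
      assume "\<not> ?thesis"
      then have "H \<subseteq> {\<one>\<^bsub>?Q\<^esub>}" by auto
      then have "card H \<le> 1" by (metis card.empty card_insert_disjoint card_mono empty_iff finite.emptyI finite.insertI One_nat_def)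
      then show False using H(2) prime_gt_1_nat[OF p] by simp
    qed
    then obtain h where h: "h \<in> H" "h \<noteq> Z" by auto
    have "h [^]\<^bsub>?Q\<lparr>carrier := H\<rparr>\<^esub> Coset.order (?Q\<lparr>carrier := H\<rparr>) = \<one>\<^bsub>?Q\<lparr>carrier := H\<rparr>\<^esub>"
      by (rule H.pow_order_eq_1) (use h in auto)
    then have hp: "h [^]\<^bsub>?Q\<^esub> p = Z"
      using H(2) by (simp add: order_def flip: Q.nat_pow_consistent)
    from h(1) H(1) have "h \<in> carrier ?Q" by (auto dest: subgroup.subset)
    then obtain x where x: "x \<in> R" "h = (+) x ` Z" using car by auto
    have "of_nat p * x \<in> Z" using hp x powQ trivial mulR by metis
    moreover have "x \<notin> Z" using h(2) x trivial by auto
    ultimately show "\<exists>x\<in>R. x \<notin> Z \<and> of_nat p * x \<in> Z" using x by auto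
  next
    assume "\<exists>x\<in>R. x \<notin> Z \<and> of_nat p * x \<in> Z"
    then obtain x where x: "x \<in> R" "x \<notin> Z" "of_nat p * x \<in> Z" by auto
    let ?h = "(+) x ` Z"
    have hQ: "?h \<in> carrier ?Q" using x car by auto
    have "?h [^]\<^bsub>?Q\<^esub> p = \<one>\<^bsub>?Q\<^esub>" using powQ trivial x mulR by simp
    then have "group.ord ?Q ?h dvd p" using Q.pow_eq_id[OF hQ] by simp
    moreover have "group.ord ?Q ?h \<noteq> 1" using Q.ord_eq_1[OF hQ] trivial x by simp
    ultimately have "group.ord ?Q ?h = p" using p by (auto simp: prime_nat_iff)
    then show "p dvd card ((\<lambda>x. (+) x ` Z) ` R)"
      using Q.ord_dvd_group_order[OF hQ] ord by simp
  qed
qed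

section \<open>Algebraic integers\<close>

abbreviation ipoly :: "int poly \<Rightarrow> 'a::comm_ring_1 \<Rightarrow> 'a" where
  "ipoly q x \<equiv> poly (map_poly of_int q) x"

lemma ipoly_simps [simp]:
  fixes x :: "'a::comm_ring_1"
  shows "ipoly (q + r) x = ipoly q x + ipoly r x"
    and "ipoly (q - r) x = ipoly q x - ipoly r x"
    and "ipoly (- q) x = - ipoly q x"
    and "ipoly (q * r) x = ipoly q x * ipoly r x"
    and "ipoly (q ^ n) x = ipoly q x ^ n"
    and "ipoly (Polynomial.monom z n) x = of_int z * x ^ n"
    and "ipoly (of_int z) x = of_int z"
    and "ipoly (of_nat k) x = of_nat k"
    and "ipoly 1 x = 1"
    and "ipoly (pCons z q) x = of_int z + x * ipoly q x"
  by (simp_all add: of_int_poly_hom.hom_add of_int_poly_hom.hom_minus of_int_poly_hom.hom_uminus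
      of_int_poly_hom.hom_mult of_int_poly_hom.hom_power map_poly_monom poly_monom
      of_int_poly of_nat_poly of_int_hom.map_poly_pCons_hom)

text \<open>Pseudo-division multiplies the dividend by a power of the leading coefficient of the
  divisor; for a monic divisor that power is 1.\<close>

lemma monic_div_mod:
  fixes g q :: "'a::comm_ring_1 poly"
  assumes "monic g"
  obtains a r where "q = g * a + r" "r = 0 \<or> degree r < degree g"
proof -
  obtain a r where "pseudo_divmod q g = (a, r)" by fastforce
  with pseudo_divmod[of g q a r] assms
  have "q = g * a + r" "r = 0 \<or> degree r < degree g" by (force simp: monic_degree_0)+
  with that show thesis .
qed

text \<open>Indexing the coefficients by the elements of B makes coincidences among listed
  generators, such as equal monomials x^i w^j, harmless.\<close>

definition int_span :: "complex set \<Rightarrow> complex set" where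
  "int_span B = {\<Sum>b\<in>B. of_int (c b) * b | c. True}"

lemma int_span_add: "x \<in> int_span B \<Longrightarrow> y \<in> int_span B \<Longrightarrow> x + y \<in> int_span B"
proof -
  assume "x \<in> int_span B" "y \<in> int_span B"
  then obtain c d where "x = (\<Sum>b\<in>B. of_int (c b) * b)" "y = (\<Sum>b\<in>B. of_int (d b) * b)"
    by (auto simp: int_span_def)
  then have "x + y = (\<Sum>b\<in>B. of_int (c b + d b) * b)" by (simp add: sum.distrib algebra_simps)
  then show ?thesis unfolding int_span_def by (intro CollectI exI[of _ "\<lambda>b. c b + d b"]) simp
qed

lemma int_span_mult_int: "x \<in> int_span B \<Longrightarrow> of_int z * x \<in> int_span B"
proof -
  assume "x \<in> int_span B"
  then obtain c where "x = (\<Sum>b\<in>B. of_int (c b) * b)" by (auto simp: int_span_def)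
  then have "of_int z * x = (\<Sum>b\<in>B. of_int (z * c b) * b)" by (simp add: sum_distrib_left algebra_simps)
  then show ?thesis unfolding int_span_def by (intro CollectI exI[of _ "\<lambda>b. z * c b"]) simp
qed

lemma int_span_0: "0 \<in> int_span B"
  unfolding int_span_def by (intro CollectI exI[of _ "\<lambda>b. 0"]) simp

lemma int_span_sum: "(\<And>i. i \<in> I \<Longrightarrow> h i \<in> int_span B) \<Longrightarrow> sum h I \<in> int_span B"
  by (induction I rule: infinite_finite_induct) (auto intro: int_span_add int_span_0)

lemma int_span_base:
  assumes "finite B" "b \<in> B"
  shows "b \<in> int_span B"
proof -
  have "(\<Sum>x\<in>B. of_int (if x = b then 1 else 0) * x) = (\<Sum>x\<in>B. if x = b then x else 0)"
    by (rule sum.cong) auto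
  then have "b = (\<Sum>x\<in>B. of_int (if x = b then 1 else 0) * x)" using assms by simp
  then show ?thesis unfolding int_span_def by (intro CollectI exI[of _ "\<lambda>x. if x = b then 1 else 0"]) simp
qed

lemma int_span_mult_closed:
  assumes "\<And>b. b \<in> B \<Longrightarrow> w * b \<in> int_span B" "x \<in> int_span B"
  shows "w * x \<in> int_span B"
proof -
  obtain c where "x = (\<Sum>b\<in>B. of_int (c b) * b)" using assms(2) by (auto simp: int_span_def)
  then have "w * x = (\<Sum>b\<in>B. of_int (c b) * (w * b))" by (simp add: sum_distrib_left algebra_simps)
  then show ?thesis using assms(1) by (auto intro!: int_span_sum int_span_mult_int)
qed

text \<open>The characteristic polynomial of the matrix of multiplication by \<open>w\<close> is an integral equation.\<close>

lemma algebraic_int_if_stable_span: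
  assumes fin: "finite B" and b0: "b0 \<in> B" "b0 \<noteq> 0"
    and stable: "\<And>x. x \<in> int_span B \<Longrightarrow> w * x \<in> int_span B"
  shows "algebraic_int w"
proof -
  obtain b where b: "bij_betw b {0..<card B} B" using ex_bij_betw_nat_finite[OF fin] by auto
  define n where "n = card B"
  have "\<exists>c. w * x = (\<Sum>y\<in>B. of_int (c y) * y)" if "x \<in> B" for x
    using stable[OF int_span_base[OF fin that]] by (auto simp: int_span_def)
  then obtain c where c: "\<And>x. x \<in> B \<Longrightarrow> w * x = (\<Sum>y\<in>B. of_int (c x y) * y)" by metis
  define A :: "int mat" where "A = mat n n (\<lambda>(i, j). c (b i) (b j))"
  define v where "v = vec n b"
  let ?A = "map_mat of_int A :: complex mat"
  have A: "A \<in> carrier_mat n n" "?A \<in> carrier_mat n n" by (auto simp: A_def)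
  have bB: "b i \<in> B" if "i < n" for i using that b by (auto simp: bij_betw_def n_def)
  have "?A *\<^sub>v v = w \<cdot>\<^sub>v v"
  proof (rule eq_vecI)
    fix i assume "i < dim_vec (w \<cdot>\<^sub>v v)"
    then have i: "i < n" by (simp add: v_def)
    have "(?A *\<^sub>v v) $ i = (\<Sum>j = 0..<n. of_int (c (b i) (b j)) * b j)"
      using i by (simp add: A_def v_def scalar_prod_def)
    also have "\<dots> = (\<Sum>y\<in>B. of_int (c (b i) y) * y)"
      using b sum.reindex_bij_betw[OF b, of "\<lambda>y. of_int (c (b i) y) * y"] by (simp add: n_def)
    also have "\<dots> = w * b i" using c[OF bB[OF i]] by simp
    finally show "(?A *\<^sub>v v) $ i = (w \<cdot>\<^sub>v v) $ i" using i by (simp add: v_def)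
  qed (simp add: A_def v_def)
  moreover have "v \<noteq> 0\<^sub>v n"
  proof
    assume v0: "v = 0\<^sub>v n"
    obtain i where "i < n" "b i = b0"
      using b0(1) bij_betw_imp_surj_on[OF b] by (metis atLeastLessThan_iff imageE n_def)
    then show False using v0 b0 by (metis index_vec index_zero_vec(1) v_def)
  qed
  ultimately have "eigenvalue ?A w"
    unfolding eigenvalue_def eigenvector_def using A by (intro exI[of _ v]) (auto simp: v_def A_def)
  then have "poly (char_poly ?A) w = 0" using eigenvalue_root_char_poly[OF A(2)] by simp
  then have "ipoly (char_poly A) w = 0" by (simp add: of_int_hom.char_poly_hom[OF A(1)])
  moreover have "lead_coeff (char_poly A) = 1" using degree_monic_char_poly[OF A(1)] by simp
  ultimately show ?thesis unfolding algebraic_int_altdef_ipoly by blast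
qed

lemma monic_root_power:
  fixes x :: "'a::field_char_0"
  assumes root: "ipoly P x = 0" and monic: "monic P"
  shows "degree P > 0" "x ^ degree P = (\<Sum>i<degree P. of_int (- coeff P i) * x ^ i)"
proof -
  show "degree P > 0"
  proof (rule ccontr)
    assume "\<not> degree P > 0"
    then have "P = 1" using monic_degree_0[OF monic] by simp
    then show False using root by simp
  qed
  have "ipoly P x = (\<Sum>i\<le>degree P. of_int (coeff P i) * x ^ i)" by (simp add: poly_altdef)
  also have "\<dots> = (\<Sum>i<degree P. of_int (coeff P i) * x ^ i) + x ^ degree P"
    using monic sum.lessThan_Suc[of "\<lambda>i. of_int (coeff P i) * x ^ i" "degree P"]
    by (simp add: lessThan_Suc_atMost)
  finally have "(\<Sum>i<degree P. of_int (coeff P i) * x ^ i) + x ^ degree P = 0" using root by simp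
  then have "x ^ degree P = - (\<Sum>i<degree P. of_int (coeff P i) * x ^ i)" by (rule add_eq_0_iff[THEN iffD1])
  then show "x ^ degree P = (\<Sum>i<degree P. of_int (- coeff P i) * x ^ i)" by (simp add: sum_negf)
qed

text \<open>The monomials x^i w^j with i < d and j < e span a lattice stable under x and w: overflow
  in i is absorbed by the monic equation of x, overflow in j by the given one. The latter may have
  coefficients in Z[x] because the witness in Dedekind's criterion satisfies a quadratic equation
  over Z[\<theta>].\<close>

lemma algebraic_int_extension:
  fixes x w :: complex
  assumes x: "algebraic_int x" and e: "e > 0"
    and w: "w ^ e = (\<Sum>j<e. ipoly (q j) x * w ^ j)"
  shows "algebraic_int w" "algebraic_int (x + w)" "algebraic_int (x * w)"
proof -
  obtain P where P: "ipoly P x = 0" "lead_coeff P = 1" using x unfolding algebraic_int_altdef_ipoly by auto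
  define d where "d = degree P"
  note d = monic_root_power(1)[OF P, folded d_def] and xd = monic_root_power(2)[OF P, folded d_def]
  define B where "B = (\<lambda>(i, j). x ^ i * w ^ j) ` ({..<d} \<times> {..<e})"
  have fin: "finite B" by (simp add: B_def)
  have base: "x ^ i * w ^ j \<in> int_span B" if "i < d" "j < e" for i j
    using that by (intro int_span_base[OF fin]) (auto simp: B_def)
  have stx: "x * s \<in> int_span B" if "s \<in> int_span B" for s
  proof (rule int_span_mult_closed[OF _ that])
    fix b assume "b \<in> B"
    then obtain i j where ij: "i < d" "j < e" "b = x ^ i * w ^ j" by (auto simp: B_def)
    show "x * b \<in> int_span B"
    proof (cases "Suc i < d")
      case True then show ?thesis using base[of "Suc i" j] ij by (simp add: mult_ac)
    next
      case False
      then have "d = Suc i" using ij by simp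
      then have "x * b = x ^ d * w ^ j" using ij by simp
      then have "x * b = (\<Sum>i<d. of_int (- coeff P i) * (x ^ i * w ^ j))"
        unfolding xd by (simp add: sum_distrib_right mult.assoc)
      then show ?thesis using base[OF _ ij(2)] by (auto intro!: int_span_sum int_span_mult_int simp del: of_int_minus)
    qed
  qed
  have str: "ipoly r x * s \<in> int_span B" if "s \<in> int_span B" for r s
    using that
  proof (induction r arbitrary: s)
    case 0
    then show ?case by (simp add: int_span_0)
  next
    case (pCons z r)
    have "ipoly (pCons z r) x * s = of_int z * s + ipoly r x * (x * s)" by (simp add: algebra_simps)
    then show ?case using pCons by (metis int_span_add int_span_mult_int stx)
  qed
  have stw: "w * s \<in> int_span B" if "s \<in> int_span B" for s
  proof (rule int_span_mult_closed[OF _ that])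
    fix b assume "b \<in> B"
    then obtain i j where ij: "i < d" "j < e" "b = x ^ i * w ^ j" by (auto simp: B_def)
    show "w * b \<in> int_span B"
    proof (cases "Suc j < e")
      case True then show ?thesis using base[of i "Suc j"] ij by (simp add: mult_ac)
    next
      case False
      then have "e = Suc j" using ij by simp
      then have "w * b = x ^ i * w ^ e" using ij by simp
      then have "w * b = (\<Sum>j<e. ipoly (q j) x * (x ^ i * w ^ j))"
        using w by (simp add: sum_distrib_left mult_ac)
      then show ?thesis using base[OF ij(1)] by (auto intro!: int_span_sum str)
    qed
  qed
  have b0: "1 \<in> B" unfolding B_def by (rule image_eqI[of _ _ "(0, 0)"]) (use d e in auto)
  note I = algebraic_int_if_stable_span[OF fin b0 one_neq_zero]
  show "algebraic_int w" by (rule I[OF stw])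
  show "algebraic_int (x + w)" by (rule I, unfold distrib_right) (intro int_span_add stx stw)
  show "algebraic_int (x * w)" by (rule I, unfold mult.assoc) (intro stx stw)
qed

lemma
  fixes x y :: complex
  assumes "algebraic_int x" "algebraic_int y"
  shows algebraic_int_add: "algebraic_int (x + y)" and algebraic_int_mult: "algebraic_int (x * y)"
proof -
  obtain P where P: "ipoly P y = 0" "lead_coeff P = 1" using assms unfolding algebraic_int_altdef_ipoly by auto
  have y: "y ^ degree P = (\<Sum>i<degree P. ipoly [:- coeff P i:] x * y ^ i)"
    using monic_root_power(2)[OF P] by simp
  show "algebraic_int (x + y)" "algebraic_int (x * y)"
    using algebraic_int_extension[OF assms(1) monic_root_power(1)[OF P] y] by blast+
qed

lemma algebraic_int_sum:
  "(\<And>i. i \<in> I \<Longrightarrow> algebraic_int (h i :: complex)) \<Longrightarrow> algebraic_int (sum h I)"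
  by (induction I rule: infinite_finite_induct) (auto intro: algebraic_int_add)

lemma algebraic_int_prod:
  "(\<And>i. i \<in> I \<Longrightarrow> algebraic_int (h i :: complex)) \<Longrightarrow> algebraic_int (prod h I)"
  by (induction I rule: infinite_finite_induct) (auto intro: algebraic_int_mult int_imp_algebraic_int)

lemma algebraic_int_ipoly:
  "algebraic_int x \<Longrightarrow> algebraic_int (ipoly q x :: complex)"
  by (induction q) (auto intro: algebraic_int_add algebraic_int_mult)

section \<open>Maximal ideals of the integer polynomial ring\<close>

definition poly_ideal :: "int poly set \<Rightarrow> bool" where
  "poly_ideal I \<longleftrightarrow> 0 \<in> I \<and> (\<forall>q\<in>I. \<forall>r\<in>I. q + r \<in> I) \<and> (\<forall>q\<in>I. \<forall>r. q * r \<in> I)"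

lemma poly_idealD:
  assumes "poly_ideal I"
  shows "0 \<in> I" "q \<in> I \<Longrightarrow> r \<in> I \<Longrightarrow> q + r \<in> I" "q \<in> I \<Longrightarrow> q * r \<in> I" "q \<in> I \<Longrightarrow> r * q \<in> I"
    "q \<in> I \<Longrightarrow> r \<in> I \<Longrightarrow> q - r \<in> I" "q \<in> I \<Longrightarrow> - q \<in> I"
proof -
  show *: "0 \<in> I" "q \<in> I \<Longrightarrow> r \<in> I \<Longrightarrow> q + r \<in> I" "q \<in> I \<Longrightarrow> q * r \<in> I" "q \<in> I \<Longrightarrow> r * q \<in> I" for q r
    using assms by (auto simp: poly_ideal_def mult.commute[of r q])
  show "q \<in> I \<Longrightarrow> - q \<in> I" for q using *(3)[of q "-1"] by simp
  with * show "q \<in> I \<Longrightarrow> r \<in> I \<Longrightarrow> q - r \<in> I" for q r by (metis diff_conv_add_uminus)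
qed

definition pideal :: "int \<Rightarrow> int poly \<Rightarrow> int poly set" where
  "pideal p g = {of_int p * A + g * B | A B. True}"

text \<open>The square of the ideal (p, g), generated by the three products of its
  generators.\<close>

definition pideal_sq :: "int \<Rightarrow> int poly \<Rightarrow> int poly set" where
  "pideal_sq p g = {of_int p ^ 2 * A + of_int p * g * B + g ^ 2 * C | A B C. True}"

lemma poly_ideal_pideal: "poly_ideal (pideal p g)"
  unfolding poly_ideal_def
proof (intro conjI ballI allI)
  show "0 \<in> pideal p g" unfolding pideal_def by (intro CollectI exI[of _ 0]) simp
  fix q assume "q \<in> pideal p g"
  then obtain A B where q: "q = of_int p * A + g * B" by (auto simp: pideal_def)
  show "q * r \<in> pideal p g" for r
    unfolding pideal_def q by (intro CollectI exI[of _ "A * r"] exI[of _ "B * r"]) (simp add: algebra_simps)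
  fix r assume "r \<in> pideal p g"
  then obtain A' B' where r: "r = of_int p * A' + g * B'" by (auto simp: pideal_def)
  show "q + r \<in> pideal p g"
    unfolding pideal_def q r by (intro CollectI exI[of _ "A + A'"] exI[of _ "B + B'"]) (simp add: algebra_simps)
qed

lemma poly_ideal_pideal_sq: "poly_ideal (pideal_sq p g)"
  unfolding poly_ideal_def
proof (intro conjI ballI allI)
  show "0 \<in> pideal_sq p g" unfolding pideal_sq_def by (intro CollectI exI[of _ 0]) simp
  fix q assume "q \<in> pideal_sq p g"
  then obtain A B C where q: "q = of_int p ^ 2 * A + of_int p * g * B + g ^ 2 * C"
    by (auto simp: pideal_sq_def)
  show "q * r \<in> pideal_sq p g" for r
    unfolding pideal_sq_def q
    by (intro CollectI exI[of _ "A * r"] exI[of _ "B * r"] exI[of _ "C * r"]) (simp add: algebra_simps)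
  fix r assume "r \<in> pideal_sq p g"
  then obtain A' B' C' where r: "r = of_int p ^ 2 * A' + of_int p * g * B' + g ^ 2 * C'"
    by (auto simp: pideal_sq_def)
  show "q + r \<in> pideal_sq p g"
    unfolding pideal_sq_def q r
    by (intro CollectI exI[of _ "A + A'"] exI[of _ "B + B'"] exI[of _ "C + C'"]) (simp add: algebra_simps)
qed

lemma pideal_p: "of_int p * A \<in> pideal p g" and pideal_g: "g * A \<in> pideal p g"
proof -
  show "of_int p * A \<in> pideal p g" unfolding pideal_def by (intro CollectI exI[of _ A] exI[of _ 0]) simp
  show "g * A \<in> pideal p g" unfolding pideal_def by (intro CollectI exI[of _ 0] exI[of _ A]) simp
qed

lemma pideal_subset: "poly_ideal I \<Longrightarrow> of_int p \<in> I \<Longrightarrow> g \<in> I \<Longrightarrow> pideal p g \<subseteq> I"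
  by (auto simp: pideal_def intro!: poly_idealD(2)[of I] poly_idealD(3)[of I])

lemma dvd_of_int_poly_iff: "of_int p dvd q \<longleftrightarrow> (\<forall>i. p dvd coeff q i)" for q :: "int poly"
  by (simp add: of_int_poly const_poly_dvd_iff)

lemma not_dvd_monic: "prime p \<Longrightarrow> monic g \<Longrightarrow> \<not> of_int p dvd (g :: int poly)" for p :: int
  unfolding dvd_of_int_poly_iff by (metis not_prime_unit)

lemma prime_elem_of_int_poly: "prime p \<Longrightarrow> prime_elem (of_int p :: int poly)" for p :: int
  unfolding of_int_poly of_int_eq_id id_apply prime_elem_const_poly_iff by (rule prime_imp_prime_elem)

lemma bezout_prime:
  fixes p z :: int
  assumes "prime p" "\<not> p dvd z"
  obtains u v where "u * z + v * p = 1"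
proof -
  obtain u v where "u * z + v * p = gcd z p" using bezout_int by blast
  moreover have "gcd z p = 1" using prime_imp_coprime[OF assms] by (simp add: gcd.commute)
  ultimately show thesis using that by simp
qed

text \<open>Normalization in F_p[x]: leading terms divisible by p are stripped until the leading
  coefficient is invertible modulo p, and Bezout then turns it into 1. The degree bound keeps the
  result comparable with division remainders.\<close>

lemma monic_mod_prime:
  fixes p :: int and r :: "int poly"
  assumes p: "prime p"
  shows "\<not> of_int p dvd r \<Longrightarrow> \<exists>s u A. monic s \<and> degree s \<le> degree r \<and> s = of_int u * r + of_int p * A"
proof (induction "degree r" arbitrary: r rule: less_induct)
  case less
  let ?n = "degree r" and ?l = "lead_coeff r"
  show ?case
  proof (cases "p dvd ?l")
    case False
    then obtain u v where uv: "u * ?l + v * p = 1" using bezout_prime[OF p] by blast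
    define s where "s = of_int u * r + of_int p * (of_int v * monom 1 ?n)"
    have "coeff s ?n = 1" using uv by (simp add: s_def of_int_poly algebra_simps)
    moreover have "degree s \<le> ?n"
      by (rule degree_le) (auto simp: s_def of_int_poly coeff_eq_0)
    ultimately have "monic s" by (metis le_degree le_antisym one_neq_zero)
    with \<open>degree s \<le> ?n\<close> show ?thesis unfolding s_def by blast
  next
    case True
    then obtain l where l: "?l = p * l" by auto
    define r' where "r' = r - of_int p * monom l ?n"
    have nd: "\<not> of_int p dvd r'" using less.prems by (simp add: r'_def dvd_diff_left_iff)
    have c: "coeff r' i = (if i < ?n then coeff r i else 0)" for i
      using l by (auto simp: r'_def of_int_poly coeff_eq_0)
    have "r' \<noteq> 0" using nd by auto
    then have "degree r' < ?n" by (metis c leading_coeff_0_iff)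
    from less.hyps[OF this nd] obtain s u A
      where s: "monic s" "degree s \<le> degree r'" "s = of_int u * r' + of_int p * A" by blast
    have "s = of_int u * r + of_int p * (A - of_int u * monom l ?n)"
      by (simp add: s(3) r'_def algebra_simps)
    moreover have "degree s \<le> degree r" using s(2) \<open>degree r' < ?n\<close> by simp
    ultimately show ?thesis using s(1) by blast
  qed
qed

text \<open>F_p[x] is a principal ideal domain: after division by a monic element d of least degree,
  a remainder not divisible by p would normalize to a monic element of smaller degree. The given
  monic h ensures that a candidate exists.\<close>

lemma pideal_principal:
  fixes p :: int
  assumes p: "prime p" and I: "poly_ideal I" "of_int p \<in> I" and h: "h \<in> I" "monic h"
  obtains d where "monic d" "I = pideal p d" "\<And>h. h \<in> I \<Longrightarrow> monic h \<Longrightarrow> degree d \<le> degree h"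
proof -
  obtain d where d: "d \<in> I" "monic d" and min: "\<And>h. h \<in> I \<Longrightarrow> monic h \<Longrightarrow> degree d \<le> degree h"
    using ex_has_least_nat[of "\<lambda>h. h \<in> I \<and> monic h" h degree] h by auto
  have "q \<in> pideal p d" if q: "q \<in> I" for q
  proof -
    obtain a r where ar: "q = d * a + r" "r = 0 \<or> degree r < degree d" using d(2) by (rule monic_div_mod)
    have r: "r \<in> I" using poly_idealD(5)[OF I(1) q poly_idealD(3)[OF I(1) d(1), of a]] ar(1) by simp
    have "of_int p dvd r"
    proof (rule ccontr)
      assume nd: "\<not> of_int p dvd r"
      then obtain s u A where s: "monic s" "degree s \<le> degree r" "s = of_int u * r + of_int p * A"
        using monic_mod_prime[OF p] by blast
      have "s \<in> I"
        unfolding s(3) using poly_idealD(2)[OF I(1) poly_idealD(4)[OF I(1) r] poly_idealD(3)[OF I]] .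
      with min s have "degree d \<le> degree r" by (meson order_trans)
      moreover have "r \<noteq> 0" using nd by auto
      ultimately show False using ar(2) by simp
    qed
    then obtain r' where "r = of_int p * r'" by auto
    then show ?thesis unfolding pideal_def using ar(1) by (auto simp: add.commute)
  qed
  moreover have "pideal p d \<subseteq> I" using pideal_subset[OF I(1,2) d(1)] .
  ultimately show thesis using that d min by blast
qed

text \<open>Here \<open>maximal\<close> makes Z[x]/(p, g) a field by providing inverses directly, so
  irreducibility of g modulo p never has to be discussed. A monic g is not divisible by p, which
  cancellation of p modulo the square relies on.\<close>

locale maximal_pair =
  fixes p :: int and g :: "int poly"
  assumes prime: "prime p" and monic: "monic g" and proper: "1 \<notin> pideal p g"
    and maximal: "\<And>q. q \<notin> pideal p g \<Longrightarrow> \<exists>s. q * s - 1 \<in> pideal p g"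

text \<open>A generator g of least degree takes the place of Zorn's lemma: a larger proper ideal
  would again be generated by p and a monic d of degree at least that of g, which the remainder
  modulo g of an added element q contradicts.\<close>

lemma maximal_pair_exists:
  fixes p :: int
  assumes p: "prime p" and I: "poly_ideal I" "of_int p \<in> I" "1 \<notin> I" and h: "h \<in> I" "monic h"
  obtains g where "maximal_pair p g" "I \<subseteq> pideal p g"
proof -
  define H where "H g \<longleftrightarrow> monic g \<and> 1 \<notin> pideal p g \<and> I \<subseteq> pideal p g" for g
  obtain d where "H d" using pideal_principal[OF p I(1,2) h] I(3) unfolding H_def by (metis order_refl)
  then obtain g where g: "H g" and min: "\<And>d. H d \<Longrightarrow> degree g \<le> degree d"
    using ex_has_least_nat[of H d degree] by auto
  have "maximal_pair p g"
  proof
    show "prime p" "monic g" "1 \<notin> pideal p g" using p g by (auto simp: H_def)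
    fix q assume q: "q \<notin> pideal p g"
    show "\<exists>s. q * s - 1 \<in> pideal p g"
    proof (rule ccontr)
      assume no: "\<not> ?thesis"
      \<comment> \<open>The ideal (p, g) + (q); it is proper because q has no inverse modulo (p,
        g).\<close>
      define J where "J = {r + q * s | r s. r \<in> pideal p g}"
      note PI = poly_idealD[OF poly_ideal_pideal[of p g]]
      have J: "poly_ideal J" unfolding poly_ideal_def
      proof (intro conjI ballI allI)
        show "0 \<in> J" unfolding J_def using PI(1) by (intro CollectI exI[of _ 0]) simp
        fix x assume "x \<in> J"
        then obtain r s where x: "x = r + q * s" "r \<in> pideal p g" by (auto simp: J_def)
        show "x * y \<in> J" for y
          unfolding J_def x(1) using PI(3)[OF x(2), of y]
          by (intro CollectI exI[of _ "r * y"] exI[of _ "s * y"]) (simp add: distrib_right mult.assoc)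
        fix y assume "y \<in> J"
        then obtain r' s' where y: "y = r' + q * s'" "r' \<in> pideal p g" by (auto simp: J_def)
        show "x + y \<in> J"
          unfolding J_def x(1) y(1) using PI(2)[OF x(2) y(2)]
          by (intro CollectI exI[of _ "r + r'"] exI[of _ "s + s'"]) (simp add: algebra_simps)
      qed
      have sub: "pideal p g \<subseteq> J"
      proof
        fix r assume "r \<in> pideal p g"
        then show "r \<in> J" unfolding J_def by (intro CollectI exI[of _ r] exI[of _ 0]) simp
      qed
      have gJ: "g \<in> J" "of_int p \<in> J" using sub pideal_g[of g 1 p] pideal_p[of p 1 g] by auto
      have qJ: "q \<in> J" unfolding J_def using PI(1) by (intro CollectI exI[of _ 0] exI[of _ 1]) simp
      have one: "1 \<notin> J"
      proof
        assume "1 \<in> J"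
        then obtain r s where rs: "1 = r + q * s" "r \<in> pideal p g" by (auto simp: J_def)
        then have "q * s - 1 = - r" by (simp add: algebra_simps)
        then show False using no PI(6)[OF rs(2)] by metis
      qed
      obtain d where d: "monic d" "J = pideal p d" "\<And>h. h \<in> J \<Longrightarrow> monic h \<Longrightarrow> degree d \<le> degree h"
        using pideal_principal[OF p J gJ(2,1)] g by (auto simp: H_def)
      have "H d" using d one sub g by (auto simp: H_def)
      note gd = min[OF this]
      have "monic g" using g by (simp add: H_def)
      then obtain a r where ar: "q = g * a + r" "r = 0 \<or> degree r < degree g" by (rule monic_div_mod)
      have r: "r \<in> J" using poly_idealD(5)[OF J qJ poly_idealD(3)[OF J gJ(1), of a]] ar(1) by simp
      show False
      proof (cases "of_int p dvd r")
        case True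
        then obtain r' where "r = of_int p * r'" by auto
        then have "q \<in> pideal p g" unfolding pideal_def using ar(1) by (auto simp: add.commute)
        then show False using q by simp
      next
        case nd: False
        then obtain s u A where s: "monic s" "degree s \<le> degree r" "s = of_int u * r + of_int p * A"
          using monic_mod_prime[OF p] by blast
        have "s \<in> J"
          unfolding s(3) using poly_idealD(2)[OF J poly_idealD(4)[OF J r] poly_idealD(3)[OF J gJ(2)]] .
        with d(3) s gd have "degree g \<le> degree r" by (meson order_trans)
        moreover have "r \<noteq> 0" using nd by auto
        ultimately show False using ar(2) by simp
      qed
    qed
  qed
  then show thesis using that g by (auto simp: H_def)
qed

section \<open>Arithmetic modulo a maximal ideal and its square\<close>

context maximal_pair
begin

abbreviation "M \<equiv> pideal p g"
abbreviation "M2 \<equiv> pideal_sq p g"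

lemmas M_ideal = poly_idealD[OF poly_ideal_pideal[of p g]]
lemmas M2_ideal = poly_idealD[OF poly_ideal_pideal_sq[of p g]]

lemma p_in_M: "of_int p \<in> M" and g_in_M: "g \<in> M"
  using pideal_p[of p 1 g] pideal_g[of g 1 p] by simp_all

lemma unit: assumes "q \<notin> M" obtains s j where "q * s = 1 + j" "j \<in> M"
  using maximal[OF assms] by (metis add.commute diff_add_cancel)

lemma M_prime: "q * r \<in> M \<longleftrightarrow> q \<in> M \<or> r \<in> M"
proof
  assume qr: "q * r \<in> M"
  have "r \<in> M" if "q \<notin> M"
  proof -
    from that obtain s j where s: "q * s = 1 + j" "j \<in> M" by (rule unit)
    have "q * r * s - j * r = (q * s - j) * r" by (simp add: algebra_simps)
    then have "r = q * r * s - j * r" using s(1) by simp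
    then show ?thesis using M_ideal(3,5) qr s(2) by metis
  qed
  then show "q \<in> M \<or> r \<in> M" by blast
next
  assume "q \<in> M \<or> r \<in> M"
  then show "q * r \<in> M" using M_ideal(3,4) by blast
qed

lemma M_power: "q ^ n \<in> M \<longleftrightarrow> q \<in> M \<and> n > 0"
  using proper by (induction n) (auto simp: M_prime)

lemma M_diff_iff: "q - r \<in> M \<Longrightarrow> q \<in> M \<longleftrightarrow> r \<in> M"
  using M_ideal(2)[of "q - r" r] M_ideal(5)[of q "q - r"] by auto

lemma M2_diff_iff: "q - r \<in> M2 \<Longrightarrow> q \<in> M2 \<longleftrightarrow> r \<in> M2"
  using M2_ideal(2)[of "q - r" r] M2_ideal(5)[of q "q - r"] by auto

lemma M_of_int: "of_int z \<in> M \<longleftrightarrow> p dvd z"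
proof
  assume z: "of_int z \<in> M"
  show "p dvd z"
  proof (rule ccontr)
    assume "\<not> p dvd z"
    then obtain u v where uv: "u * z + v * p = 1" using bezout_prime[OF prime] by blast
    then have "(1 :: int poly) = of_int z * of_int u + of_int p * of_int v"
      by (metis mult.commute of_int_1 of_int_add of_int_mult)
    then have "1 \<in> M" using M_ideal(2)[OF M_ideal(3)[OF z] M_ideal(3)[OF p_in_M]] by metis
    then show False using proper by simp
  qed
next
  assume "p dvd z"
  then obtain w where "z = p * w" by auto
  then show "of_int z \<in> M" using pideal_p[of p "of_int w" g] by simp
qed

lemma M2_mult: assumes "q \<in> M" "r \<in> M" shows "q * r \<in> M2"
proof -
  obtain A B A' B' where "q = of_int p * A + g * B" "r = of_int p * A' + g * B'"
    using assms by (auto simp: pideal_def)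
  then have "q * r = of_int p ^ 2 * (A * A') + of_int p * g * (A * B' + A' * B) + g ^ 2 * (B * B')"
    by (simp add: algebra_simps power2_eq_square)
  then show ?thesis unfolding pideal_sq_def by blast
qed

lemma M2_subset: "q \<in> M2 \<Longrightarrow> q \<in> M"
proof -
  assume "q \<in> M2"
  then obtain A B C where "q = of_int p ^ 2 * A + of_int p * g * B + g ^ 2 * C" by (auto simp: pideal_sq_def)
  then have "q = of_int p * (of_int p * A + g * B) + g * (g * C)" by (simp add: algebra_simps power2_eq_square)
  then show "q \<in> M" unfolding pideal_def by blast
qed

text \<open>If p q is in M^2, then p divides g^2 C; it is prime in Z[x] and does not divide the
  monic g, so C is a multiple of p and one factor p cancels. This turns f = p w mod M^2 into the
  condition w in M.\<close>

lemma M2_p_mult: "of_int p * q \<in> M2 \<longleftrightarrow> q \<in> M"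
proof
  assume "of_int p * q \<in> M2"
  then obtain A B C where q: "of_int p * q = of_int p ^ 2 * A + of_int p * g * B + g ^ 2 * C"
    by (auto simp: pideal_sq_def)
  then have "g ^ 2 * C = of_int p * (q - of_int p * A - g * B)" by (simp add: algebra_simps power2_eq_square)
  then have "of_int p dvd g ^ 2 * C" by simp
  then have "of_int p dvd C"
    using prime_elem_of_int_poly[OF prime] not_dvd_monic[OF prime monic]
    by (meson prime_elem_dvd_mult_iff prime_elem_dvd_power)
  then obtain D where D: "C = of_int p * D" by auto
  have "of_int p * q = of_int p * (of_int p * A + g * (B + g * D))"
    unfolding q D by (simp add: algebra_simps power2_eq_square)
  then have "q = of_int p * A + g * (B + g * D)" using prime by (simp add: prime_gt_0_int)
  then show "q \<in> M" unfolding pideal_def by blast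
qed (rule M2_mult[OF p_in_M])

text \<open>M^2 is primary: primality of M already puts q in M, so with u s = 1 + j the error j q
  lies in M^2.\<close>

lemma M2_unit_mult: assumes "u \<notin> M" shows "u * q \<in> M2 \<longleftrightarrow> q \<in> M2"
proof
  assume uq: "u * q \<in> M2"
  then have "q \<in> M" using assms M_prime M2_subset by blast
  obtain s j where s: "u * s = 1 + j" "j \<in> M" using assms by (rule unit)
  have "u * q * s = u * s * q" by (simp add: mult_ac)
  then have "u * q * s = q + j * q" using s(1) by (simp add: distrib_right)
  then have "q = u * q * s - j * q" by simp
  then show "q \<in> M2" using M2_ideal(5)[OF M2_ideal(3)[OF uq, of s] M2_mult[OF s(2) \<open>q \<in> M\<close>]] by simp
qed (rule M2_ideal(4))

lemma M2_of_int: "of_int z \<in> M2 \<longleftrightarrow> p ^ 2 dvd z"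
proof (cases "p dvd z")
  case True
  then obtain w where w: "z = p * w" by auto
  have "p ^ 2 dvd z \<longleftrightarrow> p dvd w" using prime by (auto simp: w power2_eq_square)
  then show ?thesis using M2_p_mult[of "of_int w"] M_of_int[of w] by (simp add: w)
next
  case False
  then have "\<not> p ^ 2 dvd z" by (meson dvd_trans dvd_power zero_less_numeral)
  then show ?thesis using False M_of_int M2_subset by blast
qed

lemma power_first_order:
  assumes d: "d \<in> M"
  shows "(r + d) ^ n - (r ^ n + of_nat n * r ^ (n - 1) * d) \<in> M2"
proof (induction n)
  case 0 then show ?case by (simp add: M2_ideal(1))
next
  case (Suc n)
  let ?e = "(r + d) ^ n - (r ^ n + of_nat n * r ^ (n - 1) * d)"
  \<comment> \<open>The factor n covers the truncated exponent n - 1 at n = 0.\<close>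
  have r: "of_nat n * r ^ n = of_nat n * (r * r ^ (n - 1))" by (cases n) auto
  have "(r + d) ^ Suc n - (r ^ Suc n + of_nat (Suc n) * r ^ (Suc n - 1) * d) =
    ?e * (r + d) + d * d * (of_nat n * r ^ (n - 1)) + (of_nat n * (r * r ^ (n - 1)) - of_nat n * r ^ n) * d"
    by (simp add: ring_distribs mult_ac)
  also have "\<dots> = ?e * (r + d) + d * d * (of_nat n * r ^ (n - 1))" unfolding r by simp
  finally have "(r + d) ^ Suc n - (r ^ Suc n + of_nat (Suc n) * r ^ (Suc n - 1) * d) =
    ?e * (r + d) + d * d * (of_nat n * r ^ (n - 1))" .
  moreover have "?e * (r + d) \<in> M2" "d * d * (of_nat n * r ^ (n - 1)) \<in> M2"
    using M2_ideal(3)[OF Suc.IH] M2_ideal(3)[OF M2_mult[OF d d]] by simp_all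
  ultimately show ?case using M2_ideal(2) by metis
qed

lemma M2_power_diff:
  assumes "q - r \<in> M" "p dvd int n"
  shows "q ^ n - r ^ n \<in> M2"
proof -
  obtain k where k: "int n = p * k" using assms(2) by auto
  have "(of_nat n :: int poly) = of_int p * of_int k" by (metis k of_int_mult of_int_of_nat_eq)
  then have "of_nat n \<in> M" by (simp add: pideal_p)
  then have "of_nat n * r ^ (n - 1) * (q - r) \<in> M2" by (rule M2_mult[OF M_ideal(3) assms(1)])
  from M2_ideal(2)[OF power_first_order[OF assms(1), of r n] this] show ?thesis by simp
qed

end

section \<open>The order generated by an algebraic integer\<close>

lemma of_rat_of_int_poly: "map_poly of_rat (map_poly of_int q) = (map_poly of_int q :: 'a::field_char_0 poly)"
  by (rule poly_eqI) (simp add: coeff_map_poly)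

lemma clear_denominators:
  obtains d :: int and Q where "d > 0" "Polynomial.smult (of_int d) q = (map_poly of_int Q :: rat poly)"
proof -
  have "\<exists>d Q. d > 0 \<and> Polynomial.smult (of_int d) q = (map_poly of_int Q :: rat poly)"
  proof (induction q)
    case 0
    show ?case by (rule exI[of _ 1], rule exI[of _ 0]) simp
  next
    case (pCons r q)
    then obtain d Q where dQ: "d > 0" "Polynomial.smult (of_int d) q = (map_poly of_int Q :: rat poly)" by auto
    obtain a b where ab: "r = of_int a / of_int b" "b > 0" by (metis Fract_of_int_quotient Rat_cases)
    have "Polynomial.smult (of_int (b * d)) (pCons r q)
        = pCons (of_int (a * d)) (Polynomial.smult (of_int b) (Polynomial.smult (of_int d) q))"
      using ab by simp
    also have "\<dots> = map_poly of_int (pCons (a * d) (Polynomial.smult b Q))"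
      unfolding dQ(2) by (simp add: of_int_hom.map_poly_pCons_hom of_int_hom.map_poly_hom_smult)
    finally show ?case using ab dQ by (metis mult_pos_pos)
  qed
  then show thesis using that by auto
qed

lemma QQ_adj_iff: "x \<in> QQ_adj \<theta> \<longleftrightarrow> (\<exists>d Q. d > 0 \<and> of_int d * x = ipoly Q \<theta>)"
proof
  assume "x \<in> QQ_adj \<theta>"
  then obtain q :: "rat poly" where q: "x = poly (map_poly of_rat q) \<theta>" by (auto simp: QQ_adj_def)
  obtain d Q where dQ: "d > 0" "Polynomial.smult (of_int d) q = (map_poly of_int Q :: rat poly)"
    by (rule clear_denominators)
  have "of_int d * x = poly (map_poly of_rat (Polynomial.smult (of_int d) q)) \<theta>"
    by (simp add: q of_rat_hom.map_poly_hom_smult)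
  also have "\<dots> = ipoly Q \<theta>" unfolding dQ(2) of_rat_of_int_poly ..
  finally show "\<exists>d Q. d > 0 \<and> of_int d * x = ipoly Q \<theta>" using dQ(1) by blast
next
  assume "\<exists>d Q. d > 0 \<and> of_int d * x = ipoly Q \<theta>"
  then obtain d Q where dQ: "d > 0" "of_int d * x = ipoly Q \<theta>" by auto
  have "poly (map_poly of_rat (Polynomial.smult (1 / of_int d) (map_poly of_int Q))) \<theta> = ipoly Q \<theta> / of_int d"
    by (simp add: of_rat_hom.map_poly_hom_smult of_rat_of_int_poly of_rat_divide)
  also have "\<dots> = x" using dQ by (simp add: field_simps)
  finally show "x \<in> QQ_adj \<theta>" unfolding QQ_adj_def by blast
qed

lemma ZZ_adj_iff: "x \<in> ZZ_adj \<theta> \<longleftrightarrow> (\<exists>q. x = ipoly q \<theta>)"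
  by (auto simp: ZZ_adj_def)

lemma ZZ_adj_closed:
  "0 \<in> ZZ_adj \<theta>"
  "x \<in> ZZ_adj \<theta> \<Longrightarrow> y \<in> ZZ_adj \<theta> \<Longrightarrow> x + y \<in> ZZ_adj \<theta>"
  "x \<in> ZZ_adj \<theta> \<Longrightarrow> y \<in> ZZ_adj \<theta> \<Longrightarrow> x - y \<in> ZZ_adj \<theta>"
  "x \<in> ZZ_adj \<theta> \<Longrightarrow> y \<in> ZZ_adj \<theta> \<Longrightarrow> x * y \<in> ZZ_adj \<theta>"
  "x \<in> ZZ_adj \<theta> \<Longrightarrow> - x \<in> ZZ_adj \<theta>"
  "ipoly q \<theta> \<in> ZZ_adj \<theta>"
  unfolding ZZ_adj_iff by (metis map_poly_0 poly_0 ipoly_simps)+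

text \<open>If \<open>b e = z\<close> and \<open>P(e) = 0\<close>, then clearing denominators in \<open>P(z/b)\<close> gives a form vanishing at \<open>(b, z)\<close>.\<close>

definition homogenize :: "int poly \<Rightarrow> int poly \<Rightarrow> int poly \<Rightarrow> int poly" where
  "homogenize P b z = (\<Sum>i\<le>degree P. of_int (coeff P i) * b ^ (degree P - i) * z ^ i)"

lemma ipoly_homogenize:
  fixes e x :: complex
  assumes "ipoly b x * e = ipoly z x"
  shows "ipoly (homogenize P b z) x = ipoly b x ^ degree P * ipoly P e"
proof -
  have sum: "ipoly (sum h I) x = (\<Sum>i\<in>I. ipoly (h i) x)" for h :: "nat \<Rightarrow> int poly" and I
    by (induction I rule: infinite_finite_induct) auto
  have "ipoly (homogenize P b z) x
      = (\<Sum>i\<le>degree P. of_int (coeff P i) * ipoly b x ^ (degree P - i) * (ipoly b x * e) ^ i)"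
    by (simp add: homogenize_def sum assms)
  also have "\<dots> = (\<Sum>i\<le>degree P. ipoly b x ^ degree P * (of_int (coeff P i) * e ^ i))"
  proof (rule sum.cong)
    fix i assume "i \<in> {..degree P}"
    then have "ipoly b x ^ degree P = ipoly b x ^ (degree P - i) * ipoly b x ^ i"
      by (simp flip: power_add)
    then show "of_int (coeff P i) * ipoly b x ^ (degree P - i) * (ipoly b x * e) ^ i
        = ipoly b x ^ degree P * (of_int (coeff P i) * e ^ i)"
      by (simp add: power_mult_distrib)
  qed simp
  also have "\<dots> = ipoly b x ^ degree P * ipoly P e"
    by (simp add: poly_altdef sum_distrib_left)
  finally show ?thesis .
qed

text \<open>Every term except the top one carries a positive power of b, so modulo b an integral
  equation for z/b leaves only a power of z.\<close>

lemma homogenize_monic: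
  assumes "monic P"
  shows "\<exists>r. homogenize P b z = z ^ degree P + b * r"
proof -
  have "homogenize P b z = (\<Sum>i<degree P. of_int (coeff P i) * b ^ (degree P - i) * z ^ i) + z ^ degree P"
    using assms sum.lessThan_Suc[of "\<lambda>i. of_int (coeff P i) * b ^ (degree P - i) * z ^ i" "degree P"]
    by (simp add: homogenize_def lessThan_Suc_atMost)
  moreover have "b dvd (\<Sum>i<degree P. of_int (coeff P i) * b ^ (degree P - i) * z ^ i)"
    by (intro dvd_sum dvd_mult2 dvd_mult dvd_power) auto
  ultimately show ?thesis by (auto simp: add.commute elim!: dvdE)
qed

text \<open>Dividing an annihilating polynomial by the variable until its constant term is nonzero
  writes that constant as an algebraic integer times x. Such an integer D later bounds
  denominators.\<close>

lemma algebraic_int_dvd_int: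
  assumes "algebraic_int (x :: complex)" "x \<noteq> 0"
  obtains D :: int and y where "D > 0" "algebraic_int y" "y * x = of_int D"
proof -
  have "\<exists>D y. D \<noteq> 0 \<and> algebraic_int y \<and> y * x = of_int D" if "P \<noteq> 0" "ipoly P x = 0" for P :: "int poly"
    using that
  proof (induction P)
    case (pCons c P)
    show ?case
    proof (cases "c = 0")
      case True
      then show ?thesis using pCons assms(2) by auto
    next
      case False
      have "- ipoly P x * x = of_int c" using pCons.prems(2) by (simp add: algebra_simps add_eq_0_iff)
      then show ?thesis using False algebraic_int_ipoly[OF assms(1), of P] algebraic_int_minus by blast
    qed
  qed simp
  moreover obtain P where "ipoly P x = 0" "lead_coeff P = 1"
    using assms(1) unfolding algebraic_int_altdef_ipoly by auto
  moreover from this have "P \<noteq> 0" by auto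
  ultimately obtain D y where Dy: "D \<noteq> 0" "algebraic_int y" "y * x = of_int D" by blast
  show thesis
  proof (cases "D > 0")
    case True then show ?thesis using that Dy by blast
  next
    case False then show ?thesis using that[of "- D" "- y"] Dy by auto
  qed
qed

lemma algebraic_int_diff:
  "algebraic_int x \<Longrightarrow> algebraic_int y \<Longrightarrow> algebraic_int (x - y :: complex)"
  using algebraic_int_add[of x "- y"] by simp

lemma algebraic_int_coeff_prod_linear:
  fixes S :: "complex set"
  assumes "\<And>u. u \<in> S \<Longrightarrow> algebraic_int u"
  shows "algebraic_int (coeff (\<Prod>u\<in>S. [:- u, 1:]) i)"
  using assms
proof (induction S arbitrary: i rule: infinite_finite_induct)
  case (insert u S)
  have *: "algebraic_int (coeff (\<Prod>u\<in>S. [:- u, 1:]) i)" for i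
    using insert.IH insert.prems by auto
  have "algebraic_int (- u * coeff (\<Prod>u\<in>S. [:- u, 1:]) i)"
    using * insert.prems by (intro algebraic_int_mult) auto
  then show ?case using insert.hyps *
    by (cases i) (auto simp: mult_pCons_left intro!: algebraic_int_diff)
qed (auto simp: coeff_1 intro: int_imp_algebraic_int)

section \<open>The integers of Q(\<theta>) and the finiteness of the index\<close>

locale simple_order =
  fixes f :: "int poly" and \<theta> :: complex
  assumes monic: "monic f" and irred: "irreducible (map_poly (of_int :: int \<Rightarrow> rat) f)"
    and root: "ipoly f \<theta> = 0"
begin

lemma degree_pos: "degree f > 0"
  by (rule monic_root_power(1)[OF root monic])

text \<open>Irreducibility makes a nonzero remainder coprime to f over Q, and the Bezout identity
  then fails at z. Allowing any root z of f lets relations pass from \<theta> to its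
  conjugates.\<close>

lemma root_iff_dvd:
  fixes z :: complex
  assumes z: "ipoly f z = 0"
  shows "ipoly q z = 0 \<longleftrightarrow> f dvd q"
proof
  assume q: "ipoly q z = 0"
  obtain a r where ar: "q = f * a + r" "r = 0 \<or> degree r < degree f" using monic by (rule monic_div_mod)
  have r: "ipoly r z = 0" using q z ar(1) by simp
  have "r = 0"
  proof (rule ccontr)
    assume "r \<noteq> 0"
    define F R where "F = map_poly (of_int :: int \<Rightarrow> rat) f" and "R = map_poly (of_int :: int \<Rightarrow> rat) r"
    have "R \<noteq> 0" "degree R < degree F" using ar(2) \<open>r \<noteq> 0\<close> by (auto simp: F_def R_def)
    then have nd: "\<not> F dvd R" by (meson dvd_imp_degree_le not_le)
    have "F dvd gcd F R \<or> is_unit (gcd F R)"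
      using irreducibleD'[OF irred, of "gcd F R"] by (simp add: F_def)
    moreover have "\<not> F dvd gcd F R" using nd by simp
    ultimately have "gcd F R = 1" by (metis is_unit_gcd_iff)
    then obtain u v where uv: "u * F + v * R = 1" using bezout_coefficients_fst_snd by metis
    interpret map_poly_comm_ring_hom "of_rat :: rat \<Rightarrow> complex" ..
    have "poly (map_poly of_rat (u * F + v * R)) z = 0"
      using z r by (simp add: F_def R_def of_rat_of_int_poly hom_add hom_mult)
    then show False using uv by simp
  qed
  then show "f dvd q" using ar(1) by simp
qed (use z in \<open>auto elim!: dvdE\<close>)

abbreviation "Zth \<equiv> ZZ_adj \<theta>"
abbreviation "OK \<equiv> ring_of_integers (QQ_adj \<theta>)"

lemma \<theta>_int: "algebraic_int \<theta>"
  using root monic unfolding algebraic_int_altdef_ipoly by blast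

lemma OK_iff: "x \<in> OK \<longleftrightarrow> algebraic_int x \<and> (\<exists>d Q. d > 0 \<and> of_int d * x = ipoly Q \<theta>)"
  by (auto simp: ring_of_integers_def QQ_adj_iff)

lemma Zth_subset_OK: "Zth \<subseteq> OK"
proof
  fix x assume "x \<in> Zth"
  then obtain q where q: "x = ipoly q \<theta>" by (auto simp: ZZ_adj_iff)
  show "x \<in> OK"
    unfolding OK_iff using q algebraic_int_ipoly[OF \<theta>_int, of q]
    by (intro conjI exI[of _ 1] exI[of _ q]) auto
qed

lemma OK_add: assumes "x \<in> OK" "y \<in> OK" shows "x + y \<in> OK"
proof -
  obtain d Q d' Q' where *: "d > 0" "of_int d * x = ipoly Q \<theta>" "d' > 0" "of_int d' * y = ipoly Q' \<theta>"
    using assms unfolding OK_iff by blast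
  have "of_int (d * d') * (x + y) = of_int d' * (of_int d * x) + of_int d * (of_int d' * y)"
    by (simp add: algebra_simps)
  also have "\<dots> = ipoly (of_int d' * Q + of_int d * Q') \<theta>" unfolding * by simp
  finally have "of_int (d * d') * (x + y) = ipoly (of_int d' * Q + of_int d * Q') \<theta>" .
  moreover have "d * d' > 0" using * by simp
  moreover have "algebraic_int (x + y)" using assms algebraic_int_add by (simp add: OK_iff)
  ultimately show ?thesis unfolding OK_iff by blast
qed

lemma OK_mult: assumes "x \<in> OK" "y \<in> OK" shows "x * y \<in> OK"
proof -
  obtain d Q d' Q' where *: "d > 0" "of_int d * x = ipoly Q \<theta>" "d' > 0" "of_int d' * y = ipoly Q' \<theta>"
    using assms unfolding OK_iff by blast
  have "of_int (d * d') * (x * y) = (of_int d * x) * (of_int d' * y)"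
    by (simp add: algebra_simps)
  also have "\<dots> = ipoly (Q * Q') \<theta>" unfolding * by simp
  finally have "of_int (d * d') * (x * y) = ipoly (Q * Q') \<theta>" .
  moreover have "d * d' > 0" using * by simp
  moreover have "algebraic_int (x * y)" using assms algebraic_int_mult by (simp add: OK_iff)
  ultimately show ?thesis unfolding OK_iff by blast
qed

lemma OK_uminus: assumes "x \<in> OK" shows "- x \<in> OK"
proof -
  have "ipoly (- 1) \<theta> \<in> OK" using Zth_subset_OK ZZ_adj_closed(6) by blast
  from OK_mult[OF this assms] show ?thesis by simp
qed

text \<open>Cleared of denominators, the integral equation of x is a polynomial relation in
  \<theta>, hence a multiple of f, hence valid at the conjugate z.\<close>

lemma conjugate_int:
  assumes x: "algebraic_int x" "of_int d * x = ipoly r \<theta>" "d \<noteq> 0" and z: "ipoly f z = 0"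
  shows "algebraic_int (ipoly r z / of_int d :: complex)"
proof -
  obtain P where P: "ipoly P x = 0" "lead_coeff P = 1"
    using x(1) unfolding algebraic_int_altdef_ipoly by auto
  have "ipoly (homogenize P (of_int d) r) \<theta> = 0"
    using ipoly_homogenize[of "of_int d" \<theta> x r P] x(2) P(1) by simp
  then have "ipoly (homogenize P (of_int d) r) z = 0" using root_iff_dvd[OF root] root_iff_dvd[OF z] by simp
  then have "ipoly P (ipoly r z / of_int d) = 0"
    using ipoly_homogenize[of "of_int d" z "ipoly r z / of_int d" r P] x(3) by simp
  then show ?thesis using P(2) unfolding algebraic_int_altdef_ipoly by blast
qed

text \<open>Lagrange interpolation over the conjugates of \<open>\<theta>\<close> bounds the denominators of algebraic integers.\<close>

lemma bounded_denominators:
  obtains D :: int where "D > 0" "\<And>x. x \<in> OK \<Longrightarrow> of_int D * x \<in> Zth"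
proof -
  define F where "F = (map_poly of_int f :: complex poly)"
  define S where "S = {z. poly F z = 0}"
  have F: "lead_coeff F = 1" "F \<noteq> 0" "degree F = degree f" using monic by (auto simp: F_def)
  have finS: "finite S" unfolding S_def using F(2) by (rule poly_roots_finite)
  have "rsquarefree F"
  proof (unfold rsquarefree_roots, intro allI notI)
    fix z assume z: "poly F z = 0 \<and> poly (pderiv F) z = 0"
    then have "ipoly (pderiv f) z = 0" by (simp add: F_def of_int_hom.map_poly_pderiv)
    then have "f dvd pderiv f" using z root_iff_dvd[of z "pderiv f"] by (simp add: F_def)
    moreover have "pderiv f \<noteq> 0" using degree_pos by (simp add: pderiv_eq_0_iff)
    ultimately have "degree f \<le> degree (pderiv f)" by (rule dvd_imp_degree_le)
    then show False using degree_pos by (simp add: degree_pderiv)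
  qed
  from complex_poly_decompose_rsquarefree[OF this] have Fp: "(\<Prod>z\<in>S. [:- z, 1:]) = F"
    using F(1) by (simp add: S_def)
  have cardS: "card S = degree f" using Fp F(3) degree_prod_eq_sum_degree[of S "\<lambda>z. [:- z, 1:]"] by simp
  have S_int: "algebraic_int z" if "z \<in> S" for z
    using that monic unfolding S_def F_def algebraic_int_altdef_ipoly by blast
  \<comment> \<open>\<open>w z\<close> is F'(z) and \<open>L z\<close> is F/(X - z), so W is the
    discriminant up to sign. The denominator bound D is a positive integer that is an algebraic
    integer times W.\<close>
  define w where "w z = (\<Prod>u\<in>S - {z}. z - u)" for z
  define W where "W = prod w S"
  define L where "L z = (\<Prod>u\<in>S - {z}. [:- u, 1:])" for z
  have w0: "w z \<noteq> 0" if "z \<in> S" for z using finS by (auto simp: w_def)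
  have w_int: "algebraic_int (w z)" if "z \<in> S" for z
    unfolding w_def using S_int that by (intro algebraic_int_prod algebraic_int_diff) auto
  have W: "algebraic_int W" "W \<noteq> 0"
    unfolding W_def using w_int w0 finS by (auto intro: algebraic_int_prod)
  obtain D W' where D: "D > 0" "algebraic_int W'" "W' * W = of_int D" using algebraic_int_dvd_int[OF W] .
  have "of_int D * x \<in> Zth" if x: "x \<in> OK" for x
  proof -
    obtain d Q where dQ: "d > 0" "of_int d * x = ipoly Q \<theta>" using x by (auto simp: OK_iff)
    obtain a r where ar: "Q = f * a + r" "r = 0 \<or> degree r < degree f" using monic by (rule monic_div_mod)
    have dr: "of_int d * x = ipoly r \<theta>" "degree r < degree f" using dQ ar root degree_pos by auto
    define X where "X z = (ipoly r z / of_int d :: complex)" for z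
    have X_int: "algebraic_int (X z)" if "z \<in> S" for z
      unfolding X_def using conjugate_int[OF _ dr(1)] x dQ(1) that by (auto simp: OK_iff S_def F_def)
    have Lz: "poly (L z) u = (if u = z then w z else 0)" if "u \<in> S" for z u
      using finS that by (auto simp: L_def w_def poly_prod)
    have degL: "degree (L z) < card S" if "z \<in> S" for z
      using finS that card_gt_0_iff[of S] by (auto simp: L_def degree_prod_eq_sum_degree)
    have "map_poly of_int r = (\<Sum>z\<in>S. Polynomial.smult (of_int d * X z / w z) (L z))"
    proof (rule poly_eqI_degree)
      fix u assume u: "u \<in> S"
      have "poly (\<Sum>z\<in>S. Polynomial.smult (of_int d * X z / w z) (L z)) u
          = (\<Sum>z\<in>S. if z = u then of_int d * X u else 0)"
        unfolding poly_sum by (rule sum.cong) (use u w0 in \<open>auto simp: Lz\<close>)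
      also have "\<dots> = ipoly r u" using finS u dQ(1) by (simp add: X_def)
      finally show "ipoly r u = poly (\<Sum>z\<in>S. Polynomial.smult (of_int d * X z / w z) (L z)) u" ..
    next
      show "card S > degree (map_poly of_int r :: complex poly)" using dr(2) cardS by simp
      show "card S > degree (\<Sum>z\<in>S. Polynomial.smult (of_int d * X z / w z) (L z))"
        using degL degree_pos cardS by (intro degree_sum_less) (auto intro: le_less_trans[OF degree_smult_le])
    qed
    from arg_cong[OF this, of "\<lambda>q. coeff q _"]
    have coeff: "of_int (coeff r i) = (\<Sum>z\<in>S. of_int d * X z / w z * coeff (L z) i)" for i
      by (simp add: coeff_sum)
    have "d dvd coeff (of_int D * r) i" for i
    proof -
      \<comment> \<open>The quotient D r_i / d is rational and, by the interpolation formula, an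
        algebraic integer; hence it is an integer.\<close>
      have "of_int D * of_int (coeff r i) / of_int d
          = W' * (\<Sum>z\<in>S. X z * (W / w z * coeff (L z) i))"
        unfolding coeff D(3)[symmetric] using dQ(1)
        by (simp add: sum_distrib_left sum_divide_distrib mult_ac)
      moreover have "algebraic_int (W / w z)" if z: "z \<in> S" for z
      proof -
        have "W / w z = prod w (S - {z})"
          unfolding W_def using prod.remove[OF finS z, of w] w0[OF z] by simp
        then show ?thesis using w_int by (auto intro!: algebraic_int_prod)
      qed
      then have "algebraic_int (\<Sum>z\<in>S. X z * (W / w z * coeff (L z) i))"
        using X_int S_int unfolding L_def
        by (intro algebraic_int_sum algebraic_int_mult algebraic_int_coeff_prod_linear) auto
      ultimately have "algebraic_int (of_int D * of_int (coeff r i) / of_int d :: complex)"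
        using D(2) by (metis algebraic_int_mult)
      then have "of_int D * of_int (coeff r i) / of_int d \<in> (\<int> :: complex set)"
        by (rule rational_algebraic_int_is_int) auto
      then obtain k where "of_int D * of_int (coeff r i) / of_int d = (of_int k :: complex)" by (auto elim: Ints_cases)
      then have "(of_int (D * coeff r i) :: complex) = of_int (k * d)" using dQ(1) by (simp add: field_simps)
      then have "D * coeff r i = k * d" by (simp only: of_int_eq_iff)
      then show ?thesis by (simp add: of_int_poly)
    qed
    then have "of_int d dvd of_int D * r" unfolding dvd_of_int_poly_iff by blast
    then obtain q where q: "of_int D * r = of_int d * q" by auto
    have "of_int d * (of_int D * x) = of_int D * ipoly r \<theta>" using dr(1) by (simp add: mult_ac)
    also have "\<dots> = ipoly (of_int D * r) \<theta>" by simp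
    also have "\<dots> = of_int d * ipoly q \<theta>" unfolding q by simp
    finally have "of_int D * x = ipoly q \<theta>" using dQ(1) by simp
    then show ?thesis unfolding ZZ_adj_iff by blast
  qed
  with D(1) that show thesis by blast
qed

lemma coset_eq_iff: "(+) x ` Zth = (+) y ` Zth \<longleftrightarrow> x - y \<in> Zth"
proof
  assume "(+) x ` Zth = (+) y ` Zth"
  then have "x \<in> (+) y ` Zth" using ZZ_adj_closed(1)[of \<theta>] by force
  then show "x - y \<in> Zth" by auto
next
  have sub: "(+) x ` Zth \<subseteq> (+) y ` Zth" if "x - y \<in> Zth" for x y
  proof
    fix u assume "u \<in> (+) x ` Zth"
    then obtain v where v: "v \<in> Zth" "u = x + v" by auto
    then have "u = y + (x - y + v)" by simp
    then show "u \<in> (+) y ` Zth" using ZZ_adj_closed(2)[OF that v(1)] by blast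
  qed
  assume "x - y \<in> Zth"
  moreover from ZZ_adj_closed(5)[OF this] have "y - x \<in> Zth" by simp
  ultimately show "(+) x ` Zth = (+) y ` Zth" using sub by blast
qed

text \<open>Writing D x = r(\<theta>) with r of degree below that of f, the coset of x depends only
  on the coefficients of r modulo D.\<close>

lemma finite_cosets: "finite ((\<lambda>x. (+) x ` Zth) ` OK)"
proof -
  obtain D :: int where D: "D > 0" "\<And>x. x \<in> OK \<Longrightarrow> of_int D * x \<in> Zth" using bounded_denominators by blast
  define Ls where "Ls = {xs. set xs \<subseteq> {0..<D} \<and> length xs = degree f}"
  have "(\<lambda>x. (+) x ` Zth) ` OK \<subseteq> (\<lambda>xs. (+) (ipoly (Poly xs) \<theta> / of_int D) ` Zth) ` Ls"
  proof (rule image_subsetI)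
    fix x assume "x \<in> OK"
    then obtain q where q: "of_int D * x = ipoly q \<theta>" using D(2) unfolding ZZ_adj_iff by blast
    obtain a r where ar: "q = f * a + r" "r = 0 \<or> degree r < degree f" using monic by (rule monic_div_mod)
    have r: "of_int D * x = ipoly r \<theta>" "degree r < degree f" using q ar root degree_pos by auto
    define xs where "xs = map (\<lambda>i. coeff r i mod D) [0..<degree f]"
    have xs: "xs \<in> Ls" using D(1) by (auto simp: xs_def Ls_def)
    have c: "coeff (Poly xs) i = coeff r i mod D" for i
      using r(2) by (auto simp: xs_def nth_default_def coeff_eq_0)
    have "of_int D dvd r - Poly xs" unfolding dvd_of_int_poly_iff using c by (auto simp: minus_mod_eq_mult_div)
    then obtain b where b: "r = of_int D * b + Poly xs" by (metis diff_add_cancel dvdE)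
    have "x - ipoly (Poly xs) \<theta> / of_int D = ipoly b \<theta>"
      using r(1) D(1) unfolding b by (simp add: field_simps)
    then have "(+) x ` Zth = (+) (ipoly (Poly xs) \<theta> / of_int D) ` Zth"
      unfolding coset_eq_iff by (simp add: ZZ_adj_closed(6))
    then show "(+) x ` Zth \<in> (\<lambda>xs. (+) (ipoly (Poly xs) \<theta> / of_int D) ` Zth) ` Ls" using xs by blast
  qed
  moreover have "finite Ls" unfolding Ls_def by (rule finite_lists_length_eq) simp
  ultimately show ?thesis by (meson finite_imageI finite_subset)
qed

lemma prime_dvd_index_iff:
  assumes "prime p"
  shows "p dvd order_index \<theta> \<longleftrightarrow> (\<exists>x\<in>OK. x \<notin> Zth \<and> of_nat p * x \<in> Zth)"
  unfolding order_index_def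
proof (rule prime_dvd_card_cosets_iff)
  show "finite ((\<lambda>x. (+) x ` Zth) ` OK)" by (rule finite_cosets)
qed (use assms Zth_subset_OK ZZ_adj_closed OK_add OK_uminus in auto)

lemma index_eq_1_iff: "order_index \<theta> = 1 \<longleftrightarrow> OK = Zth"
proof
  assume "OK = Zth"
  moreover have "(+) x ` Zth = Zth" if "x \<in> Zth" for x
    using coset_eq_iff[of x 0] that by simp
  ultimately have "(\<lambda>x. (+) x ` Zth) ` OK = {Zth}" using ZZ_adj_closed(1)[of \<theta>] by auto
  then show "order_index \<theta> = 1" by (simp add: order_index_def)
next
  assume "order_index \<theta> = 1"
  then obtain c where c: "(\<lambda>x. (+) x ` Zth) ` OK = {c}" unfolding order_index_def by (rule card_1_singletonE)
  have "0 \<in> OK" using Zth_subset_OK ZZ_adj_closed(1) by blast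
  have "x \<in> Zth" if "x \<in> OK" for x
  proof -
    have "(+) y ` Zth = c" if "y \<in> OK" for y using imageI[OF that, of "\<lambda>x. (+) x ` Zth"] c by simp
    then have "(+) x ` Zth = (+) 0 ` Zth" using that \<open>0 \<in> OK\<close> by metis
    then show ?thesis unfolding coset_eq_iff by simp
  qed
  then show "OK = Zth" using Zth_subset_OK by blast
qed

end

section \<open>Dedekind's criterion\<close>

context simple_order
begin

text \<open>With f = p^2 A + p g B + g^2 C, the witness is the value w of g C / p at \<theta>.
  Multiplying f(\<theta>) = 0 by C(\<theta>) and dividing by p^2 gives w^2 + B w + A C = 0 at
  \<theta>, so w is integral, while p w lies in Z[\<theta>].\<close>

lemma index_dvd_if_in_square:
  assumes p: "prime p" and g: "1 \<notin> pideal (int p) g" and f: "f \<in> pideal_sq (int p) g"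
  shows "p dvd order_index \<theta>"
proof -
  let ?p = "of_nat p :: complex"
  have p0: "?p \<noteq> 0" using p by (simp add: prime_gt_0_nat)
  obtain A B C where ABC: "f = of_int (int p) ^ 2 * A + of_int (int p) * g * B + g ^ 2 * C"
    using f by (auto simp: pideal_sq_def)
  define a b c h where "a = ipoly A \<theta>" and "b = ipoly B \<theta>" and "c = ipoly C \<theta>" and "h = ipoly g \<theta>"
  have "ipoly f \<theta> = ?p ^ 2 * a + ?p * h * b + h ^ 2 * c"
    unfolding ABC by (simp add: a_def b_def c_def h_def)
  then have "?p ^ 2 * a + ?p * h * b + h ^ 2 * c = 0" using root by simp
  then have "h ^ 2 * c = - (?p ^ 2 * a + ?p * h * b)" by (rule add_eq_0_iff[THEN iffD1])
  then have rel: "h ^ 2 * c = - (?p ^ 2 * a) - ?p * h * b" by simp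
  define w where "w = h * c / ?p"
  have pw: "?p * w = ipoly (g * C) \<theta>" using p0 by (simp add: w_def h_def c_def)
  have "?p ^ 2 * w ^ 2 = c * (h ^ 2 * c)" using p0 by (simp add: w_def power_mult_distrib power_divide power2_eq_square)
  also have "\<dots> = ?p ^ 2 * (- c * a - b * w)" unfolding rel using p0 by (simp add: w_def algebra_simps power2_eq_square)
  finally have "w ^ 2 = - c * a - b * w" using p0 by simp
  \<comment> \<open>The list holds the two coefficients of the quadratic equation of w, in the shape
    that \<open>algebraic_int_extension\<close> expects.\<close>
  moreover have "(\<Sum>j<2. ipoly ([- C * A, - B] ! j) \<theta> * w ^ j) = - c * a - b * w"
    by (simp add: numeral_2_eq_2 a_def b_def c_def)
  ultimately have "w ^ 2 = (\<Sum>j<2. ipoly ([- C * A, - B] ! j) \<theta> * w ^ j)" by simp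
  from algebraic_int_extension(1)[OF \<theta>_int _ this] have "algebraic_int w" by simp
  moreover have "of_int (int p) * w = ipoly (g * C) \<theta>" using pw by simp
  moreover have "int p > 0" using p by (simp add: prime_gt_0_nat)
  ultimately have "w \<in> OK" unfolding OK_iff by blast
  moreover have "?p * w \<in> Zth" unfolding pw by (rule ZZ_adj_closed(6))
  moreover have "w \<notin> Zth"
  proof
    assume "w \<in> Zth"
    then obtain q where q: "w = ipoly q \<theta>" by (auto simp: ZZ_adj_iff)
    have "ipoly (g * C - of_int (int p) * q) \<theta> = 0" using pw q by simp
    then have "f dvd g * C - of_int (int p) * q" using root_iff_dvd[OF root] by blast
    then obtain r where r: "g * C - of_int (int p) * q = f * r" by auto
    \<comment> \<open>If w were in Z[\<theta>], then g C (1 - g r) would vanish modulo p; since (p,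
      g) is proper, p would divide g C and hence f.\<close>
    have "g * C * (1 - g * r) = (g * C - of_int (int p) * q) + of_int (int p) * q - g ^ 2 * C * r"
      by (simp add: algebra_simps power2_eq_square)
    also have "\<dots> = of_int (int p) * (q + (of_int (int p) * A + g * B) * r)"
      unfolding r unfolding ABC by (simp add: algebra_simps power2_eq_square)
    finally have "of_int (int p) dvd g * C * (1 - g * r)" by simp
    moreover have pe: "prime_elem (of_int (int p) :: int poly)"
      using p by (intro prime_elem_of_int_poly) simp
    moreover have "\<not> of_int (int p) dvd 1 - g * r"
    proof
      assume "of_int (int p) dvd 1 - g * r"
      then obtain s where "1 - g * r = of_int (int p) * s" by auto
      then have "1 = of_int (int p) * s + g * r" by (simp add: algebra_simps)
      then show False using g unfolding pideal_def by blast
    qed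
    ultimately have "of_int (int p) dvd g * C" by (simp add: prime_elem_dvd_mult_iff)
    then obtain s where s: "g * C = of_int (int p) * s" by auto
    have "f = of_int (int p) * (of_int (int p) * A + g * B + g * s)"
      unfolding ABC power2_eq_square mult.assoc s by (simp add: algebra_simps)
    then have "of_int (int p) dvd f" by simp
    then show False using not_dvd_monic[of "int p" f] p monic by simp
  qed
  ultimately show ?thesis unfolding prime_dvd_index_iff[OF p] by blast
qed

text \<open>The homogenized integral equation of e = z/b is a multiple of f, so a power of z lies in
  (f, b) and thus in M.\<close>

lemma numerator_in_maximal:
  assumes g: "maximal_pair p g" and f: "f \<in> pideal p g" and b: "b \<in> pideal p g"
    and e: "algebraic_int e" "ipoly b \<theta> * e = ipoly z \<theta>"
  shows "z \<in> pideal p g"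
proof -
  interpret maximal_pair p g by fact
  obtain P where P: "ipoly P e = 0" "lead_coeff P = 1"
    using e(1) unfolding algebraic_int_altdef_ipoly by auto
  have "ipoly (homogenize P b z) \<theta> = 0" using ipoly_homogenize[OF e(2)] P by simp
  then have "f dvd homogenize P b z" using root_iff_dvd[OF root] by blast
  then have H: "homogenize P b z \<in> M" using M_ideal(3)[OF f] by (auto elim!: dvdE)
  obtain r where r: "homogenize P b z = z ^ degree P + b * r" using homogenize_monic[OF P(2)] by auto
  have "z ^ degree P \<in> M" using M_ideal(5)[OF H M_ideal(3)[OF b, of r]] unfolding r by simp
  then show ?thesis using M_power by blast
qed

text \<open>Here \<open>b1\<close> generates the maximal ideal locally, because \<open>b1 A + b2 B = 0\<close> with \<open>B\<close> a local unit.\<close>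

lemma locally_principal:
  assumes g: "maximal_pair p g" and f: "f \<in> pideal p g"
    and gen: "\<And>q. q \<in> pideal p g \<longleftrightarrow> (\<exists>u v. q = b1 * u + b2 * v)"
    and rel: "f = b1 * A + b2 * B" and B: "B \<notin> pideal p g" and b1: "ipoly b1 \<theta> \<noteq> 0"
    and e: "algebraic_int e" "ipoly b1 \<theta> * e \<in> Zth" "ipoly b2 \<theta> * e \<in> Zth"
  shows "e \<in> Zth"
proof -
  interpret maximal_pair p g by fact
  have "b1 = b1 * 1 + b2 * 0" by simp
  then have b1M: "b1 \<in> M" using gen by blast
  obtain z where z: "ipoly b1 \<theta> * e = ipoly z \<theta>" using e(2) by (auto simp: ZZ_adj_iff)
  have "z \<in> M" using numerator_in_maximal[OF g f b1M e(1) z] .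
  then obtain u v where uv: "z = b1 * u + b2 * v" using gen by blast
  \<comment> \<open>Multiplying by B removes the generator b2 in favour of f, which vanishes at
    \<theta>; cancelling b1 then gives B e in Z[\<theta>].\<close>
  have "B * z = b1 * (u * B - A * v) + f * v" unfolding uv rel by (simp add: algebra_simps)
  then have "ipoly (B * z) \<theta> = ipoly (b1 * (u * B - A * v)) \<theta>" using root by simp
  moreover have "ipoly b1 \<theta> * (ipoly B \<theta> * e) = ipoly (B * z) \<theta>" using z by simp
  ultimately have "ipoly b1 \<theta> * (ipoly B \<theta> * e) = ipoly b1 \<theta> * ipoly (u * B - A * v) \<theta>"
    by simp
  then have Be: "ipoly B \<theta> * e = ipoly (u * B - A * v) \<theta>" using b1 by simp
  \<comment> \<open>B is inverted only modulo M, but the error term j e also lies in Z[\<theta>],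
    because b1 and b2 both carry e into it.\<close>
  obtain s j where s: "B * s = 1 + j" "j \<in> M" using B by (rule unit)
  obtain x y where j: "j = b1 * x + b2 * y" using s(2) gen by blast
  have "ipoly B \<theta> * ipoly s \<theta> = 1 + ipoly j \<theta>" using s(1) by (metis ipoly_simps(1,4,9))
  then have "e = ipoly s \<theta> * (ipoly B \<theta> * e)
      - (ipoly x \<theta> * (ipoly b1 \<theta> * e) + ipoly y \<theta> * (ipoly b2 \<theta> * e))"
    unfolding j by (simp add: algebra_simps)
  also have "\<dots> \<in> Zth" unfolding Be
    by (rule ZZ_adj_closed(3)[OF ZZ_adj_closed(4) ZZ_adj_closed(2)[OF ZZ_adj_closed(4) ZZ_adj_closed(4)]])
      (rule ZZ_adj_closed(6) e(2,3))+
  finally show ?thesis .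
qed

text \<open>Let I consist of all q with q(\<theta>) x in Z[\<theta>], generated by p and d, and let
  M = (p, g) contain I. Writing d = p A + g B, the element e = B(\<theta>) x lies outside
  Z[\<theta>] but is carried into it by all of M. If a coefficient in f = p A' + g B' were a unit
  modulo M, then M would be locally principal at \<theta> and e would fall into Z[\<theta>].\<close>

lemma maximal_pair_if_index_dvd:
  assumes p: "prime p" and dvd: "p dvd order_index \<theta>"
  obtains g where "maximal_pair (int p) g" "f \<in> pideal_sq (int p) g"
proof -
  let ?P = "of_int (int p) :: int poly"
  have pp: "prime (int p)" using p by simp
  obtain x where x: "x \<in> OK" "x \<notin> Zth" "of_nat p * x \<in> Zth" using dvd prime_dvd_index_iff[OF p] by auto
  define I where "I = {q. ipoly q \<theta> * x \<in> Zth}"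
  have I: "poly_ideal I"
    unfolding poly_ideal_def
  proof (intro conjI ballI allI)
    show "0 \<in> I" by (simp add: I_def ZZ_adj_closed(1))
    fix q assume q: "q \<in> I"
    show "q + r \<in> I" if "r \<in> I" for r
      using ZZ_adj_closed(2)[of "ipoly q \<theta> * x" \<theta> "ipoly r \<theta> * x"] q that
      by (simp add: I_def distrib_right)
    have "ipoly (q * r) \<theta> * x = ipoly r \<theta> * (ipoly q \<theta> * x)" for r by simp
    then show "q * r \<in> I" for r
      using ZZ_adj_closed(4)[OF ZZ_adj_closed(6)] q unfolding I_def mem_Collect_eq by metis
  qed
  have pI: "?P \<in> I" using x(3) by (simp add: I_def)
  have fI: "f \<in> I" using root ZZ_adj_closed(1) by (simp add: I_def)
  have oneI: "1 \<notin> I" using x(2) by (simp add: I_def)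
  obtain d where d: "monic d" "I = pideal (int p) d" using pideal_principal[OF pp I pI fI monic] by blast
  obtain g where g: "maximal_pair (int p) g" "I \<subseteq> pideal (int p) g"
    using maximal_pair_exists[OF pp I pI oneI fI monic] by blast
  interpret maximal_pair "int p" g by fact
  have "d \<in> I" using d(2) pideal_g[of d 1 "int p"] by simp
  then have "d \<in> M" using g(2) by blast
  then obtain A B where AB: "d = ?P * A + g * B" by (auto simp: pideal_def)
  \<comment> \<open>Otherwise B = d B' = g B B' modulo p, and properness of (p, g) would make p
    divide B and so d.\<close>
  have B: "B \<notin> I"
  proof
    assume "B \<in> I"
    then obtain A' B' where "B = ?P * A' + d * B'" unfolding d(2) by (auto simp: pideal_def)
    then have "B * (1 - g * B') = ?P * (A' + A * B')" unfolding AB by (simp add: algebra_simps)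
    then have "?P dvd B * (1 - g * B')" by simp
    moreover have "\<not> ?P dvd 1 - g * B'"
    proof
      assume "?P dvd 1 - g * B'"
      then obtain s where "1 - g * B' = ?P * s" by auto
      then have "1 = ?P * s + g * B'" by (simp add: algebra_simps)
      then show False using proper unfolding pideal_def by blast
    qed
    ultimately have "?P dvd B" using prime_elem_of_int_poly[OF pp] by (simp add: prime_elem_dvd_mult_iff)
    then have "?P dvd d" unfolding AB by simp
    then show False using not_dvd_monic[OF pp d(1)] by simp
  qed
  define e where "e = ipoly B \<theta> * x"
  have e_notin: "e \<notin> Zth" using B by (simp add: I_def e_def)
  have "ipoly B \<theta> \<in> OK" using Zth_subset_OK ZZ_adj_closed(6) by blast
  then have "e \<in> OK" unfolding e_def using x(1) by (rule OK_mult)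
  then have e_int: "algebraic_int e" by (simp add: OK_iff)
  have "ipoly ?P \<theta> * e = ipoly B \<theta> * (of_nat p * x)" by (simp add: e_def)
  then have pe: "ipoly ?P \<theta> * e \<in> Zth" using ZZ_adj_closed(4)[OF ZZ_adj_closed(6) x(3)] by metis
  have "g * B = d - ?P * A" using AB by simp
  also have "\<dots> \<in> I" using poly_idealD(5)[OF I \<open>d \<in> I\<close> poly_idealD(3)[OF I pI]] .
  finally have ge: "ipoly g \<theta> * e \<in> Zth" by (simp add: I_def e_def mult.assoc)
  have fM: "f \<in> M" using fI g(2) by blast
  then obtain A' B' where f: "f = ?P * A' + g * B'" by (auto simp: pideal_def)
  have "A' \<in> M"
  proof (rule ccontr)
    assume A': "A' \<notin> M"
    have "ipoly g \<theta> \<noteq> 0"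
    proof
      assume "ipoly g \<theta> = 0"
      then have "ipoly ?P \<theta> * ipoly A' \<theta> = 0" using root unfolding f by simp
      then have "ipoly A' \<theta> = 0" using p by simp
      then have "f dvd A'" using root_iff_dvd[OF root] by blast
      then show False using A' M_ideal(3)[OF fM] by (auto elim!: dvdE)
    qed
    moreover have "q \<in> M \<longleftrightarrow> (\<exists>u v. q = g * u + ?P * v)" for q
      unfolding pideal_def by (auto simp: add.commute)
    moreover have "f = g * B' + ?P * A'" using f by simp
    ultimately show False using locally_principal[OF g(1) fM _ _ A' _ e_int ge pe] e_notin by blast
  qed
  moreover have "B' \<in> M"
  proof (rule ccontr)
    assume B': "B' \<notin> M"
    have "ipoly ?P \<theta> \<noteq> 0" using p by simp
    moreover have "q \<in> M \<longleftrightarrow> (\<exists>u v. q = ?P * u + g * v)" for q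
      unfolding pideal_def by auto
    ultimately show False using locally_principal[OF g(1) fM _ f B' _ e_int pe ge] e_notin by blast
  qed
  ultimately have "f \<in> M2"
    unfolding f using M2_ideal(2)[OF M2_mult[OF p_in_M] M2_mult[OF g_in_M]] by blast
  then show thesis using that g(1) by blast
qed

theorem dedekind_criterion:
  assumes "prime p"
  shows "p dvd order_index \<theta> \<longleftrightarrow> (\<exists>g. maximal_pair (int p) g \<and> f \<in> pideal_sq (int p) g)"
proof
  assume "p dvd order_index \<theta>"
  then show "\<exists>g. maximal_pair (int p) g \<and> f \<in> pideal_sq (int p) g"
    using maximal_pair_if_index_dvd[OF assms] by blast
next
  assume "\<exists>g. maximal_pair (int p) g \<and> f \<in> pideal_sq (int p) g"
  then obtain g where g: "maximal_pair (int p) g" "f \<in> pideal_sq (int p) g" by blast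
  show "p dvd order_index \<theta>"
    using index_dvd_if_in_square[OF assms maximal_pair.proper[OF g(1)] g(2)] .
qed

end

section \<open>Resultants modulo a prime\<close>

text \<open>The rows of the Sylvester matrix, read as polynomials of degree less than \<open>degree f + degree h\<close>.\<close>

definition sylvester_row :: "int poly \<Rightarrow> int poly \<Rightarrow> nat \<Rightarrow> int poly" where
  "sylvester_row f h i = (if i < degree h then monom 1 (degree h - 1 - i) * f
     else monom 1 (degree f + degree h - 1 - i) * h)"

lemma sylvester_mat_row:
  assumes "i < degree f + degree h" "j < degree f + degree h"
  shows "sylvester_mat f h $$ (i, j) = coeff (sylvester_row f h i) (degree f + degree h - 1 - j)"
proof -
  have "coeff (monom 1 (Suc a) * q) (Suc b) = coeff (monom 1 a * q) b" for a b and q :: "int poly"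
    by (simp add: coeff_monom_mult)
  from this[of "degree h - 1 - i" f "degree f + degree h - 1 - j"]
    this[of "degree f + degree h - 1 - i" h "degree f + degree h - 1 - j"]
  show ?thesis
    unfolding sylvester_index_mat2[OF assms] sylvester_row_def using assms
    by (auto simp: Suc_diff_Suc)
qed

lemma degree_sylvester_row:
  assumes "f \<noteq> 0" "i < degree f + degree h"
  shows "degree (sylvester_row f h i) < degree f + degree h"
proof (cases "i < degree h")
  case True
  have "degree (monom (1::int) (degree h - 1 - i) * f) \<le> degree h - 1 - i + degree f"
    using degree_mult_le[of "monom (1::int) (degree h - 1 - i)" f] by (simp add: degree_monom_eq)
  then show ?thesis using True by (simp add: sylvester_row_def)
next
  case False
  have "degree (monom (1::int) (degree f + degree h - 1 - i) * h) \<le> degree f + degree h - 1 - i + degree h"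
    using degree_mult_le[of "monom (1::int) (degree f + degree h - 1 - i)" h] by (simp add: degree_monom_eq)
  then show ?thesis using False assms by (simp add: sylvester_row_def)
qed

lemma poly_ideal_sum:
  assumes I: "poly_ideal I" and h: "\<And>i. i \<in> A \<Longrightarrow> h i \<in> I"
  shows "sum h A \<in> I"
  using h by (induction A rule: infinite_finite_induct) (simp_all add: poly_idealD(1,2)[OF I])

text \<open>The adjugate times the Sylvester matrix is det times the identity. The last row of the
  adjugate therefore combines the rows, which are multiples of f and h, into the constant polynomial
  det.\<close>

lemma resultant_in_ideal:
  assumes I: "poly_ideal I" "f \<in> I" "h \<in> I" and f: "degree f > 0"
  shows "of_int (resultant f h) \<in> I"
proof -
  define r where "r = degree f + degree h"
  define S where "S = sylvester_mat f h"
  have S: "S \<in> carrier_mat r r" by (auto simp: S_def r_def)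
  have r: "r > 0" using f by (simp add: r_def)
  have "adj_mat S \<in> carrier_mat r r" and AS: "adj_mat S * S = det S \<cdot>\<^sub>m 1\<^sub>m r"
    using adj_mat(1,3)[OF S] by auto
  define R where "R = (\<Sum>i<r. of_int (adj_mat S $$ (r - 1, i)) * sylvester_row f h i)"
  have "R = of_int (det S)"
  proof (rule poly_eqI)
    fix k
    show "coeff R k = coeff (of_int (det S)) k"
    proof (cases "k < r")
      case True
      define j where "j = r - 1 - k"
      have j: "j < r" "k = r - 1 - j" using True by (auto simp: j_def)
      have "coeff R k = (\<Sum>i<r. adj_mat S $$ (r - 1, i) * S $$ (i, j))"
        unfolding R_def coeff_sum using j sylvester_mat_row[of _ f h j]
        by (intro sum.cong) (auto simp: of_int_poly S_def r_def)
      also have "\<dots> = (adj_mat S * S) $$ (r - 1, j)"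
        using S r j(1) \<open>adj_mat S \<in> carrier_mat r r\<close> by (auto simp: scalar_prod_def atLeast0LessThan)
      also have "\<dots> = (if k = 0 then det S else 0)" unfolding AS using r j by auto
      finally show ?thesis by (simp add: of_int_poly coeff_pCons split: nat.split)
    next
      case False
      have "coeff (sylvester_row f h i) k = 0" if "i < r" for i
      proof (rule coeff_eq_0)
        have "f \<noteq> 0" using f by auto
        from degree_sylvester_row[OF this, of i h] show "degree (sylvester_row f h i) < k"
          using that False by (simp add: r_def)
      qed
      then have "coeff R k = 0" unfolding R_def coeff_sum by (simp add: of_int_poly)
      then show ?thesis using False r by (simp add: of_int_poly coeff_pCons split: nat.split)
    qed
  qed
  moreover have "sylvester_row f h i \<in> I" for i
    using I poly_idealD(4)[OF I(1)] by (simp add: sylvester_row_def)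
  then have "R \<in> I" unfolding R_def by (intro poly_ideal_sum[OF I(1)] poly_idealD(4)[OF I(1)])
  ultimately show ?thesis by (simp add: resultant_def S_def)
qed

text \<open>Reducing the coefficients modulo p makes the degree of a nonzero representative its
  degree over F_p.\<close>

lemma mod_prime_representative:
  fixes p :: int
  assumes p: "prime p"
  obtains q' where "of_int p dvd q - q'" "q' = 0 \<or> \<not> p dvd lead_coeff q'"
proof -
  define q' where "q' = map_poly (\<lambda>x. x mod p) q"
  have c: "coeff q' i = coeff q i mod p" for i by (simp add: q'_def coeff_map_poly)
  have "of_int p dvd q - q'" unfolding dvd_of_int_poly_iff by (simp add: c minus_mod_eq_mult_div)
  moreover have "q' = 0 \<or> \<not> p dvd lead_coeff q'"
    using c by (metis dvd_eq_mod_eq_0 leading_coeff_0_iff mod_mod_trivial)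
  ultimately show thesis using that by blast
qed

text \<open>The Bezout identity is multiplied by X^k and the cofactor of h reduced modulo f; the
  degree of the other cofactor over F_p is then forced. Its bound is stated on coefficients so that
  it says U = 0 when h is constant.\<close>

lemma bezout_degree_bounds:
  fixes p :: int and f h :: "int poly"
  assumes p: "prime p" and f: "monic f" "degree f > 0" and uv: "of_int p dvd u * f + v * h - 1"
    and k: "k < degree f + degree h"
  obtains U V where "of_int p dvd U * f + V * h - monom 1 k" "\<And>i. i \<ge> degree h \<Longrightarrow> coeff U i = 0" "degree V < degree f"
proof -
  obtain a s where as: "monom 1 k * v = f * a + s" "s = 0 \<or> degree s < degree f" using f(1) by (rule monic_div_mod)
  obtain U where U: "of_int p dvd (monom 1 k * u + a * h) - U" "U = 0 \<or> \<not> p dvd lead_coeff U"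
    using mod_prime_representative[OF p] by blast
  have "U * f + s * h - monom 1 k = monom 1 k * (u * f + v * h - 1) - ((monom 1 k * u + a * h) - U) * f
     + (f * a + s - monom 1 k * v) * h"
    by (simp add: algebra_simps)
  also have "\<dots> = monom 1 k * (u * f + v * h - 1) - ((monom 1 k * u + a * h) - U) * f" using as(1) by simp
  finally have *: "of_int p dvd U * f + s * h - monom 1 k" using uv U(1) by (metis dvd_diff dvd_mult dvd_mult2)
  have s: "degree s < degree f" using as(2) f(2) by auto
  have "U = 0 \<or> degree U < degree h"
  proof (rule ccontr)
    assume "\<not> (U = 0 \<or> degree U < degree h)"
    then have U': "degree U \<ge> degree h" "\<not> p dvd lead_coeff U" using U(2) by auto
    \<comment> \<open>In degree deg U + deg f only U f contributes, with a leading coefficient prime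
      to p.\<close>
    have "p dvd coeff (U * f + s * h - monom 1 k) (degree U + degree f)"
      using * unfolding dvd_of_int_poly_iff by blast
    moreover have "degree (s * h) < degree U + degree f"
      using degree_mult_le[of s h] s U'(1) by linarith
    then have "coeff (s * h) (degree U + degree f) = 0" by (rule coeff_eq_0)
    ultimately have "p dvd coeff (U * f) (degree U + degree f)"
      using k U'(1) by simp
    then show False using U'(2) f(1) by (simp add: coeff_mult_degree_sum)
  qed
  then have "coeff U i = 0" if "i \<ge> degree h" for i using that by (auto intro: coeff_eq_0)
  then show thesis using that * s by blast
qed

lemma poly_as_sum_monom_bound:
  assumes "\<And>i. i \<ge> n \<Longrightarrow> coeff q i = 0"
  shows "q = (\<Sum>i<n. monom (coeff q i) i)"
proof (rule poly_eqI)
  fix k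
  have "coeff (\<Sum>i<n. monom (coeff q i) i) k = (\<Sum>i<n. if i = k then coeff q k else 0)"
    unfolding coeff_sum by (rule sum.cong) auto
  also have "\<dots> = coeff q k" using assms[of k] by auto
  finally show "coeff q k = coeff (\<Sum>i<n. monom (coeff q i) i) k" ..
qed

lemma combination_sylvester_rows:
  assumes "\<And>i. i \<ge> degree h \<Longrightarrow> coeff U i = 0" "degree V < degree f"
  shows "U * f + V * h = (\<Sum>i<degree f + degree h.
    of_int (if i < degree h then coeff U (degree h - 1 - i) else coeff V (degree f + degree h - 1 - i))
      * sylvester_row f h i)" (is "_ = sum ?t _")
proof -
  let ?n = "degree h" and ?m = "degree f"
  have mon: "of_int c * (monom 1 i * q) = monom c i * q" for c i and q :: "int poly"
    by (simp add: of_int_poly smult_monom flip: mult_smult_left)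
  have "(\<Sum>i<?m + ?n. ?t i) = sum ?t {..<?n} + sum ?t {?n..<?n + ?m}"
    by (subst sum.union_disjoint[symmetric]) (auto intro!: sum.cong)
  also have "sum ?t {..<?n} = (\<Sum>i<?n. monom (coeff U (?n - Suc i)) (?n - Suc i) * f)"
    by (rule sum.cong) (auto simp: sylvester_row_def mon)
  also have "\<dots> = (\<Sum>i<?n. monom (coeff U i) i) * f"
    by (simp only: sum.nat_diff_reindex[of "\<lambda>i. monom (coeff U i) i * f"] sum_distrib_right)
  also have "(\<Sum>i<?n. monom (coeff U i) i) = U" using poly_as_sum_monom_bound[OF assms(1)] by simp
  also have "sum ?t {?n..<?n + ?m} = (\<Sum>i<?m. ?t (i + ?n))"
    using sum.shift_bounds_nat_ivl[of ?t 0 ?n ?m] by (simp add: atLeast0LessThan add.commute)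
  also have "\<dots> = (\<Sum>i<?m. monom (coeff V (?m - Suc i)) (?m - Suc i) * h)"
    by (rule sum.cong) (auto simp: sylvester_row_def mon)
  also have "\<dots> = (\<Sum>i<?m. monom (coeff V i) i) * h"
    by (simp only: sum.nat_diff_reindex[of "\<lambda>i. monom (coeff V i) i * h"] sum_distrib_right)
  also have "(\<Sum>i<?m. monom (coeff V i) i) = V"
    using poly_as_sum_monom_bound[of ?m V] assms(2) coeff_eq_0[of V] by simp
  finally show ?thesis by simp
qed

text \<open>Write E = 1 + p X. The determinant of 1 + y X is a polynomial in y, and its values at y
  = p and y = 0 differ by a multiple of p.\<close>

lemma det_cong_one:
  fixes p :: int and E :: "int mat"
  assumes E: "E \<in> carrier_mat n n"
    and cong: "\<And>i j. i < n \<Longrightarrow> j < n \<Longrightarrow> p dvd E $$ (i, j) - (if i = j then 1 else 0)"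
  shows "p dvd det E - 1"
proof -
  have "\<exists>X. \<forall>i<n. \<forall>j<n. E $$ (i, j) = (if i = j then 1 else 0) + p * X i j"
  proof -
    have "\<exists>x. E $$ (i, j) = (if i = j then 1 else 0) + p * x" if "i < n" "j < n" for i j
      using cong[OF that] by (auto elim!: dvdE simp: algebra_simps)
    then show ?thesis by metis
  qed
  then obtain X where X: "\<And>i j. i < n \<Longrightarrow> j < n \<Longrightarrow> E $$ (i, j) = (if i = j then 1 else 0) + p * X i j" by blast
  define T where "T = mat n n (\<lambda>(i, j). [:(if i = j then 1 else 0), X i j:])"
  have T: "T \<in> carrier_mat n n" by (simp add: T_def)
  have at_p: "poly (det T) p = det E"
    by (rule poly_det_cong[OF E T]) (simp add: T_def X)
  have at_0: "poly (det T) 0 = det (1\<^sub>m n)"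
    by (rule poly_det_cong[OF _ T]) (simp_all add: T_def)
  obtain c q where "det T = pCons c q" by (cases "det T")
  then have "det E - 1 = p * poly q p" using at_p at_0 by simp
  then show ?thesis by simp
qed

text \<open>Comaximality lets every monomial X^k with k < r be written modulo p through the
  Sylvester rows, so the Sylvester matrix has a left inverse modulo p.\<close>

lemma not_dvd_resultant_if_comaximal:
  fixes p :: int and f h :: "int poly"
  assumes p: "prime p" and f: "monic f" "degree f > 0" and uv: "of_int p dvd u * f + v * h - 1"
  shows "\<not> p dvd resultant f h"
proof
  assume dvd: "p dvd resultant f h"
  define r where "r = degree f + degree h"
  define S where "S = sylvester_mat f h"
  have S: "S \<in> carrier_mat r r" by (auto simp: S_def r_def)
  have "\<exists>b. of_int p dvd (\<Sum>i<r. of_int (b i) * sylvester_row f h i) - monom 1 k" if k: "k < r" for k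
  proof -
    obtain U V where UV: "of_int p dvd U * f + V * h - monom 1 k"
      "\<And>i. i \<ge> degree h \<Longrightarrow> coeff U i = 0" "degree V < degree f"
      using bezout_degree_bounds[OF p f uv k[unfolded r_def]] by blast
    define c where "c i = (if i < degree h then coeff U (degree h - 1 - i)
        else coeff V (degree f + degree h - 1 - i))" for i
    have "U * f + V * h = (\<Sum>i<r. of_int (c i) * sylvester_row f h i)"
      unfolding c_def r_def by (rule combination_sylvester_rows[OF UV(2,3)])
    with UV(1) show ?thesis by (intro exI[of _ c]) simp
  qed
  then obtain b where b: "\<And>k. k < r \<Longrightarrow> of_int p dvd (\<Sum>i<r. of_int (b k i) * sylvester_row f h i) - monom 1 k"
    by metis
  \<comment> \<open>The columns list coefficients by falling degree, hence the index r - 1 -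
    k.\<close>
  define B where "B = mat r r (\<lambda>(k, i). b (r - 1 - k) i)"
  have B: "B \<in> carrier_mat r r" by (simp add: B_def)
  have "p dvd det (B * S) - 1"
  proof (rule det_cong_one)
    show "B * S \<in> carrier_mat r r" using B S by simp
    fix i j assume ij: "i < r" "j < r"
    have "(B * S) $$ (i, j) = (\<Sum>l<r. b (r - 1 - i) l * coeff (sylvester_row f h l) (r - 1 - j))"
      using B S ij sylvester_mat_row[of _ f h j]
      by (auto simp: scalar_prod_def B_def S_def r_def atLeast0LessThan intro!: sum.cong)
    also have "\<dots> = coeff (\<Sum>l<r. of_int (b (r - 1 - i) l) * sylvester_row f h l) (r - 1 - j)"
      by (simp add: coeff_sum of_int_poly)
    finally have "(B * S) $$ (i, j) - (if i = j then 1 else 0)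
      = coeff ((\<Sum>l<r. of_int (b (r - 1 - i) l) * sylvester_row f h l) - monom 1 (r - 1 - i)) (r - 1 - j)"
      using ij by auto
    then show "p dvd (B * S) $$ (i, j) - (if i = j then 1 else 0)"
      using b[of "r - 1 - i"] ij unfolding dvd_of_int_poly_iff by auto
  qed
  moreover have "p dvd det (B * S)" using dvd unfolding det_mult[OF B S] by (simp add: resultant_def S_def)
  ultimately have "p dvd 1" by (metis dvd_diff_right_iff)
  then show False using p not_prime_unit by blast
qed

text \<open>Both sides express that the ideal (f, h, p) is proper.\<close>

lemma dvd_resultant_iff:
  fixes p :: int
  assumes p: "prime p" and f: "monic f" "degree f > 0"
  shows "p dvd resultant f h \<longleftrightarrow> (\<exists>g. maximal_pair p g \<and> f \<in> pideal p g \<and> h \<in> pideal p g)"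
proof
  assume dvd: "p dvd resultant f h"
  define I where "I = {u * f + v * h + of_int p * w | u v w. True}"
  have I: "poly_ideal I"
    unfolding poly_ideal_def
  proof (intro conjI ballI allI)
    show "0 \<in> I" unfolding I_def by (intro CollectI exI[of _ 0]) simp
    fix q assume "q \<in> I"
    then obtain u v w where q: "q = u * f + v * h + of_int p * w" by (auto simp: I_def)
    show "q * r \<in> I" for r
      unfolding I_def q
      by (intro CollectI exI[of _ "u * r"] exI[of _ "v * r"] exI[of _ "w * r"]) (simp add: algebra_simps)
    fix r assume "r \<in> I"
    then obtain u' v' w' where r: "r = u' * f + v' * h + of_int p * w'" by (auto simp: I_def)
    show "q + r \<in> I"
      unfolding I_def q r
      by (intro CollectI exI[of _ "u + u'"] exI[of _ "v + v'"] exI[of _ "w + w'"]) (simp add: algebra_simps)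
  qed
  have pI: "of_int p \<in> I" unfolding I_def by (intro CollectI exI[of _ 0] exI[of _ 1]) simp
  have fI: "f \<in> I" unfolding I_def
    by (rule CollectI, rule exI[of _ 1], rule exI[of _ 0], rule exI[of _ 0]) simp
  have hI: "h \<in> I" unfolding I_def
    by (rule CollectI, rule exI[of _ 0], rule exI[of _ 1], rule exI[of _ 0]) simp
  have "1 \<notin> I"
  proof
    assume "1 \<in> I"
    then obtain u v w where "1 = u * f + v * h + of_int p * w" by (auto simp: I_def)
    then have "u * f + v * h - 1 = of_int p * (- w)" by (simp add: algebra_simps)
    then have "of_int p dvd u * f + v * h - 1" by (rule dvdI)
    then show False using not_dvd_resultant_if_comaximal[OF p f] dvd by blast
  qed
  obtain g where "maximal_pair p g" "I \<subseteq> pideal p g"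
    using maximal_pair_exists[OF p I pI \<open>1 \<notin> I\<close> fI f(1)] .
  then show "\<exists>g. maximal_pair p g \<and> f \<in> pideal p g \<and> h \<in> pideal p g" using fI hI by blast
next
  assume "\<exists>g. maximal_pair p g \<and> f \<in> pideal p g \<and> h \<in> pideal p g"
  then obtain g where g: "maximal_pair p g" "f \<in> pideal p g" "h \<in> pideal p g" by blast
  have "of_int (resultant f h) \<in> pideal p g"
    using resultant_in_ideal[OF poly_ideal_pideal g(2,3) f(2)] .
  then show "p dvd resultant f h" using maximal_pair.M_of_int[OF g(1)] by blast
qed

lemma dvd_disc_iff:
  fixes p :: int
  assumes p: "prime p" and f: "monic f" "degree f > 0"
  shows "p dvd disc f \<longleftrightarrow> (\<exists>g. maximal_pair p g \<and> f \<in> pideal p g \<and> pderiv f \<in> pideal p g)"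
proof -
  have "p dvd disc f \<longleftrightarrow> p dvd resultant f (pderiv f)"
    using f(1) by (cases "even (degree f * (degree f - 1) div 2)") (simp_all add: disc_def)
  then show ?thesis using dvd_resultant_iff[OF assms] by simp
qed

section \<open>Congruences modulo a maximal ideal and its square\<close>

definition icong :: "int poly set \<Rightarrow> int poly \<Rightarrow> int poly \<Rightarrow> bool" where
  "icong I q r \<longleftrightarrow> q - r \<in> I"

lemma icong_ideal:
  assumes I: "poly_ideal I"
  shows "icong I q q" "icong I q r \<Longrightarrow> icong I r q" "icong I q r \<Longrightarrow> icong I r s \<Longrightarrow> icong I q s"
    "icong I q r \<Longrightarrow> icong I q' r' \<Longrightarrow> icong I (q + q') (r + r')"
    "icong I q r \<Longrightarrow> icong I q' r' \<Longrightarrow> icong I (q - q') (r - r')"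
    "icong I q r \<Longrightarrow> icong I q' r' \<Longrightarrow> icong I (q * q') (r * r')"
    "icong I q r \<Longrightarrow> icong I (q ^ n) (r ^ n)"
    "icong I q r \<Longrightarrow> q \<in> I \<longleftrightarrow> r \<in> I"
    "icong I q 0 \<longleftrightarrow> q \<in> I"
proof -
  note D = poly_idealD[OF I]
  show "icong I q q" "icong I q 0 \<longleftrightarrow> q \<in> I" by (simp_all add: icong_def D(1))
  show "icong I q r \<Longrightarrow> icong I r q" using D(6)[of "q - r"] by (simp add: icong_def)
  show "icong I q r \<Longrightarrow> icong I r s \<Longrightarrow> icong I q s" using D(2)[of "q - r" "r - s"] by (simp add: icong_def)
  show "icong I q r \<Longrightarrow> icong I q' r' \<Longrightarrow> icong I (q + q') (r + r')"
    using D(2)[of "q - r" "q' - r'"] by (simp add: icong_def algebra_simps)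
  show "icong I q r \<Longrightarrow> icong I q' r' \<Longrightarrow> icong I (q - q') (r - r')"
    using D(5)[of "q - r" "q' - r'"] by (simp add: icong_def algebra_simps)
  show mult: "icong I q r \<Longrightarrow> icong I q' r' \<Longrightarrow> icong I (q * q') (r * r')" for q r q' r'
    using D(2)[OF D(3)[of "q - r" q'] D(4)[of "q' - r'" r]] by (simp add: icong_def algebra_simps)
  show "icong I q r \<Longrightarrow> icong I (q ^ n) (r ^ n)"
    by (induction n) (simp_all add: mult, simp add: icong_def D(1))
  show "icong I q r \<Longrightarrow> q \<in> I \<longleftrightarrow> r \<in> I"
    using D(2)[of "q - r" r] D(5)[of q "q - r"] by (auto simp: icong_def)
qed

lemma prime_dvd_freshman:
  fixes x y :: "'a::comm_ring_1"
  assumes p: "prime p"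
  shows "of_nat p dvd (x + y) ^ p - (x ^ p + y ^ p)"
proof -
  have p0: "p > 0" using p by (rule prime_gt_0_nat)
  have "(x + y) ^ p = (\<Sum>i\<le>p. of_nat (p choose i) * x ^ i * y ^ (p - i))" by (rule binomial_ring)
  also have "{..p} = insert 0 (insert p {0<..<p})" using p0 by auto
  also have "(\<Sum>i\<in>\<dots>. of_nat (p choose i) * x ^ i * y ^ (p - i))
      = y ^ p + (x ^ p + (\<Sum>i\<in>{0<..<p}. of_nat (p choose i) * x ^ i * y ^ (p - i)))"
    using p0 by (subst sum.insert; simp)+
  finally have "(x + y) ^ p - (x ^ p + y ^ p) = (\<Sum>i\<in>{0<..<p}. of_nat (p choose i) * x ^ i * y ^ (p - i))"
    by simp
  moreover have "(of_nat p :: 'a) dvd of_nat (p choose i)" if "i \<in> {0<..<p}" for i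
    using dvd_choose_prime[of i p] p that by (auto elim!: dvdE)
  ultimately show ?thesis by (auto intro!: dvd_sum dvd_mult2)
qed

lemma prime_power_dvd_freshman:
  fixes x y :: "'a::comm_ring_1"
  assumes p: "prime p"
  shows "of_nat p dvd (x + y) ^ (p ^ j) - (x ^ (p ^ j) + y ^ (p ^ j))"
proof (induction j arbitrary: x y)
  case (Suc j)
  have diff_dvd: "u - v dvd u ^ i - v ^ i" for u v :: 'a and i by (simp add: power_diff_sumr2)
  have "(x + y) ^ (p ^ Suc j) - (x ^ (p ^ Suc j) + y ^ (p ^ Suc j))
    = (((x + y) ^ p) ^ (p ^ j) - (x ^ p + y ^ p) ^ (p ^ j))
      + ((x ^ p + y ^ p) ^ (p ^ j) - ((x ^ p) ^ (p ^ j) + (y ^ p) ^ (p ^ j)))"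
    by (simp add: power_mult)
  moreover have "of_nat p dvd ((x + y) ^ p) ^ (p ^ j) - (x ^ p + y ^ p) ^ (p ^ j)"
    using prime_dvd_freshman[OF p] diff_dvd by (rule dvd_trans)
  ultimately show ?case using Suc.IH by (metis dvd_add)
qed simp

lemma prime_dvd_power_minus_self:
  fixes a :: int
  assumes p: "prime p"
  shows "int p dvd a ^ (p ^ j) - a"
proof (induction j)
  case (Suc j)
  have fermat: "int p dvd a ^ p - a" for a :: int
  proof (induction a rule: int_induct[where k = 0])
    case base
    then show ?case using prime_gt_0_nat[OF p] by (simp add: zero_power)
  next
    case (step1 i)
    have "(i + 1) ^ p - (i + 1) = ((i + 1) ^ p - (i ^ p + 1 ^ p)) + (i ^ p - i)" by simp
    then show ?case using prime_dvd_freshman[OF p, of i 1] step1.IH by (metis dvd_add of_nat_eq_id id_apply int_ops(1))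
  next
    case (step2 i)
    have "(i - 1) ^ p - (i - 1) = (i ^ p - i) - ((i - 1 + 1) ^ p - ((i - 1) ^ p + 1 ^ p))" by simp
    then show ?case using prime_dvd_freshman[OF p, of "i - 1" 1] step2.IH by (metis dvd_diff)
  qed
  have "a ^ (p ^ Suc j) - a = ((a ^ (p ^ j)) ^ p - a ^ (p ^ j)) + (a ^ (p ^ j) - a)"
    by (simp add: power_mult[symmetric] mult.commute)
  then show ?case using fermat[of "a ^ (p ^ j)"] Suc.IH by (metis dvd_add)
qed simp

definition polyX :: "int poly" where "polyX = [:0, 1:]"

lemma monom_eq_polyX: "monom z n = of_int z * polyX ^ n"
  by (simp add: polyX_def monom_altdef of_int_poly)

lemma degree_polyX_power: "degree (polyX ^ n) = n" and coeff_polyX_power: "coeff (polyX ^ n) i = (if i = n then 1 else 0)"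
proof -
  have "polyX ^ n = monom 1 n" by (simp add: monom_eq_polyX)
  then show "degree (polyX ^ n) = n" "coeff (polyX ^ n) i = (if i = n then 1 else 0)"
    by (simp_all add: degree_monom_eq)
qed

lemma pderiv_polyX [simp]: "pderiv polyX = 1"
  by (simp add: polyX_def pderiv_pCons)

lemma monic_polyX_power_plus:
  assumes "degree r < n"
  shows "monic (polyX ^ n + r)" "degree (polyX ^ n + r) = n"
proof -
  show "degree (polyX ^ n + r) = n"
    using degree_add_eq_left[of r "polyX ^ n"] assms by (simp add: degree_polyX_power)
  then show "monic (polyX ^ n + r)" using assms by (simp add: coeff_polyX_power coeff_eq_0)
qed

text \<open>Over F_p the product of h with a nonzero polynomial has degree at least that of h, so it
  cannot be 1.\<close>

lemma not_one_in_pideal: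
  fixes p :: int
  assumes p: "prime p" and h: "monic h" "degree h > 0"
  shows "1 \<notin> pideal p h"
proof
  assume "1 \<in> pideal p h"
  then obtain A B where AB: "1 = of_int p * A + h * B" by (auto simp: pideal_def)
  obtain B' where B': "of_int p dvd B - B'" "B' = 0 \<or> \<not> p dvd lead_coeff B'"
    using mod_prime_representative[OF p] by blast
  have "1 - h * B' = of_int p * A + h * (B - B')" using AB by (simp add: algebra_simps)
  then have d: "of_int p dvd 1 - h * B'" using B'(1) by simp
  show False
  proof (cases "B' = 0")
    case True
    then have "p dvd coeff 1 0" using d unfolding dvd_of_int_poly_iff by (metis diff_zero mult_zero_right)
    then show False using prime_gt_1_int[OF p] by simp
  next
    case False
    have "p dvd coeff (1 - h * B') (degree h + degree B')" using d unfolding dvd_of_int_poly_iff by blast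
    then have "p dvd lead_coeff B'" using h by (simp add: coeff_mult_degree_sum)
    then show False using B'(2) False by simp
  qed
qed

lemma maximal_pair_containing:
  fixes p :: int
  assumes p: "prime p" and h: "monic h" "degree h > 0"
  obtains g where "maximal_pair p g" "h \<in> pideal p g"
proof -
  have "of_int p \<in> pideal p h" "h \<in> pideal p h" using pideal_p[of p 1 h] pideal_g[of h 1 p] by simp_all
  from maximal_pair_exists[OF p poly_ideal_pideal this(1) not_one_in_pideal[OF p h] this(2) h(1)]
  obtain g where "maximal_pair p g" "pideal p h \<subseteq> pideal p g" .
  with \<open>h \<in> pideal p h\<close> that show thesis by blast
qed

section \<open>Frobenius modulo a maximal ideal\<close>

locale nat_maximal_pair = maximal_pair "int p" g for p :: nat and g
begin

lemma prime_p: "prime p"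
  using prime by simp

lemmas cong1 = icong_ideal[OF poly_ideal_pideal[of "int p" g]]

lemma cong1_of_dvd: "of_int (int p) dvd q - r \<Longrightarrow> icong M q r"
  unfolding icong_def by (auto elim!: dvdE intro: pideal_p simp del: of_int_of_nat_eq)

lemma cong1_of_int: "int p dvd x - y \<Longrightarrow> icong M (of_int x) (of_int y)"
  using M_of_int[of "x - y"] by (simp add: icong_def)

text \<open>By the product rule each term keeps one factor from M. This is why primes dividing the
  index also divide the discriminant.\<close>

lemma pderiv_in_M: "q \<in> M2 \<Longrightarrow> pderiv q \<in> M"
proof -
  assume "q \<in> M2"
  then obtain A B C where q: "q = of_int (int p) ^ 2 * A + of_int (int p) * g * B + g ^ 2 * C"
    by (auto simp: pideal_sq_def)
  have "pderiv q = of_int (int p) * (of_int (int p) * pderiv A + pderiv (g * B)) + g * (g * pderiv C + 2 * pderiv g * C)"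
    unfolding q by (simp add: pderiv_add pderiv_mult power2_eq_square pderiv_of_nat algebra_simps)
  then show ?thesis unfolding pideal_def by blast
qed

text \<open>Expanding (x - y) + y instead of x + (-y) avoids the sign (-1)^(p^j).\<close>

lemma freshman_diff: "icong M ((x - y) ^ (p ^ j)) (x ^ (p ^ j) - y ^ (p ^ j))"
proof -
  have "icong M ((x - y + y) ^ (p ^ j)) ((x - y) ^ (p ^ j) + y ^ (p ^ j))"
    using cong1_of_dvd prime_power_dvd_freshman[OF prime_p, of "x - y" y j] by simp
  from cong1(5)[OF this cong1(1)[of "y ^ (p ^ j)"]] show ?thesis using cong1(2) by simp
qed

text \<open>Frobenius is injective on the field Z[x]/M.\<close>

lemma power_prime_diff_iff: "x ^ (p ^ j) - y ^ (p ^ j) \<in> M \<longleftrightarrow> x - y \<in> M"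
  using cong1(8)[OF freshman_diff[of x y j]] prime_gt_0_nat[OF prime_p] by (simp add: M_power)

lemma cong1_fermat: "icong M (of_int a ^ (p ^ j)) (of_int a)"
  using cong1_of_int[OF prime_dvd_power_minus_self[OF prime_p, of a j]] by simp

text \<open>Taking \<open>p\<close>-th powers improves congruences modulo \<open>M\<close> to congruences modulo \<open>M2\<close>.\<close>

lemma cong2_power:
  assumes "icong M x y" "p dvd N"
  shows "icong M2 (x ^ N) (y ^ N)"
  using M2_power_diff[of x y N] assms by (simp add: icong_def)

text \<open>By Fermat, a = a^q modulo M for q = p^j, and injectivity of Frobenius gives x^(N/q) = a
  modulo M; the q-th power of this congruence holds modulo M^2. Hence the powers a^(p^j) in the
  conditions.\<close>

lemma cong2_power_of_int:
  assumes x: "icong M (x ^ N) (of_int a)" and N: "p ^ j dvd N" "j > 0"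
  shows "icong M2 (x ^ N) (of_int (a ^ (p ^ j)))"
proof -
  obtain u where u: "N = u * p ^ j" using N(1) by (metis dvdE mult.commute)
  have "icong M ((x ^ u) ^ (p ^ j)) (of_int a ^ (p ^ j))"
    using cong1(3)[OF x cong1(2)[OF cong1_fermat]] by (simp add: u power_mult)
  then have "icong M (x ^ u) (of_int a)" using power_prime_diff_iff by (simp add: icong_def)
  from cong2_power[OF this, of "p ^ j"] show ?thesis using N(2) by (simp add: u power_mult)
qed

end

section \<open>Binomial systems over F_p\<close>

lemma mod_inverse:
  fixes p b :: int
  assumes "prime p" "\<not> p dvd b"
  obtains b' where "[b * b' = 1] (mod p)"
proof -
  obtain u v where "u * b + v * p = 1" using bezout_prime[OF assms] .
  then have "b * u - 1 = p * (- v)" by (simp add: algebra_simps)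
  then have "[b * u = 1] (mod p)" by (metis cong_iff_dvd_diff dvd_triv_left)
  then show thesis by (rule that)
qed

text \<open>If \<open>r N - s n = 1\<close>, then \<open>A\<^sup>r \<beta>\<^sup>-\<^sup>s\<close> is a simultaneous solution, \<open>\<beta>\<close> being a root of \<open>\<beta>\<^sup>N = A\<^sup>n\<close>.\<close>

lemma simultaneous_power_residue:
  fixes p A \<beta> :: int
  assumes p: "prime p" "\<not> p dvd A" "\<not> p dvd \<beta>" and cop: "gcd N n = 1" "N > 0"
    and rel: "[\<beta> ^ N = A ^ n] (mod p)"
  obtains \<gamma> where "[\<gamma> ^ N = A] (mod p)" "[\<gamma> ^ n = \<beta>] (mod p)"
proof -
  obtain r s where rs: "N * r = n * s + 1" using bezout_nat[of N n] cop by auto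
  obtain B where B: "[\<beta> * B = 1] (mod p)" using mod_inverse[OF p(1,3)] .
  define \<gamma> where "\<gamma> = A ^ r * B ^ s"
  have "[\<gamma> ^ N * A ^ 0 = A * (A ^ n * B ^ N) ^ s] (mod p)"
  proof -
    have "\<gamma> ^ N = A ^ (N * r) * B ^ (N * s)" by (simp add: \<gamma>_def power_mult_distrib power_mult[symmetric] mult.commute)
    also have "\<dots> = A * (A ^ n * B ^ N) ^ s" unfolding rs
      by (simp add: power_add power_mult_distrib power_mult[symmetric] mult_ac)
    finally show ?thesis by simp
  qed
  also have "[A * (A ^ n * B ^ N) ^ s = A * (\<beta> ^ N * B ^ N) ^ s] (mod p)"
    by (intro cong_mult cong_pow cong_refl cong_sym[OF rel])
  also have "A * (\<beta> ^ N * B ^ N) ^ s = A * ((\<beta> * B) ^ N) ^ s" by (simp add: power_mult_distrib)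
  also have "[A * ((\<beta> * B) ^ N) ^ s = A * (1 ^ N) ^ s] (mod p)" by (intro cong_mult cong_pow cong_refl B)
  finally have 1: "[\<gamma> ^ N = A] (mod p)" by simp
  have "\<gamma> ^ n = (A ^ n) ^ r * B ^ (n * s)" by (simp add: \<gamma>_def power_mult_distrib power_mult[symmetric] mult.commute)
  also have "[(A ^ n) ^ r * B ^ (n * s) = (\<beta> ^ N) ^ r * B ^ (n * s)] (mod p)"
    by (intro cong_mult cong_pow cong_refl cong_sym[OF rel])
  also have "(\<beta> ^ N) ^ r * B ^ (n * s) = \<beta> * (\<beta> * B) ^ (n * s)"
    unfolding power_mult[symmetric] rs by (simp add: power_add power_mult_distrib mult_ac)
  also have "[\<beta> * (\<beta> * B) ^ (n * s) = \<beta> * 1 ^ (n * s)] (mod p)" by (intro cong_mult cong_pow cong_refl B)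
  finally have "[\<gamma> ^ n = \<beta>] (mod p)" by simp
  with 1 that show thesis by blast
qed

text \<open>Necessity compares the n-th power of X^(tN) = A with the N-th power of b X^(tn) = -d.
  Conversely, d being a unit makes b one, and \<beta> = -d/b leads to a solution \<gamma> in F_p for
  X^t. Any maximal ideal containing p and X^t - \<gamma> then works, without extracting a t-th root
  of \<gamma>.\<close>

lemma binomial_system_unit:
  fixes p :: nat and A b d :: int
  assumes p: "prime p" and A: "\<not> int p dvd A" and d: "\<not> int p dvd d"
    and t: "t > 0" and cop: "gcd N n = 1" "N > 0"
  shows "(\<exists>g. nat_maximal_pair p g \<and> polyX ^ (t * N) - of_int A \<in> pideal (int p) g \<and>
      of_int b * polyX ^ (t * n) + of_int d \<in> pideal (int p) g)
    \<longleftrightarrow> int p dvd A ^ n * b ^ N - (- d) ^ N"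
proof
  assume "\<exists>g. nat_maximal_pair p g \<and> polyX ^ (t * N) - of_int A \<in> pideal (int p) g \<and>
      of_int b * polyX ^ (t * n) + of_int d \<in> pideal (int p) g"
  then obtain g where g: "nat_maximal_pair p g" and XA: "polyX ^ (t * N) - of_int A \<in> pideal (int p) g"
    and Xb: "of_int b * polyX ^ (t * n) + of_int d \<in> pideal (int p) g" by blast
  interpret nat_maximal_pair p g by fact
  have XA: "icong M ((polyX ^ (t * N)) ^ n) (of_int A ^ n)" using XA by (intro cong1(7)) (simp add: icong_def)
  have Xb: "icong M ((of_int b * polyX ^ (t * n)) ^ N) (of_int (- d) ^ N)"
    using Xb by (intro cong1(7)) (simp add: icong_def)
  have "(of_int b * polyX ^ (t * n)) ^ N = of_int b ^ N * (polyX ^ (t * N)) ^ n"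
    by (simp add: power_mult_distrib power_mult[symmetric] mult_ac)
  then have "icong M (of_int b ^ N * of_int A ^ n) (of_int (- d) ^ N)"
    using cong1(3)[OF cong1(6)[OF cong1(1) cong1(2)[OF XA]] Xb[unfolded \<open>_ = of_int b ^ N * _\<close>]] by simp
  then have "of_int (A ^ n * b ^ N - (- d) ^ N) \<in> M" by (simp add: icong_def mult.commute)
  then show "int p dvd A ^ n * b ^ N - (- d) ^ N" using M_of_int by blast
next
  let ?P = "int p"
  assume dvd: "?P dvd A ^ n * b ^ N - (- d) ^ N"
  have pp: "prime ?P" using p by simp
  have b: "\<not> ?P dvd b"
  proof
    assume "?P dvd b"
    then have "?P dvd A ^ n * b ^ N" using cop(2) by (intro dvd_mult) (meson dvd_power dvd_trans)
    then have "?P dvd (- d) ^ N" using dvd by (metis dvd_diff_right_iff)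
    then have "?P dvd - d" by (rule prime_dvd_power[OF pp])
    then show False using d by simp
  qed
  obtain b' where b': "[b * b' = 1] (mod ?P)" using mod_inverse[OF pp b] .
  define \<beta> where "\<beta> = - d * b'"
  have b\<beta>: "[b * \<beta> = - d] (mod ?P)"
    using cong_mult[OF cong_refl[of "- d"] b'] by (simp add: \<beta>_def mult_ac)
  have \<beta>: "\<not> ?P dvd \<beta>"
  proof
    assume "?P dvd \<beta>"
    then have "?P dvd - d" using b\<beta> by (metis cong_dvd_iff dvd_mult)
    then show False using d by simp
  qed
  have "[b ^ N * \<beta> ^ N = b ^ N * A ^ n] (mod ?P)"
  proof -
    have "[b ^ N * \<beta> ^ N = (- d) ^ N] (mod ?P)" using cong_pow[OF b\<beta>, of N] by (simp add: power_mult_distrib)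
    also have "[(- d) ^ N = A ^ n * b ^ N] (mod ?P)" by (rule cong_sym) (use dvd in \<open>simp add: cong_iff_dvd_diff\<close>)
    finally show ?thesis by (simp add: mult.commute)
  qed
  then have "?P dvd b ^ N * (\<beta> ^ N - A ^ n)" by (simp add: cong_iff_dvd_diff algebra_simps)
  then have "[\<beta> ^ N = A ^ n] (mod ?P)"
    using b pp by (metis cong_iff_dvd_diff prime_dvd_mult_iff prime_dvd_power)
  then obtain \<gamma> where \<gamma>: "[\<gamma> ^ N = A] (mod ?P)" "[\<gamma> ^ n = \<beta>] (mod ?P)"
    using simultaneous_power_residue[OF pp A \<beta> cop] by blast
  have "degree (of_int (- \<gamma>) :: int poly) < t" using t by (simp add: of_int_poly)
  from monic_polyX_power_plus[OF this] t obtain g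
    where g: "maximal_pair ?P g" and h: "polyX ^ t + of_int (- \<gamma>) \<in> pideal ?P g"
    using maximal_pair_containing[OF pp] by metis
  interpret nat_maximal_pair p g using g by (rule nat_maximal_pair.intro)
  have X: "icong M (polyX ^ t) (of_int \<gamma>)" using h by (simp add: icong_def)
  have "icong M ((polyX ^ t) ^ N) (of_int A)"
    using cong1(3)[OF cong1(7)[OF X, of N]] cong1_of_int[of "\<gamma> ^ N" A] \<gamma>(1) by (simp add: cong_iff_dvd_diff)
  then have 1: "polyX ^ (t * N) - of_int A \<in> M" by (simp add: icong_def power_mult)
  have "icong M ((polyX ^ t) ^ n) (of_int \<beta>)"
    using cong1(3)[OF cong1(7)[OF X, of n]] cong1_of_int[of "\<gamma> ^ n" \<beta>] \<gamma>(2) by (simp add: cong_iff_dvd_diff)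
  from cong1(6)[OF cong1(1)[of "of_int b"] this] have "icong M (of_int b * polyX ^ (t * n)) (of_int (b * \<beta>))"
    by (simp add: power_mult)
  from cong1(3)[OF this cong1_of_int[of "b * \<beta>" "- d"]] b\<beta>
  have "of_int b * polyX ^ (t * n) + of_int d \<in> M" by (simp add: icong_def cong_iff_dvd_diff)
  with 1 nat_maximal_pair_axioms show "\<exists>g. nat_maximal_pair p g \<and> polyX ^ (t * N) - of_int A \<in> pideal ?P g \<and>
      of_int b * polyX ^ (t * n) + of_int d \<in> pideal ?P g" by blast
qed

text \<open>A is a unit, hence so is X, and a vanishing d leaves only b = 0. This settles (ii) for p
  | c2 and (iv)(b) for p | c1.\<close>

lemma binomial_system_zero:
  fixes p :: nat and A b d :: int
  assumes p: "prime p" and A: "\<not> int p dvd A" and d: "int p dvd d" and N: "N > 0"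
  shows "(\<exists>g. nat_maximal_pair p g \<and> polyX ^ N - of_int A \<in> pideal (int p) g \<and>
      of_int b * polyX ^ n + of_int d \<in> pideal (int p) g) \<longleftrightarrow> int p dvd b"
proof
  assume "\<exists>g. nat_maximal_pair p g \<and> polyX ^ N - of_int A \<in> pideal (int p) g \<and>
      of_int b * polyX ^ n + of_int d \<in> pideal (int p) g"
  then obtain g where g: "nat_maximal_pair p g" and XA: "polyX ^ N - of_int A \<in> pideal (int p) g"
    and Xb: "of_int b * polyX ^ n + of_int d \<in> pideal (int p) g" by blast
  interpret nat_maximal_pair p g by fact
  have "polyX \<notin> M"
    using M_diff_iff[OF XA] A N by (simp add: M_power M_of_int)
  moreover have "of_int b * polyX ^ n \<in> M"
    using M_diff_iff[of "of_int b * polyX ^ n + of_int d" "of_int b * polyX ^ n"] Xb d by (simp add: M_of_int)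
  ultimately show "int p dvd b" by (simp add: M_prime M_power M_of_int)
next
  assume b: "int p dvd b"
  have pp: "prime (int p)" using p by simp
  have "degree (of_int (- A) :: int poly) < N" using N by (simp add: of_int_poly)
  from monic_polyX_power_plus[OF this] N obtain g
    where g: "maximal_pair (int p) g" and h: "polyX ^ N + of_int (- A) \<in> pideal (int p) g"
    using maximal_pair_containing[OF pp] by metis
  interpret nat_maximal_pair p g using g by (rule nat_maximal_pair.intro)
  have "of_int b * polyX ^ n + of_int d \<in> M"
    using b d by (intro M_ideal(2) M_ideal(3)) (simp_all add: M_of_int)
  then show "\<exists>g. nat_maximal_pair p g \<and> polyX ^ N - of_int A \<in> pideal (int p) g \<and>
      of_int b * polyX ^ n + of_int d \<in> pideal (int p) g"
    using h nat_maximal_pair_axioms by auto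
qed

section \<open>The seven cases\<close>

lemma fpoly_eq: "fpoly a c k m n = (polyX ^ k + of_int c) ^ m - of_int a * polyX ^ n"
  by (simp add: fpoly_def monom_eq_polyX of_int_poly)

lemma fpoly_monic:
  assumes "k * m > n"
  shows "monic (fpoly a c k m n)" "degree (fpoly a c k m n) = k * m"
proof -
  let ?h = "polyX ^ k + of_int c"
  have k: "k > 0" using assms by (cases k) auto
  then have "degree (of_int c :: int poly) < k" by (simp add: of_int_poly)
  note h = monic_polyX_power_plus[OF this]
  have "?h \<noteq> 0" using h(2) k by auto
  then have hm: "monic (?h ^ m)" "degree (?h ^ m) = k * m"
    using monic_power[OF h(1), of m] h(2) degree_power_eq[of ?h m] by (simp_all add: mult.commute)
  have "degree (of_int a * polyX ^ n) \<le> n"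
    using degree_smult_le[of a "polyX ^ n"] by (simp add: of_int_poly degree_polyX_power)
  then have d: "degree (- (of_int a * polyX ^ n)) < degree (?h ^ m)" unfolding hm using assms by simp
  show deg: "degree (fpoly a c k m n) = k * m"
    using degree_add_eq_left[OF d] hm(2) by (simp add: fpoly_eq)
  have "coeff (fpoly a c k m n) (k * m) = coeff (?h ^ m) (k * m) + coeff (- (of_int a * polyX ^ n)) (k * m)"
    by (simp add: fpoly_eq)
  also have "\<dots> = 1" using hm d coeff_eq_0[OF d] by simp
  finally show "monic (fpoly a c k m n)" by (simp add: deg)
qed

lemma pderiv_fpoly:
  "pderiv (fpoly a c k m n) = of_nat (k * m) * polyX ^ (k - 1) * (polyX ^ k + of_int c) ^ (m - 1)
     - of_int a * of_nat n * polyX ^ (n - 1)"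
proof -
  have h: "pderiv (q ^ i) = of_nat i * q ^ (i - 1) * pderiv q" for i and q :: "int poly"
    by (cases i) (simp_all add: pderiv_power_Suc of_nat_poly del: power_Suc)
  have c: "pderiv (of_int z :: int poly) = 0" for z by (simp add: of_int_poly)
  show ?thesis by (simp add: fpoly_eq pderiv_diff pderiv_add pderiv_mult h c algebra_simps)
qed

text \<open>The factor X raises the exponents k - 1 and n - 1 to k and n, so that F and its
  derivative are compared through the same monomials.\<close>

lemma X_pderiv_fpoly:
  assumes "k > 0" "n > 0"
  shows "polyX * pderiv (fpoly a c k m n) = of_nat (k * m) * polyX ^ k * (polyX ^ k + of_int c) ^ (m - 1)
     - of_int a * of_nat n * polyX ^ n"
proof -
  have "polyX ^ k = polyX * polyX ^ (k - 1)" "polyX ^ n = polyX * polyX ^ (n - 1)"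
    using assms by (simp_all flip: power_Suc)
  then show ?thesis unfolding pderiv_fpoly by (simp only: right_diff_distrib mult_ac)
qed

context nat_maximal_pair
begin

lemma M2_power: "x \<in> M \<Longrightarrow> i \<ge> 2 \<Longrightarrow> x ^ i \<in> M2"
proof -
  assume x: "x \<in> M" and "i \<ge> 2"
  then have "x ^ i = x * x * x ^ (i - 2)" by (metis power2_eq_square power_add le_add_diff_inverse)
  then show "x ^ i \<in> M2" using M2_ideal(3)[OF M2_mult[OF x x]] by metis
qed

lemma M2_diff_cancel:
  "r \<in> M2 \<Longrightarrow> q - r \<in> M2 \<longleftrightarrow> q \<in> M2" "r \<in> M2 \<Longrightarrow> q + r \<in> M2 \<longleftrightarrow> q \<in> M2" "r \<in> M2 \<Longrightarrow> r + q \<in> M2 \<longleftrightarrow> q \<in> M2"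
  using M2_diff_iff[of "q - r" q] M2_diff_iff[of "q + r" q] M2_diff_iff[of "r + q" q] M2_ideal(6) by auto

lemma M_diff_cancel:
  "r \<in> M \<Longrightarrow> q - r \<in> M \<longleftrightarrow> q \<in> M" "r \<in> M \<Longrightarrow> q + r \<in> M \<longleftrightarrow> q \<in> M" "r \<in> M \<Longrightarrow> r + q \<in> M \<longleftrightarrow> q \<in> M"
  using M_diff_iff[of "q - r" q] M_diff_iff[of "q + r" q] M_diff_iff[of "r + q" q] M_ideal(6) by auto

lemma M_of_nat: "of_nat i \<in> M \<longleftrightarrow> p dvd i"
  using M_of_int[of "int i"] by simp

text \<open>The constant term of F is c^m, because n > 0.\<close>

lemma X_notin_if_unit_const:
  assumes "\<not> int p dvd c" "n > 0" "k > 0" "fpoly a c k m n \<in> M"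
  shows "polyX \<notin> M"
proof
  assume X: "polyX \<in> M"
  then have "of_int a * polyX ^ n \<in> M" "polyX ^ k \<in> M" using assms by (auto simp: M_prime M_power)
  then have "(polyX ^ k + of_int c) ^ m \<in> M" using assms(4) by (simp add: fpoly_eq M_diff_cancel)
  then have "polyX ^ k + of_int c \<in> M" by (simp add: M_power)
  then show False using assms(1) \<open>polyX ^ k \<in> M\<close> by (simp add: M_diff_cancel M_of_int)
qed

end

section \<open>Cases (i), (iii), (iv) and (vi) modulo M^2\<close>

locale prime_factor_data =
  fixes a c :: int and k m n p :: nat
  assumes p: "prime p" and kmn: "k * m > n" and n1: "n \<ge> 1"
begin

abbreviation "F \<equiv> fpoly a c k m n"
abbreviation "P \<equiv> int p"

definition in_square :: bool where
  "in_square \<longleftrightarrow> (\<exists>g. nat_maximal_pair p g \<and> F \<in> pideal_sq P g)"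

lemma km: "k > 0" "m > 0" "n > 0"
  using kmn n1 by (auto intro: Nat.gr0I)

lemma pp: "prime P"
  using p by simp

lemma nat_pair_containing:
  assumes "monic h" "degree h > 0"
  obtains g where "nat_maximal_pair p g" "h \<in> pideal P g"
  using maximal_pair_containing[OF pp assms] nat_maximal_pair.intro by metis

lemma pair_X: obtains g where "nat_maximal_pair p g" "polyX \<in> pideal P g"
proof -
  have "monic polyX" "degree polyX > 0" by (simp_all add: polyX_def)
  then show thesis using nat_pair_containing that by blast
qed

lemma pair_binomial: obtains g where "nat_maximal_pair p g" "polyX ^ k + of_int c \<in> pideal P g"
proof -
  have "degree (of_int c :: int poly) < k" using km by (simp add: of_int_poly)
  from monic_polyX_power_plus[OF this] show thesis using nat_pair_containing km that by metis
qed

text \<open>Modulo p, F is X^(km), so M must contain X. Then a X^n lies in M^2, and for m = 1 the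
  bound k > n gives k >= 2, so that only the constant c is left.\<close>

lemma case_i:
  assumes c: "P dvd c" and a: "P dvd a"
  shows "in_square \<longleftrightarrow> \<not> (m = 1 \<and> \<not> P ^ 2 dvd c)"
proof -
  have sq: "F \<in> pideal_sq P g \<longleftrightarrow> m \<ge> 2 \<or> P ^ 2 dvd c"
    if g: "nat_maximal_pair p g" and X: "polyX \<in> pideal P g" for g
  proof -
    interpret nat_maximal_pair p g by fact
    have "of_int a * polyX ^ n \<in> M2" using a X km by (intro M2_mult) (auto simp: M_of_int M_power)
    then have F: "F \<in> M2 \<longleftrightarrow> (polyX ^ k + of_int c) ^ m \<in> M2" by (simp add: fpoly_eq M2_diff_cancel)
    have h: "polyX ^ k + of_int c \<in> M" using X c km by (intro M_ideal(2)) (auto simp: M_of_int M_power)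
    show ?thesis
    proof (cases "m \<ge> 2")
      case True then show ?thesis using F M2_power[OF h] by simp
    next
      case False
      then have "m = 1" using km by simp
      then have "polyX ^ k \<in> M2" using kmn n1 by (intro M2_power[OF X]) simp
      then show ?thesis using F \<open>m = 1\<close> by (simp add: M2_diff_cancel M2_of_int)
    qed
  qed
  have X: "polyX \<in> pideal P g" if g: "nat_maximal_pair p g" and F: "F \<in> pideal_sq P g" for g
  proof -
    interpret nat_maximal_pair p g by fact
    have "of_int a * polyX ^ n \<in> M" "of_int c \<in> M" using a c by (auto simp: M_prime M_of_int)
    then show ?thesis using M2_subset[OF F] by (simp add: fpoly_eq M_diff_cancel M_power)
  qed
  have "in_square \<longleftrightarrow> m \<ge> 2 \<or> P ^ 2 dvd c"
    unfolding in_square_def using sq X pair_X by metis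
  then show ?thesis using km by auto
qed

text \<open>Modulo p, F is (X^k + c)^m, so M must contain X^k + c. As m >= 2, only a X^n survives
  modulo M^2, and X is a unit because c is.\<close>

lemma case_iv_a:
  assumes c: "\<not> P dvd c" and a: "P dvd a" and m: "m \<ge> 2"
  shows "in_square \<longleftrightarrow> P ^ 2 dvd a"
proof -
  have sq: "F \<in> pideal_sq P g \<longleftrightarrow> P ^ 2 dvd a"
    if g: "nat_maximal_pair p g" and h: "polyX ^ k + of_int c \<in> pideal P g" for g
  proof -
    interpret nat_maximal_pair p g by fact
    have "(polyX ^ k + of_int c) ^ m \<in> M2" by (rule M2_power[OF h m])
    then have "F \<in> M2 \<longleftrightarrow> of_int a * polyX ^ n \<in> M2"
      using M2_ideal(5,6) by (metis M2_diff_cancel(3) diff_conv_add_uminus fpoly_eq minus_minus)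
    moreover have "polyX \<notin> M"
    proof
      assume "polyX \<in> M"
      then have "polyX ^ k \<in> M" using km by (simp add: M_power)
      then show False using h c by (simp add: M_diff_cancel M_of_int)
    qed
    then have "polyX ^ n * of_int a \<in> M2 \<longleftrightarrow> P ^ 2 dvd a"
      by (subst M2_unit_mult) (simp_all add: M_power M2_of_int)
    ultimately show ?thesis by (simp add: mult.commute)
  qed
  have h: "polyX ^ k + of_int c \<in> pideal P g" if g: "nat_maximal_pair p g" and F: "F \<in> pideal_sq P g" for g
  proof -
    interpret nat_maximal_pair p g by fact
    have "of_int a * polyX ^ n \<in> M" using a by (auto simp: M_prime M_of_int)
    then show ?thesis using M2_subset[OF F] by (simp add: fpoly_eq M_diff_cancel M_power)
  qed
  show ?thesis unfolding in_square_def using sq h pair_binomial by metis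
qed

text \<open>F is u^p - v^p plus X^n (a^p - a). Once F lies in M, so does u - v by Frobenius, and u^p
  - v^p falls into M^2. The outcome is the same for every M containing F.\<close>

lemma case_vi:
  assumes ca: "\<not> P dvd c" "\<not> P dvd a" and pm: "p dvd m" and pn: "p dvd n"
  shows "in_square \<longleftrightarrow> P ^ 2 dvd a ^ p - a"
proof -
  obtain m' n' where m'n': "m = m' * p" "n = n' * p" using pm pn by (metis dvdE mult.commute)
  have sq: "F \<in> pideal_sq P g \<longleftrightarrow> P ^ 2 dvd a ^ p - a"
    if g: "nat_maximal_pair p g" and F: "F \<in> pideal P g" for g
  proof -
    interpret nat_maximal_pair p g by fact
    define u v where "u = (polyX ^ k + of_int c) ^ m'" and "v = of_int a * polyX ^ n'"
    have um: "u ^ p = (polyX ^ k + of_int c) ^ m" by (simp add: u_def m'n' power_mult)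
    have vm: "v ^ p = of_int (a ^ p) * polyX ^ n" by (simp add: v_def m'n' power_mult_distrib power_mult)
    have "icong M (of_int (a ^ p) * polyX ^ n) (of_int a * polyX ^ n)"
      using cong1(6)[OF cong1_fermat[of a 1] cong1(1)] by simp
    from cong1(5)[OF cong1(1)[of "u ^ p"] this] have "icong M (u ^ p - v ^ p) F"
      unfolding um vm fpoly_eq .
    then have "u ^ p - v ^ p \<in> M" using cong1(8) F by blast
    then have "u - v \<in> M" using power_prime_diff_iff[of u 1 v] by simp
    then have uv: "u ^ p - v ^ p \<in> M2" using cong2_power[of u v p] by (simp add: icong_def)
    have "F = (u ^ p - v ^ p) + polyX ^ n * of_int (a ^ p - a)"
      unfolding um vm fpoly_eq by (simp add: algebra_simps)
    then have "F \<in> M2 \<longleftrightarrow> polyX ^ n * of_int (a ^ p - a) \<in> M2" using M2_diff_cancel(3)[OF uv] by metis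
    moreover have "polyX \<notin> M" using X_notin_if_unit_const[OF ca(1) km(3,1) F] .
    then have "polyX ^ n * of_int (a ^ p - a) \<in> M2 \<longleftrightarrow> P ^ 2 dvd a ^ p - a"
      by (subst M2_unit_mult) (simp_all only: M_power M2_of_int, simp)
    ultimately show ?thesis by blast
  qed
  obtain g where "nat_maximal_pair p g" "F \<in> pideal P g"
    using nat_pair_containing fpoly_monic[OF kmn] kmn by (metis gr_zeroI not_less_zero)
  moreover have "F \<in> pideal P g" if g: "nat_maximal_pair p g" and F: "F \<in> pideal_sq P g" for g
  proof -
    interpret nat_maximal_pair p g by fact
    show ?thesis using M2_subset[OF F] .
  qed
  ultimately show ?thesis unfolding in_square_def using sq by metis
qed

text \<open>With q = p^j, F is X^k - (-c)^q plus p (a2 X^n + c1), and the first part lies in M^2 as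
  soon as X^k + c lies in M.\<close>

lemma case_iv_b:
  assumes a: "a = - (P * a2)" and m: "m = 1"
    and j: "p ^ j dvd k" "j > 0" and c1: "(- c) ^ (p ^ j) + c = P * c1"
  shows "in_square \<longleftrightarrow> (\<exists>g. nat_maximal_pair p g \<and> polyX ^ k - of_int (- c) \<in> pideal P g \<and>
    of_int a2 * polyX ^ n + of_int c1 \<in> pideal P g)"
proof -
  have "F \<in> pideal_sq P g \<longleftrightarrow> polyX ^ k - of_int (- c) \<in> pideal P g \<and>
    of_int a2 * polyX ^ n + of_int c1 \<in> pideal P g" if g: "nat_maximal_pair p g" for g
  proof -
    interpret nat_maximal_pair p g by fact
    have "of_int a \<in> M" by (subst M_of_int) (simp add: a)
    then have FM: "F \<in> M \<longleftrightarrow> polyX ^ k - of_int (- c) \<in> M"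
      by (simp add: fpoly_eq m M_diff_cancel M_prime)
    show ?thesis
    proof (cases "polyX ^ k - of_int (- c) \<in> M")
      case True
      then have "icong M2 (polyX ^ k) (of_int ((- c) ^ (p ^ j)))"
        using j by (intro cong2_power_of_int) (simp_all only: icong_def)
      then have X: "polyX ^ k - of_int ((- c) ^ (p ^ j)) \<in> M2" by (simp only: icong_def)
      have "F = (polyX ^ k - of_int ((- c) ^ (p ^ j))) + (of_int ((- c) ^ (p ^ j) + c) - of_int a * polyX ^ n)"
        by (simp add: fpoly_eq m)
      also have "\<dots> = (polyX ^ k - of_int ((- c) ^ (p ^ j))) + of_int P * (of_int a2 * polyX ^ n + of_int c1)"
        unfolding c1 unfolding a by (simp add: algebra_simps)
      finally have "F \<in> M2 \<longleftrightarrow> of_int a2 * polyX ^ n + of_int c1 \<in> M"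
        using M2_diff_cancel(3)[OF X] M2_p_mult by metis
      then show ?thesis using True by simp
    qed (use FM M2_subset in blast)
  qed
  then show ?thesis unfolding in_square_def by blast
qed

text \<open>With q = p^j, F is X^n (X^(k-n) - a^q) plus p (a1 X^n + c2). Since p does not divide c2,
  p^2 does not divide c, which excludes ideals M containing X.\<close>

lemma case_iii_reduced:
  assumes c: "c = P * c2" and m: "m = 1" and n2: "n \<ge> 2" and c2: "\<not> P dvd c2"
    and j: "p ^ j dvd k - n" "j > 0" and a1: "a ^ (p ^ j) - a = P * a1"
  shows "in_square \<longleftrightarrow> (\<exists>g. nat_maximal_pair p g \<and> polyX ^ (k - n) - of_int a \<in> pideal P g \<and>
    of_int a1 * polyX ^ n + of_int c2 \<in> pideal P g)"
proof -
  have "F \<in> pideal_sq P g \<longleftrightarrow> polyX ^ (k - n) - of_int a \<in> pideal P g \<and>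
    of_int a1 * polyX ^ n + of_int c2 \<in> pideal P g" if g: "nat_maximal_pair p g" for g
  proof -
    interpret nat_maximal_pair p g by fact
    have Xk: "polyX ^ k = polyX ^ n * polyX ^ (k - n)" using kmn m by (simp flip: power_add)
    have XA: "polyX ^ (k - n) - of_int a \<in> M" if F: "F \<in> M2"
    proof -
      have "polyX \<notin> M"
      proof
        assume X: "polyX \<in> M"
        have "polyX ^ k \<in> M2" "polyX ^ n \<in> M2" using kmn n2 m by (auto intro!: M2_power[OF X])
        then have "of_int c \<in> M2" using F M2_ideal(4) by (simp add: fpoly_eq m M2_diff_cancel)
        then have "P ^ 2 dvd c" by (simp only: M2_of_int)
        then show False using c c2 p by (simp add: power2_eq_square prime_gt_0_nat)
      qed
      have "of_int c \<in> M" by (subst M_of_int) (simp add: c)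
      moreover have "F = polyX ^ n * (polyX ^ (k - n) - of_int a) + of_int c"
        by (simp add: fpoly_eq m Xk algebra_simps)
      ultimately have "polyX ^ n * (polyX ^ (k - n) - of_int a) \<in> M"
        using M2_subset[OF F] M_diff_cancel(2) by metis
      then show ?thesis using \<open>polyX \<notin> M\<close> by (simp add: M_prime M_power)
    qed
    show ?thesis
    proof (cases "polyX ^ (k - n) - of_int a \<in> M")
      case True
      then have "icong M2 (polyX ^ (k - n)) (of_int (a ^ (p ^ j)))"
        using j by (intro cong2_power_of_int) (simp_all only: icong_def)
      then have X: "polyX ^ n * (polyX ^ (k - n) - of_int (a ^ (p ^ j))) \<in> M2"
        unfolding icong_def by (rule M2_ideal(4))
      have "F = polyX ^ n * (polyX ^ (k - n) - of_int (a ^ (p ^ j))) + (of_int (a ^ (p ^ j) - a) * polyX ^ n + of_int c)"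
        by (simp add: fpoly_eq m Xk algebra_simps)
      also have "\<dots> = polyX ^ n * (polyX ^ (k - n) - of_int (a ^ (p ^ j))) + of_int P * (of_int a1 * polyX ^ n + of_int c2)"
        unfolding a1 unfolding c by (simp add: algebra_simps)
      finally have "F \<in> M2 \<longleftrightarrow> of_int a1 * polyX ^ n + of_int c2 \<in> M"
        using M2_diff_cancel(3)[OF X] M2_p_mult by metis
      then show ?thesis using True by simp
    qed (use XA in blast)
  qed
  then show ?thesis unfolding in_square_def by blast
qed

text \<open>The identity X F' = k F - k c + a (k - n) X^n shows that a double root with X a unit
  needs p | k - n; if X were in M, then p^2 would divide c.\<close>

lemma case_iii_separable:
  assumes c: "c = P * c2" and a: "\<not> P dvd a" and m: "m = 1" and n2: "n \<ge> 2" and c2: "\<not> P dvd c2"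
    and pkn: "\<not> p dvd k - n"
  shows "\<not> in_square"
proof
  assume in_square
  then obtain g where g: "nat_maximal_pair p g" and F: "F \<in> pideal_sq P g" unfolding in_square_def by blast
  interpret nat_maximal_pair p g by fact
  have X: "polyX \<notin> M"
  proof
    assume X: "polyX \<in> M"
    have "polyX ^ k \<in> M2" "polyX ^ n \<in> M2" using kmn n2 m by (auto intro!: M2_power[OF X])
    then have "of_int c \<in> M2" using F M2_ideal(4) by (simp add: fpoly_eq m M2_diff_cancel)
    then have "P ^ 2 dvd c" by (simp only: M2_of_int)
    then show False using c c2 p by (simp add: power2_eq_square prime_gt_0_nat)
  qed
  have cM: "of_int c \<in> M" by (subst M_of_int) (simp add: c)
  have "polyX * pderiv F = of_nat k * polyX ^ k - of_int a * of_nat n * polyX ^ n"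
    unfolding X_pderiv_fpoly[OF km(1,3)] by (simp add: m)
  also have "\<dots> = of_nat k * F - of_nat k * of_int c + of_int a * of_nat (k - n) * polyX ^ n"
    using kmn by (simp add: fpoly_eq m of_nat_diff algebra_simps)
  finally have "of_nat k * F - of_nat k * of_int c + of_int a * of_nat (k - n) * polyX ^ n \<in> M"
    using M_ideal(4)[OF pderiv_in_M[OF F]] by metis
  moreover have "of_nat k * F - of_nat k * of_int c \<in> M"
    using M_ideal(4,5) M2_subset[OF F] cM by metis
  ultimately have "of_int a * of_nat (k - n) * polyX ^ n \<in> M" by (simp only: M_diff_cancel)
  then show False using a pkn X by (simp add: M_prime M_power M_of_int M_of_nat del: of_nat_diff)
qed

end

section \<open>Coprimality modulo p and the polynomial t(x)\<close>

lemma dvdm_iff_pideal: "poly_mod.dvdm p h q \<longleftrightarrow> q \<in> pideal p h"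
proof -
  have "poly_mod.Mp p q = poly_mod.Mp p r \<longleftrightarrow> of_int p dvd q - r" for r
    by (simp add: poly_eq_iff poly_mod.Mp_coeff poly_mod.M_def dvd_of_int_poly_iff mod_eq_dvd_iff)
  then have "poly_mod.dvdm p h q \<longleftrightarrow> (\<exists>r. of_int p dvd q - h * r)"
    by (simp add: poly_mod.dvdm_def)
  also have "\<dots> \<longleftrightarrow> (\<exists>r A. q = of_int p * A + h * r)"
    unfolding dvd_def by (metis add_diff_cancel_right' diff_add_cancel)
  finally show ?thesis by (auto simp: pideal_def)
qed

text \<open>A common divisor h modulo p is a nonunit exactly when (p, h) is proper, and then (p, h)
  extends to a maximal pair because it contains the monic g2.\<close>

lemma not_coprime_m_iff:
  fixes p :: nat
  assumes p: "prime p" and g2: "monic g2"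
  shows "\<not> poly_mod.coprime_m (int p) g1 g2 \<longleftrightarrow>
    (\<exists>g. nat_maximal_pair p g \<and> g1 \<in> pideal (int p) g \<and> g2 \<in> pideal (int p) g)"
proof
  assume "\<not> poly_mod.coprime_m (int p) g1 g2"
  then obtain h where h: "g1 \<in> pideal (int p) h" "g2 \<in> pideal (int p) h" "1 \<notin> pideal (int p) h"
    unfolding poly_mod.coprime_m_def dvdm_iff_pideal by blast
  have pp: "prime (int p)" using p by simp
  have "of_int (int p) \<in> pideal (int p) h" using pideal_p[of "int p" 1 h] by simp
  from maximal_pair_exists[OF pp poly_ideal_pideal this h(3,2) g2] obtain g
    where "maximal_pair (int p) g" "pideal (int p) h \<subseteq> pideal (int p) g" .
  with h show "\<exists>g. nat_maximal_pair p g \<and> g1 \<in> pideal (int p) g \<and> g2 \<in> pideal (int p) g"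
    using nat_maximal_pair.intro by blast
next
  assume "\<exists>g. nat_maximal_pair p g \<and> g1 \<in> pideal (int p) g \<and> g2 \<in> pideal (int p) g"
  then obtain g where g: "nat_maximal_pair p g" "g1 \<in> pideal (int p) g" "g2 \<in> pideal (int p) g" by blast
  then have "1 \<notin> pideal (int p) g" by (simp add: nat_maximal_pair_def maximal_pair.proper)
  with g show "\<not> poly_mod.coprime_m (int p) g1 g2"
    unfolding poly_mod.coprime_m_def dvdm_iff_pideal by blast
qed

text \<open>The division inside \<open>tpoly\<close> is exact: the freshman identity handles the
  mixed terms and Fermat the remaining c^(p^j) - c.\<close>

lemma tpoly_eq:
  assumes p: "prime p"
  shows "of_int (int p) * tpoly p j s' c
    = (polyX ^ s' + of_int c) ^ (p ^ j) - (polyX ^ s') ^ (p ^ j) - of_int c"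
proof -
  let ?q = "p ^ j" and ?S = "(\<Sum>i<p ^ j. monom (of_nat (p ^ j choose i) * c ^ (p ^ j - i)) (s' * i)) - [:c:]"
  have "(polyX ^ s' + of_int c) ^ ?q = (\<Sum>i\<le>?q. of_nat (?q choose i) * (polyX ^ s') ^ i * of_int c ^ (?q - i))"
    by (rule binomial_ring)
  also have "\<dots> = (\<Sum>i<?q. of_nat (?q choose i) * (polyX ^ s') ^ i * of_int c ^ (?q - i)) + (polyX ^ s') ^ ?q"
    using sum.lessThan_Suc[of "\<lambda>i. of_nat (?q choose i) * (polyX ^ s') ^ i * of_int c ^ (?q - i)" ?q]
    by (simp add: lessThan_Suc_atMost)
  also have "(\<Sum>i<?q. of_nat (?q choose i) * (polyX ^ s') ^ i * of_int c ^ (?q - i))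
      = (\<Sum>i<?q. monom (of_nat (?q choose i) * c ^ (?q - i)) (s' * i))"
    by (rule sum.cong) (simp_all add: monom_eq_polyX mult_ac flip: power_mult)
  finally have S: "?S = (polyX ^ s' + of_int c) ^ ?q - (polyX ^ s') ^ ?q - of_int c"
    by (simp add: of_int_poly)
  have "of_int (int p) dvd ((polyX ^ s' + of_int c) ^ ?q - ((polyX ^ s') ^ ?q + of_int c ^ ?q))"
    using prime_power_dvd_freshman[OF p, of "polyX ^ s'" "of_int c" j] by simp
  moreover have "of_int (int p) dvd (of_int (c ^ ?q - c) :: int poly)"
    using prime_dvd_power_minus_self[OF p, of c j] by (auto elim!: dvdE simp del: of_int_diff of_int_power)
  moreover have "?S = ((polyX ^ s' + of_int c) ^ ?q - ((polyX ^ s') ^ ?q + of_int c ^ ?q)) + of_int (c ^ ?q - c)"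
    unfolding S by simp
  ultimately have "of_int (int p) dvd ?S" by (metis dvd_add)
  then have "int p dvd coeff ?S i" for i unfolding dvd_of_int_poly_iff by blast
  then have "of_int (int p) * tpoly p j s' c = ?S"
    unfolding tpoly_def by (intro poly_eqI) (simp only: of_int_poly of_int_eq_id id_apply mult_pCons_left mult_zero_left
        pCons_0_0 add_0_right coeff_smult coeff_map_poly div_0 dvd_mult_div_cancel)
  then show ?thesis unfolding S .
qed

section \<open>Consequences of a double root, and the cases (ii), (v) and (vii)\<close>

context prime_factor_data
begin

text \<open>Modulo M, X F' reduces to -a n X^n with a and X units.\<close>

lemma p_dvd_n_if_double_root:
  assumes c: "\<not> P dvd c" and a: "\<not> P dvd a" and km_dvd: "p dvd k * m"
    and g: "nat_maximal_pair p g" "F \<in> pideal P g" "pderiv F \<in> pideal P g"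
  shows "p dvd n"
proof -
  interpret nat_maximal_pair p g by fact
  have X: "polyX \<notin> M" using X_notin_if_unit_const[OF c km(3,1) g(2)] .
  have "of_nat (k * m) \<in> M" unfolding M_of_nat by (rule km_dvd)
  then have "of_nat (k * m) * polyX ^ k * (polyX ^ k + of_int c) ^ (m - 1) \<in> M" using M_ideal(3) by blast
  moreover have "polyX * pderiv F \<in> M" using M_ideal(4)[OF g(3)] .
  ultimately have "of_int a * of_nat n * polyX ^ n \<in> M"
    unfolding X_pderiv_fpoly[OF km(1,3)] using M_ideal(5) by fastforce
  then show ?thesis using X a by (simp add: M_prime M_power M_of_int M_of_nat)
qed

lemma p_dvd_k_if_double_root:
  assumes c: "\<not> P dvd c" and a: "P dvd a" and m: "m = 1"
    and g: "nat_maximal_pair p g" "F \<in> pideal P g" "pderiv F \<in> pideal P g"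
  shows "p dvd k"
proof -
  interpret nat_maximal_pair p g by fact
  have X: "polyX \<notin> M" using X_notin_if_unit_const[OF c km(3,1) g(2)] .
  have "polyX * pderiv F \<in> M" using M_ideal(4)[OF g(3)] .
  moreover have "of_int a * of_nat n * polyX ^ n \<in> M" using a by (simp add: M_prime M_of_int)
  ultimately have "of_nat k * polyX ^ k \<in> M"
    unfolding X_pderiv_fpoly[OF km(1,3)] by (simp add: m M_diff_cancel)
  then show ?thesis using X by (simp add: M_prime M_power M_of_nat)
qed

text \<open>Modulo M, F becomes X^(km) - a X, and X F' becomes X times km (X^(km-1) - a) + a (km -
  1).\<close>

lemma case_ii_local:
  assumes c: "P dvd c" and a: "\<not> P dvd a" and n: "n = 1"
    and g: "nat_maximal_pair p g" "F \<in> pideal P g" "pderiv F \<in> pideal P g"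
  shows "polyX \<notin> pideal P g" "polyX ^ (k * m - 1) - of_int a \<in> pideal P g" "p dvd k * m - 1"
proof -
  interpret nat_maximal_pair p g by fact
  let ?h = "polyX ^ k + of_int c"
  have cM: "of_int c \<in> M" using c by (simp add: M_of_int)
  show X: "polyX \<notin> M"
  proof
    assume X: "polyX \<in> M"
    have "polyX ^ k \<in> M" using X km by (simp add: M_power)
    then have "?h \<in> M" using cM M_ideal(2) by blast
    \<comment> \<open>As km > 1, one of the factors X^(k-1) and (X^k + c)^(m-1) vanishes modulo M,
      leaving -a in the derivative.\<close>
    have "k - 1 > 0 \<or> m - 1 > 0" using kmn n km by (cases "k = 1"; cases "m = 1") auto
    then have "of_nat (k * m) * polyX ^ (k - 1) * ?h ^ (m - 1) \<in> M"
      using X \<open>?h \<in> M\<close> by (auto simp add: M_prime M_power)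
    then have "of_int a \<in> M" using g(3) M_ideal(5) unfolding pderiv_fpoly n by fastforce
    then show False using a by (simp add: M_of_int)
  qed
  have h: "icong M ?h (polyX ^ k)" using cM by (simp add: icong_def)
  have "k * m = Suc (k * m - 1)" using kmn by simp
  then have Xkm: "polyX ^ (k * m) = polyX * polyX ^ (k * m - 1)" by (metis power_Suc)
  have kN: "(of_nat (k * m) :: int poly) = 1 + of_nat (k * m - 1)" using \<open>k * m = Suc _\<close> by (metis of_nat_Suc)
  have "icong M F (polyX ^ (k * m) - of_int a * polyX ^ n)"
    unfolding fpoly_eq power_mult by (rule cong1(5)[OF cong1(7)[OF h] cong1(1)])
  then have "polyX ^ (k * m) - of_int a * polyX ^ n \<in> M" using cong1(8) g(2) by blast
  then have "polyX * (polyX ^ (k * m - 1) - of_int a) \<in> M" by (simp add: Xkm n algebra_simps)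
  then show XA: "polyX ^ (k * m - 1) - of_int a \<in> M" using X by (simp add: M_prime)
  have "polyX ^ k * (polyX ^ k) ^ (m - 1) = polyX ^ (k * m)" using km by (simp add: power_mult flip: power_Suc)
  then have "icong M (polyX * pderiv F) (of_nat (k * m) * polyX ^ (k * m) - of_int a * of_nat n * polyX ^ n)"
    unfolding X_pderiv_fpoly[OF km(1,3)]
    using cong1(5)[OF cong1(6)[OF cong1(1)[of "of_nat (k * m) * polyX ^ k"] cong1(7)[OF h, of "m - 1"]] cong1(1)]
    by (simp add: mult.assoc)
  then have "of_nat (k * m) * polyX ^ (k * m) - of_int a * of_nat n * polyX ^ n \<in> M"
    using cong1(8) M_ideal(4)[OF g(3)] by blast
  moreover have "of_nat (k * m) * polyX ^ (k * m) - of_int a * of_nat n * polyX ^ n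
      = polyX * of_nat (k * m) * (polyX ^ (k * m - 1) - of_int a) + polyX * (of_int a * of_nat (k * m - 1))"
    unfolding kN Xkm n by (simp add: algebra_simps)
  moreover have "polyX * of_nat (k * m) * (polyX ^ (k * m - 1) - of_int a) \<in> M" using M_ideal(4)[OF XA] .
  ultimately have "polyX * (of_int a * of_nat (k * m - 1)) \<in> M" by (metis M_diff_cancel(3))
  then show "p dvd k * m - 1" using X a by (simp add: M_prime M_of_int M_of_nat del: of_nat_diff of_nat_mult)
qed

text \<open>Expanding (X^k + c)^m to first order in c gives F = p (a1 X + m c2 X^(k(m-1))) modulo
  M^2 once X^(km-1) = a modulo M.\<close>

lemma case_ii:
  assumes c: "c = P * c2" and a: "\<not> P dvd a" and n: "n = 1"
    and j: "p ^ j dvd k * m - 1" "j > 0" and a1: "a ^ (p ^ j) - a = P * a1"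
  shows "in_square \<longleftrightarrow> (\<exists>g. nat_maximal_pair p g \<and> polyX ^ (k * m - 1) - of_int a \<in> pideal P g \<and>
    of_int a1 * polyX ^ k + of_int (int m * a * c2) \<in> pideal P g)"
proof -
  let ?N = "k * m - 1"
  have Pc: "P dvd c" using c by simp
  have "F \<in> pideal_sq P g \<longleftrightarrow> polyX ^ ?N - of_int a \<in> pideal P g \<and>
    of_int a1 * polyX ^ k + of_int (int m * a * c2) \<in> pideal P g" if g: "nat_maximal_pair p g" for g
  proof -
    interpret nat_maximal_pair p g by fact
    have "k * m = Suc ?N" using kmn by simp
    then have Xkm: "polyX ^ (k * m) = polyX * polyX ^ ?N" by (metis power_Suc)
    have N: "polyX ^ (k - 1) * (polyX ^ k) ^ (m - 1) = polyX ^ ?N"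
    proof -
      have "k - 1 + k * (m - 1) = ?N" using km by (cases m) auto
      then show ?thesis by (simp flip: power_mult power_add)
    qed
    show ?thesis
    proof (cases "polyX ^ ?N - of_int a \<in> M")
      case True
      have X: "polyX \<notin> M"
        using M_diff_iff[OF True] a kmn n by (auto simp: M_power M_of_int)
      have "icong M2 (polyX ^ ?N) (of_int (a ^ (p ^ j)))"
        using True j by (intro cong2_power_of_int) (simp_all only: icong_def)
      then have 1: "polyX * (polyX ^ ?N - of_int (a ^ (p ^ j))) \<in> M2"
        unfolding icong_def by (rule M2_ideal(4))
      have "of_int c \<in> M" using Pc by (simp add: M_of_int)
      note 2 = power_first_order[OF this, of "polyX ^ k" m]
      let ?u = "of_int a1 * polyX + of_nat m * of_int c2 * (polyX ^ k) ^ (m - 1)"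
      have "F = (((polyX ^ k + of_int c) ^ m - ((polyX ^ k) ^ m + of_nat m * (polyX ^ k) ^ (m - 1) * of_int c))
         + polyX * (polyX ^ ?N - of_int (a ^ (p ^ j))))
         + (of_int (a ^ (p ^ j) - a) * polyX + of_nat m * (polyX ^ k) ^ (m - 1) * of_int c)"
        unfolding fpoly_eq n power_one_right power_mult[symmetric] Xkm by (simp add: algebra_simps)
      also have "of_int (a ^ (p ^ j) - a) * polyX + of_nat m * (polyX ^ k) ^ (m - 1) * of_int c = of_int P * ?u"
        unfolding a1 unfolding c by (simp add: algebra_simps)
      finally have "F \<in> M2 \<longleftrightarrow> of_int P * ?u \<in> M2"
        using M2_diff_cancel(3)[OF M2_ideal(2)[OF 2 1]] by metis
      also have "\<dots> \<longleftrightarrow> ?u \<in> M" by (rule M2_p_mult)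
      \<comment> \<open>The unit X^(k-1) completes the second exponent to km - 1, where X^(km-1) may
        be replaced by a; this is the origin of the factor a in m a c2.\<close>
      also have "\<dots> \<longleftrightarrow> polyX ^ (k - 1) * ?u \<in> M" using X by (simp add: M_prime M_power)
      also have "polyX ^ (k - 1) * ?u = of_int a1 * polyX ^ k + of_nat m * of_int c2 * polyX ^ ?N"
      proof -
        have "polyX ^ (k - 1) * polyX = polyX ^ k" using km by (simp flip: power_Suc2)
        moreover have "polyX ^ (k - 1) * ?u = of_int a1 * (polyX ^ (k - 1) * polyX)
            + of_nat m * of_int c2 * (polyX ^ (k - 1) * (polyX ^ k) ^ (m - 1))"
          by (simp only: distrib_left mult_ac)
        ultimately show ?thesis unfolding N by simp
      qed
      also have "\<dots> \<in> M \<longleftrightarrow> of_int a1 * polyX ^ k + of_nat m * of_int c2 * of_int a \<in> M"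
        using True by (intro cong1(8) cong1(4) cong1(6) cong1(1)) (simp add: icong_def)
      finally show ?thesis using True by (simp add: mult_ac)
    next
      case False
      have "F \<notin> M2"
      proof
        assume F: "F \<in> M2"
        from case_ii_local(2)[OF Pc a n g M2_subset[OF F] pderiv_in_M[OF F]] False show False by blast
      qed
      then show ?thesis using False by simp
    qed
  qed
  then show ?thesis unfolding in_square_def by blast
qed

text \<open>With q = p^j and y = X^s' + c, X^k + c is y^q - p t. Modulo M, F is therefore the q-th
  power of g2. Once g2 is in M, y^(mq) and (a X^s)^q agree modulo M^2, and the first-order term of
  (y^q - p t)^m leaves F = p g1.\<close>

lemma case_v:
  assumes kn: "k = p ^ j * s'" "n = p ^ j * s" and j: "j > 0" and a1: "a ^ (p ^ j) - a = P * a1"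
  shows "in_square \<longleftrightarrow> \<not> poly_mod.coprime_m P
    (monom a1 n - Polynomial.smult (int m) (tpoly p j s' c * (monom 1 k + [:c:]) ^ (m - 1)))
    ((monom 1 s' + [:c:]) ^ m - monom a s)"
proof -
  define T W y where "T = tpoly p j s' c" and "W = polyX ^ k + of_int c" and "y = polyX ^ s' + of_int c"
  have "k * m = p ^ j * (s' * m)" by (simp add: kn)
  then have "s' * m > s" using kmn p by (simp add: kn prime_gt_0_nat)
  note monic_g2 = fpoly_monic(1)[OF this, of a c]
  have T: "of_int P * T = y ^ (p ^ j) - W"
    unfolding T_def tpoly_eq[OF p] by (simp add: W_def y_def kn(1) mult.commute[of "p ^ j"] power_mult)
  define g1 g2 where "g1 = of_int a1 * polyX ^ n - of_nat m * (T * W ^ (m - 1))" and "g2 = y ^ m - of_int a * polyX ^ s"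
  have g1: "monom a1 n - Polynomial.smult (int m) (tpoly p j s' c * (monom 1 k + [:c:]) ^ (m - 1)) = g1"
    by (simp add: g1_def T_def W_def monom_eq_polyX of_int_poly of_nat_poly)
  have g2: "(monom 1 s' + [:c:]) ^ m - monom a s = g2"
    by (simp add: g2_def y_def monom_eq_polyX of_int_poly)
  have "F \<in> pideal_sq P g \<longleftrightarrow> g1 \<in> pideal P g \<and> g2 \<in> pideal P g" if g: "nat_maximal_pair p g" for g
  proof -
    interpret nat_maximal_pair p g by fact
    define v where "v = of_int a * polyX ^ s"
    have vq: "v ^ (p ^ j) = of_int (a ^ (p ^ j)) * polyX ^ n"
      by (simp add: v_def kn(2) power_mult_distrib power_mult mult.commute[of "p ^ j"])
    have yq: "(y ^ m) ^ (p ^ j) = (y ^ (p ^ j)) ^ m" by (simp add: mult.commute flip: power_mult)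
    have F: "F = W ^ m - of_int a * polyX ^ n" by (simp add: fpoly_eq W_def)
    have WT: "W + of_int P * T = y ^ (p ^ j)" unfolding T by simp
    have PT: "of_int P * T \<in> M" by (rule pideal_p)
    then have "icong M W (y ^ (p ^ j))" unfolding T icong_def using M_ideal(6) by fastforce
    then have "icong M F ((y ^ m) ^ (p ^ j) - v ^ (p ^ j))"
      unfolding F vq yq of_int_power by (intro cong1(5) cong1(7) cong1(6) cong1(1) cong1(2)[OF cong1_fermat])
    then have FM: "F \<in> M \<longleftrightarrow> g2 \<in> M"
      using cong1(8) power_prime_diff_iff unfolding g2_def v_def by blast
    show ?thesis
    proof (cases "g2 \<in> M")
      case True
      have 1: "(y ^ m) ^ (p ^ j) - v ^ (p ^ j) \<in> M2"
        using cong2_power[of "y ^ m" v "p ^ j"] True j by (simp add: icong_def g2_def v_def)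
      have 2: "(y ^ (p ^ j)) ^ m - (W ^ m + of_nat m * W ^ (m - 1) * (of_int P * T)) \<in> M2"
        using power_first_order[OF PT, of W m] unfolding WT .
      have "F = (((y ^ m) ^ (p ^ j) - v ^ (p ^ j)) - ((y ^ (p ^ j)) ^ m - (W ^ m + of_nat m * W ^ (m - 1) * (of_int P * T))))
        + (of_int (a ^ (p ^ j) - a) * polyX ^ n - of_nat m * W ^ (m - 1) * (of_int P * T))"
        unfolding F vq yq by (simp add: algebra_simps)
      also have "of_int (a ^ (p ^ j) - a) * polyX ^ n - of_nat m * W ^ (m - 1) * (of_int P * T) = of_int P * g1"
        unfolding a1 g1_def by (simp add: algebra_simps)
      finally have "F \<in> M2 \<longleftrightarrow> of_int P * g1 \<in> M2"
        using M2_diff_cancel(3)[OF M2_ideal(5)[OF 1 2]] by metis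
      then show ?thesis using True M2_p_mult by simp
    qed (use FM M2_subset in blast)
  qed
  moreover have "monic g2" using monic_g2 by (simp add: g2_def y_def fpoly_eq)
  ultimately show ?thesis
    unfolding in_square_def g1 g2 not_coprime_m_iff[OF p \<open>monic g2\<close>] by blast
qed

text \<open>For an M containing X, both (X^k + c)^m and a X^n lie in M^2.\<close>

lemma case_iii_square:
  assumes c: "P dvd c" and n2: "n \<ge> 2" and m: "m \<ge> 2 \<or> P ^ 2 dvd c"
  shows in_square
proof -
  obtain g where g: "nat_maximal_pair p g" and X: "polyX \<in> pideal P g" by (rule pair_X)
  interpret nat_maximal_pair p g by fact
  have h: "polyX ^ k + of_int c \<in> M" using X c km by (intro M_ideal(2)) (auto simp: M_of_int M_power)
  have "(polyX ^ k + of_int c) ^ m \<in> M2"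
  proof (cases "m \<ge> 2")
    case True then show ?thesis by (rule M2_power[OF h])
  next
    case False
    then have m: "m = 1" "P ^ 2 dvd c" using m km by auto
    have "polyX ^ k \<in> M2" using kmn n2 m by (intro M2_power[OF X]) simp
    moreover have "of_int c \<in> M2" unfolding M2_of_int by (rule m(2))
    ultimately show ?thesis unfolding m(1) power_one_right by (rule M2_ideal(2))
  qed
  moreover have "of_int a * polyX ^ n \<in> M2" using M2_ideal(4)[OF M2_power[OF X n2]] .
  ultimately have "F \<in> M2" unfolding fpoly_eq by (rule M2_ideal(5))
  then show ?thesis unfolding in_square_def using g by blast
qed

text \<open>At a common zero of \<open>F\<close> and \<open>F'\<close> the element \<open>\<delta> = (km - n) X\<^sup>k - n c\<close> vanishes. Expanding
  \<open>(X\<^sup>k + c)\<^bsup>m k'\<^esup> - (a X\<^sup>n)\<^bsup>k'\<^esup>\<close> to first order in \<open>\<delta>\<close> gives a unit multiple of \<open>C - E\<close>.\<close>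

lemma case_vii_local:
  assumes c: "\<not> P dvd c" and a: "\<not> P dvd a" and k: "\<not> p dvd k" and m: "\<not> p dvd m"
    and kn: "k = t * k'" "n = t * n'"
    and g: "nat_maximal_pair p g" "F \<in> pideal P g" "pderiv F \<in> pideal P g"
  shows "F \<in> pideal_sq P g \<longleftrightarrow>
    P ^ 2 dvd int (k * m) ^ (k' * m) * c ^ (k' * m - n') - a ^ k' * int n ^ n' * int (k * m - n) ^ (k' * m - n')"
proof -
  interpret nat_maximal_pair p g by fact
  have X: "polyX \<notin> M" using X_notin_if_unit_const[OF c km(3,1) g(2)] .
  define h D where "h = polyX ^ k + of_int c" and "D = k * m - n"
  define B where "B = of_int a * polyX ^ n"
  have F: "F = h ^ m - B" by (simp add: fpoly_eq h_def B_def)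
  have D: "int n + int D = int k * int m" using kmn by (simp add: D_def of_nat_diff)
  define \<delta> where "\<delta> = of_nat D * polyX ^ k - of_int (int n * c)"
  have DX: "of_nat D * polyX ^ k = of_int (int n * c) + \<delta>" by (simp add: \<delta>_def)
  have D': "(of_nat n + of_nat D :: int poly) = of_nat k * of_nat m"
    using arg_cong[OF D, of "of_int :: int \<Rightarrow> int poly"] by simp
  have Dh: "of_nat D * h = of_int (int k * int m * c) + \<delta>"
  proof -
    have "of_nat D * h = of_int (int n * c) + \<delta> + of_nat D * of_int c"
      by (simp only: h_def distrib_left DX)
    also have "\<dots> = (of_nat n + of_nat D) * of_int c + \<delta>" by (simp add: algebra_simps)
    finally show ?thesis unfolding D' by simp
  qed
  have B: "B \<notin> M" using a X by (simp add: B_def M_prime M_power M_of_int)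
  have hM: "h \<notin> M"
  proof
    assume "h \<in> M"
    then have "h ^ m \<in> M" using km by (simp add: M_power)
    then show False using g(2) B M_ideal(5)[of "h ^ m" "h ^ m - B"] unfolding F by simp
  qed
  have "h ^ m = h * h ^ (m - 1)" using km by (simp flip: power_Suc)
  \<comment> \<open>This combination cancels a X^n and leaves, up to sign, the unit h^(m-1) times
    \<delta>.\<close>
  then have "of_nat n * F - polyX * pderiv F = h ^ (m - 1) * (of_nat n * h - of_nat k * of_nat m * polyX ^ k)"
    unfolding X_pderiv_fpoly[OF km(1,3), of a c m, folded h_def] unfolding F by (simp add: B_def algebra_simps)
  also have "of_nat n * h - of_nat k * of_nat m * polyX ^ k = - \<delta>"
    unfolding D'[symmetric] by (simp add: \<delta>_def h_def algebra_simps)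
  finally have "h ^ (m - 1) * - \<delta> \<in> M" using M_ideal(4,5) g(2,3) by metis
  then have "- \<delta> \<in> M" using hM unfolding M_prime M_power by blast
  then have \<delta>: "\<delta> \<in> M" using M_ideal(6)[of "- \<delta>"] by simp
  have kmM: "\<not> p dvd k * m" using k m p by (simp add: prime_dvd_mult_iff)
  have pD: "\<not> p dvd D"
  proof
    assume "p dvd D"
    then have "of_nat D * h \<in> M" using M_ideal(3) M_of_nat by blast
    then have "of_int (int k * int m * c) \<in> M" unfolding Dh using \<delta> M_diff_cancel(2) by blast
    then show False using kmM c pp by (simp add: M_of_int M_of_nat M_prime prime_dvd_mult_iff)
  qed
  have tk: "\<not> p dvd t" "\<not> p dvd k'" using k kn(1) by auto
  have n': "n' > 0" using km kn by (cases n') auto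
  have n'': "n' < k' * m" using kmn kn by (simp add: mult.assoc)
  define r s where "r = k' * m" and "s = r - n'"
  have rs: "r = s + n'" using n'' by (simp add: r_def s_def)
  have r0: "r > 0" using n'' unfolding r_def by (rule le_less_trans[OF le0])
  define K where "K = int k * int m * c"
  \<comment> \<open>Z is the value at \<delta> = 0 of D^r G, expanded in \<delta>, and Y is its
    first-order coefficient.\<close>
  define Z where "Z = K ^ r - a ^ k' * int D ^ s * (int n * c) ^ n'"
  define Y where "Y = int r * K ^ (r - 1) - a ^ k' * int D ^ s * (int n' * (int n * c) ^ (n' - 1))"
  \<comment> \<open>Raising to the power k' turns X^(n k') into (X^k)^n', so that F is traded for an
    expression in X^k alone; the factor k' B^(k'-1) that arises is a unit.\<close>
  define G where "G = h ^ r - of_int (a ^ k') * (polyX ^ k) ^ n'"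
  have Bk: "B ^ k' = of_int (a ^ k') * (polyX ^ k) ^ n'"
    unfolding B_def power_mult_distrib kn by (simp add: mult_ac flip: power_mult)
  have hr: "(h ^ m) ^ k' = h ^ r" by (simp add: r_def mult.commute flip: power_mult)
  have FG: "F \<in> M2 \<longleftrightarrow> G \<in> M2"
  proof -
    have hm: "h ^ m = B + F" by (simp add: F)
    have "(B + F) ^ k' - (B ^ k' + of_nat k' * B ^ (k' - 1) * F) \<in> M2" by (rule power_first_order[OF g(2)])
    then have "G - of_nat k' * B ^ (k' - 1) * F \<in> M2"
      unfolding hm[symmetric] hr Bk G_def by (simp add: algebra_simps)
    then have "G \<in> M2 \<longleftrightarrow> of_nat k' * B ^ (k' - 1) * F \<in> M2" by (rule M2_diff_iff)
    also have "\<dots> \<longleftrightarrow> F \<in> M2" using tk B by (intro M2_unit_mult) (simp add: M_prime M_power M_of_nat)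
    finally show ?thesis ..
  qed
  have "of_nat D ^ r * G = (of_nat D * h) ^ r - of_int (a ^ k' * int D ^ s) * (of_nat D * polyX ^ k) ^ n'"
    unfolding G_def rs by (simp add: power_mult_distrib power_add algebra_simps)
  then have DG: "of_nat D ^ r * G = (of_int K + \<delta>) ^ r - of_int (a ^ k' * int D ^ s) * (of_int (int n * c) + \<delta>) ^ n'"
    unfolding Dh DX K_def .
  define u1 where "u1 = (of_int K + \<delta>) ^ r - (of_int K ^ r + of_nat r * of_int K ^ (r - 1) * \<delta>)"
  define u2 where "u2 = (of_int (int n * c) + \<delta>) ^ n'
    - (of_int (int n * c) ^ n' + of_nat n' * of_int (int n * c) ^ (n' - 1) * \<delta>)"
  have u: "u1 \<in> M2" "u2 \<in> M2" unfolding u1_def u2_def by (rule power_first_order[OF \<delta>])+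
  have "of_nat D ^ r * G = (u1 - of_int (a ^ k' * int D ^ s) * u2) + (of_int Z + \<delta> * of_int Y)"
    unfolding DG u1_def u2_def Z_def Y_def by (simp add: algebra_simps)
  moreover have "u1 - of_int (a ^ k' * int D ^ s) * u2 \<in> M2" using u M2_ideal(4,5) by blast
  ultimately have GZ: "of_nat D ^ r * G \<in> M2 \<longleftrightarrow> of_int Z + \<delta> * of_int Y \<in> M2"
    using M2_diff_cancel(3) by metis
  \<comment> \<open>K = t c (k' m) and n c = t c n' are both t c times the exponents r and n' of
    their powers in Z, so t c Y = Z. Hence t c (Z + \<delta> Y) = (t c + \<delta>) Z, where t c +
    \<delta> is a unit.\<close>
  have tY: "int t * c * Y = Z"
  proof -
    have "K = int t * c * (int k' * int m)" by (simp add: K_def kn(1) mult_ac)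
    then have "int t * c * (int r * K ^ (r - 1)) = K * K ^ (r - 1)" by (simp add: r_def)
    also have "\<dots> = K ^ r" using r0 by (simp flip: power_Suc)
    finally have 1: "int t * c * (int r * K ^ (r - 1)) = K ^ r" .
    have "int t * c * (int n' * (int n * c) ^ (n' - 1)) = (int n * c) * (int n * c) ^ (n' - 1)"
      by (simp add: kn(2))
    also have "\<dots> = (int n * c) ^ n'" using n' by (simp flip: power_Suc)
    finally have 2: "int t * c * (int n' * (int n * c) ^ (n' - 1)) = (int n * c) ^ n'" .
    have "int t * c * Y = int t * c * (int r * K ^ (r - 1))
      - a ^ k' * int D ^ s * (int t * c * (int n' * (int n * c) ^ (n' - 1)))"
      by (simp only: Y_def right_diff_distrib mult_ac)
    then show ?thesis unfolding 1 2 Z_def .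
  qed
  have tc: "of_int (int t * c) \<notin> M" using tk c pp by (simp add: M_of_int prime_dvd_mult_iff del: of_int_mult)
  have "F \<in> M2 \<longleftrightarrow> of_nat D ^ r * G \<in> M2"
    unfolding FG using pD by (intro M2_unit_mult[symmetric]) (simp add: M_power M_of_nat)
  also have "\<dots> \<longleftrightarrow> of_int (int t * c) * (of_int Z + \<delta> * of_int Y) \<in> M2"
    unfolding GZ using M2_unit_mult[OF tc] by blast
  also have "of_int (int t * c) * (of_int Z + \<delta> * of_int Y) = of_int (int t * c) * of_int Z + \<delta> * of_int (int t * c * Y)"
    by (simp add: algebra_simps)
  also have "\<dots> = (of_int (int t * c) + \<delta>) * of_int Z" unfolding tY by (simp add: algebra_simps)
  also have "\<dots> \<in> M2 \<longleftrightarrow> P ^ 2 dvd Z"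
  proof -
    have "of_int (int t * c) + \<delta> \<notin> M" using tc \<delta> M_diff_cancel(2) by blast
    then show ?thesis using M2_unit_mult M2_of_int by blast
  qed
  \<comment> \<open>Splitting off the unit c^n' leaves C - E.\<close>
  also have "Z = c ^ n' * (int (k * m) ^ r * c ^ (r - n') - a ^ k' * int n ^ n' * int D ^ s)"
  proof -
    have "K ^ r = c ^ n' * (int (k * m) ^ r * c ^ s)"
      unfolding K_def rs by (simp add: power_mult_distrib power_add mult_ac)
    then show ?thesis by (simp add: Z_def s_def power_mult_distrib algebra_simps)
  qed
  also have "P ^ 2 dvd \<dots> \<longleftrightarrow> P ^ 2 dvd int (k * m) ^ r * c ^ (r - n') - a ^ k' * int n ^ n' * int D ^ s"
    (is "P ^ 2 dvd c ^ n' * ?E \<longleftrightarrow> _")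
  proof -
    have "of_int (c ^ n') \<notin> M" using c by (simp add: M_power M_of_int)
    from M2_unit_mult[OF this, of "of_int ?E"] show ?thesis
      unfolding of_int_mult[symmetric] M2_of_int .
  qed
  finally show ?thesis by (simp add: r_def s_def D_def)
qed

section \<open>From membership in M^2 to the stated conditions\<close>

definition double_root :: bool where
  "double_root \<longleftrightarrow> (\<exists>g. nat_maximal_pair p g \<and> F \<in> pideal P g \<and> pderiv F \<in> pideal P g)"

lemma double_root_if_in_square: "in_square \<Longrightarrow> double_root"
  unfolding in_square_def double_root_def nat_maximal_pair_def
  using nat_maximal_pair.pderiv_in_M maximal_pair.M2_subset nat_maximal_pair.intro by metis

lemma dvd_div_prime: "P * ((x ^ (p ^ j) - x) div P) = x ^ (p ^ j) - x"
  using prime_dvd_power_minus_self[OF p] by (rule dvd_mult_div_cancel)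

lemma multiplicity_pos: "x \<noteq> 0 \<Longrightarrow> p dvd x \<Longrightarrow> multiplicity p x > 0"
  using multiplicity_gt_zero_iff[of x p] prime_gt_1_nat[OF p] by auto

lemma gcd_quotients:
  shows "k = gcd n k * (k div gcd n k)" "n = gcd n k * (n div gcd n k)"
    "gcd n k > 0" "gcd (k div gcd n k) (n div gcd n k) = 1"
  using km coprime_imp_gcd_eq_1[OF div_gcd_coprime[of n k]] by (simp_all add: gcd.commute)

lemma cond_case_ii:
  assumes c: "P dvd c" and a: "\<not> P dvd a" and n: "n = 1" and double_root
  shows "in_square \<longleftrightarrow> \<not> cond a c k m n p"
proof -
  define N j c2 a1 where "N = k * m - 1" and "j = multiplicity p (k * m - 1)" and "c2 = c div P"
    and "a1 = (a ^ (p ^ j) - a) div P"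
  have cond: "cond a c k m n p \<longleftrightarrow> (P dvd c2 \<and> \<not> P dvd a1) \<or>
      \<not> P dvd (c2 * (a ^ k * a1 ^ N - (- int m * a * c2) ^ N))"
    unfolding cond_def Let_def N_def j_def c2_def a1_def using c a n by simp
  have pN: "p dvd N" unfolding N_def using case_ii_local(3)[OF c a n] \<open>double_root\<close> unfolding double_root_def by blast
  have N0: "N > 0" using kmn n by (simp add: N_def)
  have j: "p ^ j dvd N" "j > 0"
    unfolding j_def N_def[symmetric] using multiplicity_dvd multiplicity_pos[OF _ pN] N0 by auto
  \<comment> \<open>km - 1 and k are coprime, so the binomial system is used with t = 1.\<close>
  have cop: "gcd N k = 1"
  proof -
    have "k * m = N + 1" using N0 by (simp add: N_def)
    then have "gcd N k dvd N + 1" by (metis dvd_mult2 gcd_dvd2)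
    then have "gcd N k dvd 1" by (metis dvd_add_right_iff gcd_dvd1)
    then show ?thesis by simp
  qed
  have sq: "in_square \<longleftrightarrow> (\<exists>g. nat_maximal_pair p g \<and> polyX ^ N - of_int a \<in> pideal P g \<and>
    of_int a1 * polyX ^ k + of_int (int m * a * c2) \<in> pideal P g)"
    unfolding N_def
  proof (rule case_ii[OF _ a n])
    show "c = P * c2" using c by (simp add: c2_def)
    show "a ^ (p ^ j) - a = P * a1" unfolding a1_def by (rule dvd_div_prime[symmetric])
  qed (use j in \<open>simp_all add: N_def\<close>)
  show ?thesis
  proof (cases "P dvd c2")
    case True
    then have "P dvd int m * a * c2" by simp
    from sq binomial_system_zero[OF p a this N0, of a1 k] have "in_square \<longleftrightarrow> P dvd a1" by (simp only:)
    then show ?thesis using True by (simp add: cond)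
  next
    case False
    have "\<not> p dvd m"
    proof
      assume "p dvd m"
      moreover have "N + 1 = k * m" using N0 by (simp add: N_def)
      ultimately have "p dvd N + 1" by simp
      then have "p dvd 1" using pN by (metis dvd_add_right_iff)
      then show False using p by simp
    qed
    then have "\<not> P dvd int m * a * c2" using False a pp by (simp add: prime_dvd_mult_iff)
    from sq binomial_system_unit[OF p a this _ cop N0, of 1 a1]
    have "in_square \<longleftrightarrow> P dvd a ^ k * a1 ^ N - (- (int m * a * c2)) ^ N"
      by (simp only: mult_1 zero_less_one)
    then show ?thesis using False pp by (simp add: cond prime_dvd_mult_iff)
  qed
qed

lemma cond_case_iii:
  assumes c: "P dvd c" and a: "\<not> P dvd a" and n: "n \<ge> 2"
  shows "in_square \<longleftrightarrow> \<not> cond a c k m n p"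
proof -
  define l c2 a1 n' k' where "l = multiplicity p (k - n)" and "c2 = c div P"
    and "a1 = (a ^ (p ^ l) - a) div P" and "n' = n div gcd n k" and "k' = k div gcd n k"
  have cond: "cond a c k m n p \<longleftrightarrow> m = 1 \<and> ((P dvd a1 \<and> \<not> P dvd c2) \<or>
      \<not> P dvd (a1 * c2 ^ (n - 1) * (a ^ n' * a1 ^ (k' - n') - (- c2) ^ (k' - n'))))"
    unfolding cond_def Let_def l_def c2_def a1_def n'_def k'_def using c a n by simp
  have cc: "c = P * c2" using c by (simp add: c2_def)
  show ?thesis
  proof (cases "m = 1 \<and> \<not> P dvd c2")
    case False
    \<comment> \<open>Here an M containing X has F in its square. On the other side, n >= 2 makes
      c2^(n-1) divisible by p when c2 is, so the condition fails too.\<close>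
    have "m \<ge> 2 \<or> P ^ 2 dvd c"
      using False km cc by (cases "m = 1") (auto simp: power2_eq_square)
    then have in_square by (rule case_iii_square[OF c n])
    moreover have "P dvd c2 \<longrightarrow> P dvd c2 ^ (n - 1)" using n by (simp add: prime_dvd_power_iff[OF pp])
    then have "\<not> cond a c k m n p" using False unfolding cond by auto
    ultimately show ?thesis by blast
  next
    case True
    then have m: "m = 1" and c2: "\<not> P dvd c2" by auto
    define N where "N = k' - n'"
    have kn: "k = gcd n k * k'" "n = gcd n k * n'" "gcd n k > 0" "gcd k' n' = 1"
      using gcd_quotients unfolding n'_def k'_def by auto
    have kN: "k - n = gcd n k * N" using kn by (metis N_def diff_mult_distrib2)
    have kn0: "k - n > 0" using kmn m by simp
    then have N0: "N > 0" using kN by (cases N) auto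
    have "k' = N + n'" using N0 by (simp add: N_def)
    then have cop: "gcd N n' = 1" using kn(4) by simp
    define Z where "Z = a ^ n' * a1 ^ N - (- c2) ^ N"
    have cond': "cond a c k m n p \<longleftrightarrow> P dvd a1 \<or> \<not> P dvd Z"
    proof -
      have "\<not> P dvd c2 ^ (n - 1)" using c2 prime_dvd_power[OF pp] by blast
      then show ?thesis unfolding cond N_def[symmetric] Z_def[symmetric] using m c2 pp
        by (auto simp: prime_dvd_mult_iff)
    qed
    \<comment> \<open>For p | a1 only (-c2)^N remains of Z, a unit; the two alternatives in the
      condition thus merge into p not dividing Z.\<close>
    have a1Z: "\<not> P dvd Z" if "P dvd a1"
    proof
      assume Z: "P dvd Z"
      have "P dvd a1 ^ N" using that N0 by (simp add: prime_dvd_power_iff[OF pp])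
      then have "P dvd a ^ n' * a1 ^ N" by simp
      then have "P dvd (- c2) ^ N" using Z unfolding Z_def by (metis dvd_diff_right_iff)
      then have "P dvd - c2" by (rule prime_dvd_power[OF pp])
      then show False using c2 by simp
    qed
    show ?thesis
    proof (cases "p dvd k - n")
      case False
      \<comment> \<open>With exponent p^0 = 1 the quotient a1 is 0, and the condition holds through
        p | a1.\<close>
      then have "l = 0" unfolding l_def by (simp add: not_dvd_imp_multiplicity_0)
      then have "a1 = 0" by (simp add: a1_def)
      then show ?thesis using case_iii_separable[OF cc a m n c2 False] cond' by simp
    next
      case pkn: True
      have l: "p ^ l dvd k - n" "l > 0"
        unfolding l_def using multiplicity_dvd multiplicity_pos[OF _ pkn] kn0 by auto
      have a1: "a ^ (p ^ l) - a = P * a1" unfolding a1_def by (rule dvd_div_prime[symmetric])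
      have "in_square \<longleftrightarrow> (\<exists>g. nat_maximal_pair p g \<and> polyX ^ (gcd n k * N) - of_int a \<in> pideal P g \<and>
        of_int a1 * polyX ^ (gcd n k * n') + of_int c2 \<in> pideal P g)"
        using case_iii_reduced[OF cc m n c2 l a1] unfolding kN kn(2)[symmetric] .
      also have "\<dots> \<longleftrightarrow> P dvd Z"
        unfolding Z_def by (rule binomial_system_unit[OF p a c2 kn(3) cop N0])
      finally show ?thesis using cond' a1Z by blast
    qed
  qed
qed

lemma cond_case_iv:
  assumes c: "\<not> P dvd c" and a: "P dvd a" and double_root
  shows "in_square \<longleftrightarrow> \<not> cond a c k m n p"
proof (cases "m \<ge> 2")
  case True
  then have "cond a c k m n p \<longleftrightarrow> \<not> P ^ 2 dvd a"
    unfolding cond_def Let_def using c a by simp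
  then show ?thesis using case_iv_a[OF c a True] by simp
next
  case False
  then have m: "m = 1" using km by simp
  define l a2 c1 n' k' where "l = multiplicity p k" and "a2 = - a div P"
    and "c1 = ((- c) ^ (p ^ l) + c) div P" and "n' = n div gcd n k" and "k' = k div gcd n k"
  define Z where "Z = (- c) ^ n' * a2 ^ k' - (- c1) ^ k'"
  have cond: "cond a c k m n p \<longleftrightarrow> (P dvd a2 \<and> \<not> P dvd c1) \<or> \<not> P dvd (a2 * Z)"
    unfolding cond_def Let_def l_def a2_def c1_def n'_def k'_def Z_def using c a m by (simp add: mult.commute)
  have pk: "p dvd k" using p_dvd_k_if_double_root[OF c a m] \<open>double_root\<close> unfolding double_root_def by blast
  have l: "p ^ l dvd k" "l > 0" unfolding l_def using multiplicity_dvd multiplicity_pos[OF _ pk] km by auto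
  have kn: "k = gcd n k * k'" "n = gcd n k * n'" "gcd n k > 0" "gcd k' n' = 1"
    using gcd_quotients unfolding n'_def k'_def by auto
  have k0: "k' > 0" using kn(1) km by (cases k') auto
  have c': "\<not> P dvd - c" using c by simp
  have a2: "a = - (P * a2)" using a by (simp add: a2_def)
  have c1: "(- c) ^ (p ^ l) + c = P * c1" using dvd_div_prime[of "- c" l] by (simp add: c1_def)
  have sq: "in_square \<longleftrightarrow> (\<exists>g. nat_maximal_pair p g \<and> polyX ^ k - of_int (- c) \<in> pideal P g \<and>
    of_int a2 * polyX ^ n + of_int c1 \<in> pideal P g)"
    by (rule case_iv_b[OF a2 m l c1])
  show ?thesis
  proof (cases "P dvd c1")
    case True
    have "in_square \<longleftrightarrow> P dvd a2" unfolding sq by (rule binomial_system_zero[OF p c' True km(1)])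
    \<comment> \<open>For p | c1, Z is (-c)^n' a2^k' modulo p, so a2 Z is divisible by p exactly
      when a2 is.\<close>
    moreover have "P dvd Z \<longrightarrow> P dvd a2"
    proof
      assume Z: "P dvd Z"
      have "P dvd (- c1) ^ k'" using True k0 by (simp add: prime_dvd_power_iff[OF pp])
      then have "P dvd (- c) ^ n' * a2 ^ k'" using Z unfolding Z_def by (metis dvd_diff_left_iff)
      then show "P dvd a2" using c' pp by (meson prime_dvd_mult_iff prime_dvd_power)
    qed
    ultimately show ?thesis unfolding cond using True pp by (auto simp: prime_dvd_mult_iff)
  next
    case False
    have "in_square \<longleftrightarrow> (\<exists>g. nat_maximal_pair p g \<and> polyX ^ (gcd n k * k') - of_int (- c) \<in> pideal P g \<and>
      of_int a2 * polyX ^ (gcd n k * n') + of_int c1 \<in> pideal P g)"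
      using sq unfolding kn(1)[symmetric] kn(2)[symmetric] .
    also have "\<dots> \<longleftrightarrow> P dvd Z"
      unfolding Z_def by (rule binomial_system_unit[OF p c' False kn(3,4) k0])
    finally have "in_square \<longleftrightarrow> P dvd Z" .
    \<comment> \<open>For p | a2 the product a2 Z vanishes modulo p although Z is a unit; the first
      alternative of the condition covers this.\<close>
    moreover have "\<not> P dvd Z" if "P dvd a2"
    proof
      assume Z: "P dvd Z"
      have "P dvd a2 ^ k'" using that k0 by (simp add: prime_dvd_power_iff[OF pp])
      then have "P dvd (- c) ^ n' * a2 ^ k'" by simp
      then have "P dvd (- c1) ^ k'" using Z unfolding Z_def by (metis dvd_diff_right_iff)
      then have "P dvd - c1" by (rule prime_dvd_power[OF pp])
      then show False using False by simp
    qed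
    ultimately show ?thesis unfolding cond using False pp by (auto simp: prime_dvd_mult_iff)
  qed
qed

lemma cond_case_v:
  assumes c: "\<not> P dvd c" and a: "\<not> P dvd a" and pk: "p dvd k" and double_root
  shows "in_square \<longleftrightarrow> \<not> cond a c k m n p"
proof -
  define j where "j = multiplicity p (gcd k n)"
  have ca: "\<not> P dvd c * a" using c a pp by (simp add: prime_dvd_mult_iff)
  have cond: "cond a c k m n p \<longleftrightarrow> poly_mod.coprime_m P
      (monom ((a ^ (p ^ j) - a) div P) n
        - Polynomial.smult (int m) (tpoly p j (k div p ^ j) c * (monom 1 k + [:c:]) ^ (m - 1)))
      ((monom 1 (k div p ^ j) + [:c:]) ^ m - monom a (n div p ^ j))"
    unfolding cond_def Let_def j_def using c a ca pk by simp
  have pn: "p dvd n" using p_dvd_n_if_double_root[OF c a] pk \<open>double_root\<close> unfolding double_root_def by auto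
  \<comment> \<open>The double root supplies p | n, without which j would be 0.\<close>
  have j: "j > 0" unfolding j_def using km pk pn by (intro multiplicity_pos) auto
  have "p ^ j dvd gcd k n" unfolding j_def by (rule multiplicity_dvd)
  then have "k = p ^ j * (k div p ^ j)" "n = p ^ j * (n div p ^ j)" by auto
  from case_v[OF this j dvd_div_prime[symmetric]] show ?thesis unfolding cond .
qed

lemma cond_case_vi:
  assumes c: "\<not> P dvd c" and a: "\<not> P dvd a" and k: "\<not> p dvd k" and m: "p dvd m" and double_root
  shows "in_square \<longleftrightarrow> \<not> cond a c k m n p"
proof -
  have ca: "\<not> P dvd c * a" "\<not> P dvd c * a * int k" using c a k pp by (simp_all add: prime_dvd_mult_iff)
  have pn: "p dvd n" using p_dvd_n_if_double_root[OF c a] m \<open>double_root\<close> unfolding double_root_def by auto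
  have "cond a c k m n p \<longleftrightarrow> \<not> P ^ 2 dvd (a ^ p - a)"
    unfolding cond_def Let_def using c a ca k m pn by simp
  then show ?thesis using case_vi[OF c a m pn] by simp
qed

lemma cond_case_vii:
  assumes c: "\<not> P dvd c" and a: "\<not> P dvd a" and k: "\<not> p dvd k" and m: "\<not> p dvd m" and double_root
  shows "in_square \<longleftrightarrow> \<not> cond a c k m n p"
proof -
  define n' k' where "n' = n div gcd n k" and "k' = k div gcd n k"
  define E where "E = int (k * m) ^ (k' * m) * c ^ (k' * m - n') - a ^ k' * int n ^ n' * int (k * m - n) ^ (k' * m - n')"
  have ca: "\<not> P dvd c * a" "\<not> P dvd c * a * int k" using c a k pp by (simp_all add: prime_dvd_mult_iff)
  have cond: "cond a c k m n p \<longleftrightarrow> \<not> P ^ 2 dvd E"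
    unfolding cond_def Let_def E_def n'_def k'_def using c a ca k m by simp
  have kn: "k = gcd n k * k'" "n = gcd n k * n'" using gcd_quotients unfolding n'_def k'_def by auto
  have local: "F \<in> pideal_sq P g \<longleftrightarrow> P ^ 2 dvd E"
    if "nat_maximal_pair p g" "F \<in> pideal P g" "pderiv F \<in> pideal P g" for g
    unfolding E_def by (rule case_vii_local[OF c a k m kn that])
  \<comment> \<open>The integer E does not involve M, so one maximal ideal with a double root
    decides for all of them.\<close>
  have "in_square \<longleftrightarrow> P ^ 2 dvd E"
  proof
    assume in_square
    then obtain g where g: "nat_maximal_pair p g" "F \<in> pideal_sq P g" unfolding in_square_def by blast
    interpret nat_maximal_pair p g by fact
    show "P ^ 2 dvd E" using local[OF g(1) M2_subset[OF g(2)] pderiv_in_M[OF g(2)]] g(2) by blast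
  next
    assume "P ^ 2 dvd E"
    then show in_square using \<open>double_root\<close> local unfolding double_root_def in_square_def by blast
  qed
  then show ?thesis unfolding cond by blast
qed

theorem in_square_iff_not_cond:
  assumes double_root
  shows "in_square \<longleftrightarrow> \<not> cond a c k m n p"
proof (cases "P dvd c")
  case c: True
  show ?thesis
  proof (cases "P dvd a")
    case a: True
    then have "cond a c k m n p \<longleftrightarrow> m = 1 \<and> \<not> P ^ 2 dvd c"
      unfolding cond_def Let_def using c by simp
    then show ?thesis using case_i[OF c a] by simp
  next
    case a: False
    show ?thesis
    proof (cases "n = 1")
      case True then show ?thesis using cond_case_ii[OF c a True assms] by simp
    next
      case False
      then have "n \<ge> 2" using n1 by simp
      then show ?thesis by (rule cond_case_iii[OF c a])
    qed
  qed
next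
  case c: False
  show ?thesis
  proof (cases "P dvd a")
    case True then show ?thesis by (rule cond_case_iv[OF c _ assms])
  next
    case a: False
    show ?thesis
      using cond_case_v[OF c a _ assms] cond_case_vi[OF c a _ _ assms] cond_case_vii[OF c a _ _ assms] by blast
  qed
qed

end

theorem mainTheorem2:
  fixes a c :: int and k m n :: nat and \<theta> :: complex
  assumes "k * m > n" and "n \<ge> 1"
    and "irreducible (map_poly (of_int :: int \<Rightarrow> rat) (fpoly a c k m n))"
    and "poly (map_poly of_int (fpoly a c k m n)) \<theta> = 0"
  shows "(\<forall>p::nat. prime p \<and> int p dvd disc (fpoly a c k m n) \<longrightarrow>
            (\<not> p dvd order_index \<theta> \<longleftrightarrow> cond a c k m n p))
       \<and> (ring_of_integers (QQ_adj \<theta>) = ZZ_adj \<theta> \<longleftrightarrow>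
            (\<forall>p::nat. prime p \<and> int p dvd disc (fpoly a c k m n) \<longrightarrow> cond a c k m n p))"
proof -
  let ?f = "fpoly a c k m n"
  interpret simple_order ?f \<theta>
    using assms fpoly_monic(1) by unfold_locales auto
  have sq: "p dvd order_index \<theta> \<longleftrightarrow> prime_factor_data.in_square a c k m n p" if "prime p" for p
  proof -
    interpret prime_factor_data a c k m n p using assms(1,2) that by unfold_locales
    show ?thesis using dedekind_criterion[OF that] by (simp add: in_square_def nat_maximal_pair_def)
  qed
  have dr: "int p dvd disc ?f \<longleftrightarrow> prime_factor_data.double_root a c k m n p" if "prime p" for p
  proof -
    interpret prime_factor_data a c k m n p using assms(1,2) that by unfold_locales
    show ?thesis using dvd_disc_iff[OF pp monic degree_pos] by (simp add: double_root_def nat_maximal_pair_def)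
  qed
  have local: "\<not> p dvd order_index \<theta> \<longleftrightarrow> cond a c k m n p" if "prime p" "int p dvd disc ?f" for p
  proof -
    interpret prime_factor_data a c k m n p using assms(1,2) that(1) by unfold_locales
    show ?thesis using in_square_iff_not_cond dr[OF that(1)] that(2) sq[OF that(1)] by blast
  qed
  \<comment> \<open>The global equivalence ranges over primes of the discriminant only; this shows
    that they include all primes of the index.\<close>
  have disc: "int p dvd disc ?f" if "prime p" "p dvd order_index \<theta>" for p
  proof -
    interpret prime_factor_data a c k m n p using assms(1,2) that(1) by unfold_locales
    show ?thesis using double_root_if_in_square dr[OF that(1)] that(2) sq[OF that(1)] by blast
  qed
  have OK: "OK = Zth \<longleftrightarrow> (\<forall>p. prime p \<longrightarrow> \<not> p dvd order_index \<theta>)"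
    unfolding index_eq_1_iff[symmetric] using prime_factor_nat not_prime_unit by (metis nat_dvd_1_iff_1)
  show ?thesis
  proof (intro conjI allI impI)
    fix p assume "prime p \<and> int p dvd disc ?f"
    then show "\<not> p dvd order_index \<theta> \<longleftrightarrow> cond a c k m n p" using local by simp
  next
    show "OK = Zth \<longleftrightarrow> (\<forall>p. prime p \<and> int p dvd disc ?f \<longrightarrow> cond a c k m n p)"
      unfolding OK
    proof (intro iffI allI impI notI)
      fix p assume "\<forall>p. prime p \<longrightarrow> \<not> p dvd order_index \<theta>" "prime p \<and> int p dvd disc ?f"
      then show "cond a c k m n p" using local by simp
    next
      fix p assume *: "\<forall>p. prime p \<and> int p dvd disc ?f \<longrightarrow> cond a c k m n p" "prime p" "p dvd order_index \<theta>"
      from disc[OF *(2,3)] local[OF *(2)] * show False by simp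
    qed
  qed
qed

end
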